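(* Let $\mathsf{B}$ be an abelian category with a projective generator $P$ and let $\lambda$ be a cardinal such that the category $\mathsf{B}$ is locally $\lambda^+$-presentable and the object $P\in\mathsf{B}$ is $\lambda^+$-presentable. Then $Q=P^{(\lambda)}$, the coproduct of $\lambda$ copies of $P$ in $\mathsf{B}$, is a good projective generator of $\mathsf{B}$.
   Context: $\lambda^+$ denotes the successor cardinal of $\lambda$; local $\kappa$-presentability and $\kappa$-presentability are understood for (infinite) regular cardinals $\kappa$, in the usual sense (so "$\kappa$-presentable" means "$<\kappa$-presentable": $\operatorname{Hom}_{\mathsf{B}}(P,-)$ preserves $\kappa$-filtered colimits). Let $\mathsf{B}$ be a locally presentable abelian category with a projective generator $Q$, and let $S=\operatorname{Hom}_{\mathsf{B}}(Q,Q)^{\mathrm{op}}$ be the opposite ring of its endomorphism ring, so that $S$ acts on $Q$ on the right. Consider the exact functor $\Theta_Q=\operatorname{Hom}_{\mathsf{B}}(Q,-)\colon\mathsf{B}\to S\text{-}\mathrm{Mod}$ into the category of left $S$-modules. For an integer $n\ge0$, the projective generator $Q$ is called $n$-good if $\Theta_Q$ induces isomorphisms $\operatorname{Ext}^i_{\mathsf{B}}(B,C)\to\operatorname{Ext}^i_S(\Theta_Q(B),\Theta_Q(C))$ for all $B,C\in\mathsf{B}$ and all $0\le i\le n$. It is called good if it is $n$-good for all $n\ge0$. *)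

theory Defs
  imports "HOL-Algebra.Module" "HOL-Algebra.Coset"
begin

unbundle cardinal_syntax

section \<open>Categories\<close>

record ('o, 'a) category =
  Obj :: "'o set"
  Arr :: "'a set"
  Dom :: "'a \<Rightarrow> 'o"
  Cod :: "'a \<Rightarrow> 'o"
  Ident :: "'o \<Rightarrow> 'a"
  Comp :: "'a \<Rightarrow> 'a \<Rightarrow> 'a"  (infixr \<open>\<cdot>\<index>\<close> 70)

definition Hom :: "('o, 'a, 'z) category_scheme \<Rightarrow> 'o \<Rightarrow> 'o \<Rightarrow> 'a set"
  where "Hom C X Y = {f \<in> Arr C. Dom C f = X \<and> Cod C f = Y}"

locale category =
  fixes C :: "('o, 'a, 'z) category_scheme" (structure)
  assumes Dom_Obj: "f \<in> Arr C \<Longrightarrow> Dom C f \<in> Obj C"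
    and Cod_Obj: "f \<in> Arr C \<Longrightarrow> Cod C f \<in> Obj C"
    and Ident_Hom: "X \<in> Obj C \<Longrightarrow> Ident C X \<in> Hom C X X"
    and Comp_Hom: "f \<in> Hom C X Y \<Longrightarrow> g \<in> Hom C Y Z \<Longrightarrow> g \<cdot> f \<in> Hom C X Z"
    and Comp_Ident: "f \<in> Hom C X Y \<Longrightarrow> f \<cdot> Ident C X = f"
    and Ident_Comp: "f \<in> Hom C X Y \<Longrightarrow> Ident C Y \<cdot> f = f"
    and Comp_assoc: "f \<in> Hom C X Y \<Longrightarrow> g \<in> Hom C Y Z \<Longrightarrow> h \<in> Hom C Z W
      \<Longrightarrow> (h \<cdot> g) \<cdot> f = h \<cdot> (g \<cdot> f)"

definition mono_arr :: "('o, 'a, 'z) category_scheme \<Rightarrow> 'a \<Rightarrow> bool"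
  where "mono_arr C f \<longleftrightarrow> f \<in> Arr C \<and>
    (\<forall>X \<in> Obj C. \<forall>g \<in> Hom C X (Dom C f). \<forall>h \<in> Hom C X (Dom C f).
      f \<cdot>\<^bsub>C\<^esub> g = f \<cdot>\<^bsub>C\<^esub> h \<longrightarrow> g = h)"

definition epi_arr :: "('o, 'a, 'z) category_scheme \<Rightarrow> 'a \<Rightarrow> bool"
  where "epi_arr C f \<longleftrightarrow> f \<in> Arr C \<and>
    (\<forall>X \<in> Obj C. \<forall>g \<in> Hom C (Cod C f) X. \<forall>h \<in> Hom C (Cod C f) X.
      g \<cdot>\<^bsub>C\<^esub> f = h \<cdot>\<^bsub>C\<^esub> f \<longrightarrow> g = h)"

definition is_coproduct ::
    "('o, 'a, 'z) category_scheme \<Rightarrow> 'i set \<Rightarrow> ('i \<Rightarrow> 'o) \<Rightarrow> 'o \<Rightarrow> ('i \<Rightarrow> 'a) \<Rightarrow> bool"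
  where "is_coproduct C I F L \<iota> \<longleftrightarrow>
    L \<in> Obj C \<and> (\<forall>i \<in> I. F i \<in> Obj C \<and> \<iota> i \<in> Hom C (F i) L) \<and>
    (\<forall>Y \<in> Obj C. \<forall>g. (\<forall>i \<in> I. g i \<in> Hom C (F i) Y) \<longrightarrow>
      (\<exists>!h. h \<in> Hom C L Y \<and> (\<forall>i \<in> I. h \<cdot>\<^bsub>C\<^esub> \<iota> i = g i)))"

definition projective :: "('o, 'a, 'z) category_scheme \<Rightarrow> 'o \<Rightarrow> bool"
  where "projective C P \<longleftrightarrow> P \<in> Obj C \<and>
    (\<forall>e. epi_arr C e \<longrightarrow> (\<forall>f \<in> Hom C P (Cod C e). \<exists>g \<in> Hom C P (Dom C e). e \<cdot>\<^bsub>C\<^esub> g = f))"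

definition generator :: "('o, 'a, 'z) category_scheme \<Rightarrow> 'o \<Rightarrow> bool"
  where "generator C P \<longleftrightarrow> P \<in> Obj C \<and>
    (\<forall>X \<in> Obj C. \<forall>Y \<in> Obj C. \<forall>f \<in> Hom C X Y. \<forall>g \<in> Hom C X Y.
      f \<noteq> g \<longrightarrow> (\<exists>h \<in> Hom C P X. f \<cdot>\<^bsub>C\<^esub> h \<noteq> g \<cdot>\<^bsub>C\<^esub> h))"

definition projective_generator :: "('o, 'a, 'z) category_scheme \<Rightarrow> 'o \<Rightarrow> bool"
  where "projective_generator C P \<longleftrightarrow> projective C P \<and> generator C P"

definition is_functor ::
    "('j, 'b, 'y) category_scheme \<Rightarrow> ('o, 'a, 'z) category_scheme \<Rightarrow> ('j \<Rightarrow> 'o) \<Rightarrow> ('b \<Rightarrow> 'a) \<Rightarrow> bool"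
  where "is_functor J C Fo Fa \<longleftrightarrow>
    (\<forall>j \<in> Obj J. Fo j \<in> Obj C \<and> Fa (Ident J j) = Ident C (Fo j)) \<and>
    (\<forall>j \<in> Obj J. \<forall>k \<in> Obj J. \<forall>a \<in> Hom J j k. Fa a \<in> Hom C (Fo j) (Fo k)) \<and>
    (\<forall>j \<in> Obj J. \<forall>k \<in> Obj J. \<forall>l \<in> Obj J. \<forall>a \<in> Hom J j k. \<forall>b \<in> Hom J k l.
      Fa (b \<cdot>\<^bsub>J\<^esub> a) = Fa b \<cdot>\<^bsub>C\<^esub> Fa a)"

definition is_cocone ::
    "('j, 'b, 'y) category_scheme \<Rightarrow> ('o, 'a, 'z) category_scheme \<Rightarrow> ('j \<Rightarrow> 'o) \<Rightarrow> ('b \<Rightarrow> 'a)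
      \<Rightarrow> 'o \<Rightarrow> ('j \<Rightarrow> 'a) \<Rightarrow> bool"
  where "is_cocone J C Fo Fa L t \<longleftrightarrow>
    L \<in> Obj C \<and> (\<forall>j \<in> Obj J. t j \<in> Hom C (Fo j) L) \<and>
    (\<forall>j \<in> Obj J. \<forall>k \<in> Obj J. \<forall>a \<in> Hom J j k. t k \<cdot>\<^bsub>C\<^esub> Fa a = t j)"

definition is_colimit ::
    "('j, 'b, 'y) category_scheme \<Rightarrow> ('o, 'a, 'z) category_scheme \<Rightarrow> ('j \<Rightarrow> 'o) \<Rightarrow> ('b \<Rightarrow> 'a)
      \<Rightarrow> 'o \<Rightarrow> ('j \<Rightarrow> 'a) \<Rightarrow> bool"
  where "is_colimit J C Fo Fa L t \<longleftrightarrow>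
    is_cocone J C Fo Fa L t \<and>
    (\<forall>Y s. is_cocone J C Fo Fa Y s \<longrightarrow>
      (\<exists>!h. h \<in> Hom C L Y \<and> (\<forall>j \<in> Obj J. h \<cdot>\<^bsub>C\<^esub> t j = s j)))"

section \<open>Smallness, presentable objects, locally presentable categories\<close>

text \<open>
  There are no proper classes in HOL, so smallness is relative to a cardinal \<open>u\<close>: a set is small
  when its cardinality is below \<open>u\<close>. For a strongly inaccessible \<open>u\<close> these are the small sets of a
  Grothendieck universe, and all notions below are the usual ones. The only closure property asked
  for, besides regularity, is closure under \<open>l\<close>-th powers for one given cardinal \<open>l\<close>. A strongly
  inaccessible \<open>u\<close> has it for every \<open>l\<close> below \<open>u\<close>; so does the successor of \<open>2 ^ l\<close> for infinite
  \<open>l\<close>, which exists in HOL, so the condition can be met without assuming inaccessible cardinals.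
\<close>

definition smallness_cardinal :: "'u rel \<Rightarrow> 'l rel \<Rightarrow> bool"
  where "smallness_cardinal u l \<longleftrightarrow> Cinfinite u \<and> regularCard u \<and>
    (\<forall>A \<subseteq> Field u. |A| <o u \<longrightarrow> |A| ^c l <o u)"

text \<open>
  The index categories of small diagrams have objects and arrows in the type of \<open>u\<close>; every category
  with fewer than \<open>u\<close> arrows is isomorphic to one of these.
\<close>

definition small_category :: "'u rel \<Rightarrow> ('u, 'u) category \<Rightarrow> bool"
  where "small_category u J \<longleftrightarrow> category J \<and> |Arr J| <o u"

definition filtered_category :: "'k rel \<Rightarrow> ('j, 'b, 'y) category_scheme \<Rightarrow> bool"
  where "filtered_category \<kappa> J \<longleftrightarrow> category J \<and>
    (\<forall>D E. D \<subseteq> Obj J \<and> E \<subseteq> Arr J \<and> |D| <o \<kappa> \<and> |E| <o \<kappa> \<and>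
       (\<forall>e \<in> E. Dom J e \<in> D \<and> Cod J e \<in> D) \<longrightarrow>
       (\<exists>c \<in> Obj J. \<exists>t. (\<forall>x \<in> D. t x \<in> Hom J x c) \<and>
          (\<forall>e \<in> E. t (Cod J e) \<cdot>\<^bsub>J\<^esub> e = t (Dom J e))))"

text \<open>
  The colimit of the sets \<open>Hom C P (Fo j)\<close> is their disjoint union modulo the equivalence relation
  generated by \<open>colim_step\<close>. Preservation means that the canonical map from it to \<open>Hom C P L\<close>
  is surjective and injective.
\<close>

definition colim_step ::
    "('j, 'b, 'y) category_scheme \<Rightarrow> ('o, 'a, 'z) category_scheme \<Rightarrow> 'o \<Rightarrow> ('j \<Rightarrow> 'o) \<Rightarrow> ('b \<Rightarrow> 'a)
      \<Rightarrow> ('j \<times> 'a) rel"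
  where "colim_step J C P Fo Fa =
    {((j, g), (k, Fa a \<cdot>\<^bsub>C\<^esub> g)) | j k a g.
       j \<in> Obj J \<and> k \<in> Obj J \<and> a \<in> Hom J j k \<and> g \<in> Hom C P (Fo j)}"

definition Hom_preserves_colimit ::
    "('j, 'b, 'y) category_scheme \<Rightarrow> ('o, 'a, 'z) category_scheme \<Rightarrow> 'o \<Rightarrow> ('j \<Rightarrow> 'o) \<Rightarrow> ('b \<Rightarrow> 'a)
      \<Rightarrow> 'o \<Rightarrow> ('j \<Rightarrow> 'a) \<Rightarrow> bool"
  where "Hom_preserves_colimit J C P Fo Fa L t \<longleftrightarrow>
    (\<forall>f \<in> Hom C P L. \<exists>j \<in> Obj J. \<exists>g \<in> Hom C P (Fo j). f = t j \<cdot>\<^bsub>C\<^esub> g) \<and>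
    (\<forall>j \<in> Obj J. \<forall>k \<in> Obj J. \<forall>g \<in> Hom C P (Fo j). \<forall>h \<in> Hom C P (Fo k).
       t j \<cdot>\<^bsub>C\<^esub> g = t k \<cdot>\<^bsub>C\<^esub> h \<longrightarrow>
       ((j, g), (k, h)) \<in> (colim_step J C P Fo Fa \<union> (colim_step J C P Fo Fa)\<inverse>)\<^sup>*)"

definition presentable :: "'u rel \<Rightarrow> 'k rel \<Rightarrow> ('o, 'a, 'z) category_scheme \<Rightarrow> 'o \<Rightarrow> bool"
  where "presentable u \<kappa> C P \<longleftrightarrow> Cinfinite \<kappa> \<and> regularCard \<kappa> \<and> P \<in> Obj C \<and>
    (\<forall>(J :: ('u, 'u) category) Fo Fa L t.
       small_category u J \<and> filtered_category \<kappa> J \<and> is_functor J C Fo Fa \<and>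
       is_colimit J C Fo Fa L t \<longrightarrow> Hom_preserves_colimit J C P Fo Fa L t)"

definition cocomplete :: "'u rel \<Rightarrow> ('o, 'a, 'z) category_scheme \<Rightarrow> bool"
  where "cocomplete u C \<longleftrightarrow>
    (\<forall>(J :: ('u, 'u) category) Fo Fa. small_category u J \<and> is_functor J C Fo Fa \<longrightarrow>
       (\<exists>L t. is_colimit J C Fo Fa L t))"

definition locally_presentable :: "'u rel \<Rightarrow> 'k rel \<Rightarrow> ('o, 'a, 'z) category_scheme \<Rightarrow> bool"
  where "locally_presentable u \<kappa> C \<longleftrightarrow> Cinfinite \<kappa> \<and> regularCard \<kappa> \<and> category C \<and>
    (\<forall>X \<in> Obj C. \<forall>Y \<in> Obj C. |Hom C X Y| <o u) \<and>
    cocomplete u C \<and>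
    (\<exists>G \<subseteq> Obj C. |G| <o u \<and> (\<forall>P \<in> G. presentable u \<kappa> C P) \<and>
      (\<forall>X \<in> Obj C. \<exists>(J :: ('u, 'u) category) Fo Fa t.
         small_category u J \<and> filtered_category \<kappa> J \<and> is_functor J C Fo Fa \<and>
         (\<forall>j \<in> Obj J. Fo j \<in> G) \<and> is_colimit J C Fo Fa X t))"

section \<open>Abelian categories\<close>

record ('o, 'a) ab_category = "('o, 'a) category" +
  Add :: "'a \<Rightarrow> 'a \<Rightarrow> 'a"
  Null :: "'o \<Rightarrow> 'o \<Rightarrow> 'a"

definition hom_group :: "('o, 'a, 'z) ab_category_scheme \<Rightarrow> 'o \<Rightarrow> 'o \<Rightarrow> 'a monoid"
  where "hom_group C X Y = \<lparr>carrier = Hom C X Y, mult = Add C, one = Null C X Y\<rparr>"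

definition is_kernel :: "('o, 'a, 'z) ab_category_scheme \<Rightarrow> 'a \<Rightarrow> 'a \<Rightarrow> bool"
  where "is_kernel C k f \<longleftrightarrow> k \<in> Arr C \<and> f \<in> Arr C \<and> Cod C k = Dom C f \<and>
    f \<cdot>\<^bsub>C\<^esub> k = Null C (Dom C k) (Cod C f) \<and>
    (\<forall>X \<in> Obj C. \<forall>g \<in> Hom C X (Dom C f). f \<cdot>\<^bsub>C\<^esub> g = Null C X (Cod C f) \<longrightarrow>
      (\<exists>!h. h \<in> Hom C X (Dom C k) \<and> k \<cdot>\<^bsub>C\<^esub> h = g))"

definition is_cokernel :: "('o, 'a, 'z) ab_category_scheme \<Rightarrow> 'a \<Rightarrow> 'a \<Rightarrow> bool"
  where "is_cokernel C q f \<longleftrightarrow> q \<in> Arr C \<and> f \<in> Arr C \<and> Dom C q = Cod C f \<and>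
    q \<cdot>\<^bsub>C\<^esub> f = Null C (Dom C f) (Cod C q) \<and>
    (\<forall>X \<in> Obj C. \<forall>g \<in> Hom C (Cod C f) X. g \<cdot>\<^bsub>C\<^esub> f = Null C (Dom C f) X \<longrightarrow>
      (\<exists>!h. h \<in> Hom C (Cod C q) X \<and> h \<cdot>\<^bsub>C\<^esub> q = g))"

locale abelian_category = category C for C :: "('o, 'a, 'z) ab_category_scheme" (structure) +
  assumes hom_comm_group: "X \<in> Obj C \<Longrightarrow> Y \<in> Obj C \<Longrightarrow> comm_group (hom_group C X Y)"
    and Comp_Add: "f \<in> Hom C X Y \<Longrightarrow> f' \<in> Hom C X Y \<Longrightarrow> g \<in> Hom C Y Z
      \<Longrightarrow> g \<cdot> Add C f f' = Add C (g \<cdot> f) (g \<cdot> f')"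
    and Add_Comp: "f \<in> Hom C X Y \<Longrightarrow> g \<in> Hom C Y Z \<Longrightarrow> g' \<in> Hom C Y Z
      \<Longrightarrow> Add C g g' \<cdot> f = Add C (g \<cdot> f) (g' \<cdot> f)"
    and zero_object: "\<exists>Z \<in> Obj C. \<forall>X \<in> Obj C.
      (\<exists>!f. f \<in> Hom C Z X) \<and> (\<exists>!f. f \<in> Hom C X Z)"
    and binary_coproduct: "X \<in> Obj C \<Longrightarrow> Y \<in> Obj C
      \<Longrightarrow> \<exists>L \<iota>. is_coproduct C (UNIV :: bool set) (\<lambda>b. if b then X else Y) L \<iota>"
    and kernel: "f \<in> Arr C \<Longrightarrow> \<exists>k. is_kernel C k f"
    and cokernel: "f \<in> Arr C \<Longrightarrow> \<exists>q. is_cokernel C q f"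
    and mono_normal: "mono_arr C f \<Longrightarrow> \<exists>g. is_kernel C f g"
    and epi_normal: "epi_arr C f \<Longrightarrow> \<exists>g. is_cokernel C f g"

definition exact_pair :: "('o, 'a, 'z) ab_category_scheme \<Rightarrow> 'a \<Rightarrow> 'a \<Rightarrow> bool"
  where "exact_pair C f g \<longleftrightarrow> Cod C f = Dom C g \<and>
    (\<exists>k e. is_kernel C k g \<and> epi_arr C e \<and> Cod C e = Dom C k \<and> f = k \<cdot>\<^bsub>C\<^esub> e)"

section \<open>Ext in an abelian category\<close>

text \<open>
  The complex \<open>\<dots> \<rightarrow> P 2 \<rightarrow> P 1 \<rightarrow> P 0 \<rightarrow> X \<rightarrow> 0\<close> with augmentation \<open>e : P 0 \<rightarrow> X\<close> and differentials
  \<open>d n : P (Suc n) \<rightarrow> P n\<close>.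
\<close>

definition projective_resolution ::
    "('o, 'a, 'z) ab_category_scheme \<Rightarrow> 'o \<Rightarrow> (nat \<Rightarrow> 'o) \<Rightarrow> 'a \<Rightarrow> (nat \<Rightarrow> 'a) \<Rightarrow> bool"
  where "projective_resolution C X P e d \<longleftrightarrow>
    (\<forall>n. projective C (P n)) \<and> e \<in> Hom C (P 0) X \<and> (\<forall>n. d n \<in> Hom C (P (Suc n)) (P n)) \<and>
    epi_arr C e \<and> exact_pair C (d 0) e \<and> (\<forall>n. exact_pair C (d (Suc n)) (d n))"

definition cocycles ::
    "('o, 'a, 'z) ab_category_scheme \<Rightarrow> (nat \<Rightarrow> 'o) \<Rightarrow> (nat \<Rightarrow> 'a) \<Rightarrow> 'o \<Rightarrow> nat \<Rightarrow> 'a set"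
  where "cocycles C P d Y i =
    {f \<in> Hom C (P i) Y. f \<cdot>\<^bsub>C\<^esub> d i = Null C (P (Suc i)) Y}"

fun coboundaries ::
    "('o, 'a, 'z) ab_category_scheme \<Rightarrow> (nat \<Rightarrow> 'o) \<Rightarrow> (nat \<Rightarrow> 'a) \<Rightarrow> 'o \<Rightarrow> nat \<Rightarrow> 'a set"
  where
    "coboundaries C P d Y 0 = {Null C (P 0) Y}"
  | "coboundaries C P d Y (Suc i) = {g \<cdot>\<^bsub>C\<^esub> d i | g. g \<in> Hom C (P i) Y}"

text \<open>
  \<open>Ext_group C P d Y i\<close> is \<open>Ext\<^sup>i(X, Y)\<close> computed from a projective resolution \<open>(P, d)\<close> of \<open>X\<close>.
\<close>

definition Ext_group ::
    "('o, 'a, 'z) ab_category_scheme \<Rightarrow> (nat \<Rightarrow> 'o) \<Rightarrow> (nat \<Rightarrow> 'a) \<Rightarrow> 'o \<Rightarrow> nat \<Rightarrow> 'a set monoid"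
  where "Ext_group C P d Y i =
    (hom_group C (P i) Y)\<lparr>carrier := cocycles C P d Y i\<rparr> Mod coboundaries C P d Y i"

section \<open>Ext over a ring\<close>

text \<open>
  The records of \<^theory>\<open>HOL-Algebra.Module\<close> are used for left modules over a ring that need not be
  commutative, so its locales, which require \<^const>\<open>cring\<close>, do not apply. The fields
  \<^const>\<open>mult\<close> and \<^const>\<open>one\<close> of a module are irrelevant. Module maps are extensional functions.
\<close>

definition lmod_hom ::
    "('s, 'y) ring_scheme \<Rightarrow> ('s, 'm, 'z) module_scheme \<Rightarrow> ('s, 'n, 'w) module_scheme \<Rightarrow> ('m \<Rightarrow> 'n) set"
  where "lmod_hom R M N = {h \<in> carrier M \<rightarrow>\<^sub>E carrier N.
    (\<forall>x \<in> carrier M. \<forall>y \<in> carrier M. h (x \<oplus>\<^bsub>M\<^esub> y) = h x \<oplus>\<^bsub>N\<^esub> h y) \<and>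
    (\<forall>r \<in> carrier R. \<forall>x \<in> carrier M. h (r \<odot>\<^bsub>M\<^esub> x) = r \<odot>\<^bsub>N\<^esub> h x)}"

definition lmod_zero :: "('s, 'm, 'z) module_scheme \<Rightarrow> ('s, 'n, 'w) module_scheme \<Rightarrow> 'm \<Rightarrow> 'n"
  where "lmod_zero M N = (\<lambda>x \<in> carrier M. \<zero>\<^bsub>N\<^esub>)"

definition lmod_hom_group ::
    "('s, 'y) ring_scheme \<Rightarrow> ('s, 'm, 'z) module_scheme \<Rightarrow> ('s, 'n, 'w) module_scheme
      \<Rightarrow> ('m \<Rightarrow> 'n) monoid"
  where "lmod_hom_group R M N =
    \<lparr>carrier = lmod_hom R M N, mult = (\<lambda>f g. \<lambda>x \<in> carrier M. f x \<oplus>\<^bsub>N\<^esub> g x), one = lmod_zero M N\<rparr>"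

text \<open>The free left module on the set \<open>X\<close>: finitely supported families of scalars indexed by \<open>X\<close>.\<close>

definition free_lmod :: "('s, 'y) ring_scheme \<Rightarrow> 'x set \<Rightarrow> ('s, 'x \<Rightarrow> 's) module"
  where "free_lmod R X =
    \<lparr>carrier = {c. (\<forall>x. c x \<in> carrier R) \<and> {x. c x \<noteq> \<zero>\<^bsub>R\<^esub>} \<subseteq> X \<and> finite {x. c x \<noteq> \<zero>\<^bsub>R\<^esub>}},
     mult = undefined, one = undefined,
     zero = (\<lambda>x. \<zero>\<^bsub>R\<^esub>), add = (\<lambda>c c' x. c x \<oplus>\<^bsub>R\<^esub> c' x),
     smult = (\<lambda>r c x. r \<otimes>\<^bsub>R\<^esub> c x)\<rparr>"

definition free_resolution ::
    "('s, 'y) ring_scheme \<Rightarrow> ('s, 'm, 'z) module_scheme \<Rightarrow> (nat \<Rightarrow> 'x set)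
      \<Rightarrow> (('x \<Rightarrow> 's) \<Rightarrow> 'm) \<Rightarrow> (nat \<Rightarrow> ('x \<Rightarrow> 's) \<Rightarrow> ('x \<Rightarrow> 's)) \<Rightarrow> bool"
  where "free_resolution R M X e d \<longleftrightarrow>
    e \<in> lmod_hom R (free_lmod R (X 0)) M \<and>
    (\<forall>n. d n \<in> lmod_hom R (free_lmod R (X (Suc n))) (free_lmod R (X n))) \<and>
    e ` carrier (free_lmod R (X 0)) = carrier M \<and>
    d 0 ` carrier (free_lmod R (X 1)) = {c \<in> carrier (free_lmod R (X 0)). e c = \<zero>\<^bsub>M\<^esub>} \<and>
    (\<forall>n. d (Suc n) ` carrier (free_lmod R (X (Suc (Suc n)))) =
      {c \<in> carrier (free_lmod R (X (Suc n))). d n c = \<zero>\<^bsub>free_lmod R (X n)\<^esub>})"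

definition lmod_cocycles ::
    "('s, 'y) ring_scheme \<Rightarrow> (nat \<Rightarrow> 'x set) \<Rightarrow> (nat \<Rightarrow> ('x \<Rightarrow> 's) \<Rightarrow> ('x \<Rightarrow> 's))
      \<Rightarrow> ('s, 'm, 'z) module_scheme \<Rightarrow> nat \<Rightarrow> (('x \<Rightarrow> 's) \<Rightarrow> 'm) set"
  where "lmod_cocycles R X d N i =
    {f \<in> lmod_hom R (free_lmod R (X i)) N.
       compose (carrier (free_lmod R (X (Suc i)))) f (d i) = lmod_zero (free_lmod R (X (Suc i))) N}"

fun lmod_coboundaries ::
    "('s, 'y) ring_scheme \<Rightarrow> (nat \<Rightarrow> 'x set) \<Rightarrow> (nat \<Rightarrow> ('x \<Rightarrow> 's) \<Rightarrow> ('x \<Rightarrow> 's))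
      \<Rightarrow> ('s, 'm, 'z) module_scheme \<Rightarrow> nat \<Rightarrow> (('x \<Rightarrow> 's) \<Rightarrow> 'm) set"
  where
    "lmod_coboundaries R X d N 0 = {lmod_zero (free_lmod R (X 0)) N}"
  | "lmod_coboundaries R X d N (Suc i) =
      {compose (carrier (free_lmod R (X (Suc i)))) g (d i) | g. g \<in> lmod_hom R (free_lmod R (X i)) N}"

definition lmod_Ext_group ::
    "('s, 'y) ring_scheme \<Rightarrow> (nat \<Rightarrow> 'x set) \<Rightarrow> (nat \<Rightarrow> ('x \<Rightarrow> 's) \<Rightarrow> ('x \<Rightarrow> 's))
      \<Rightarrow> ('s, 'm, 'z) module_scheme \<Rightarrow> nat \<Rightarrow> (('x \<Rightarrow> 's) \<Rightarrow> 'm) set monoid"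
  where "lmod_Ext_group R X d N i =
    (lmod_hom_group R (free_lmod R (X i)) N)\<lparr>carrier := lmod_cocycles R X d N i\<rparr>
      Mod lmod_coboundaries R X d N i"

section \<open>Good projective generators\<close>

definition End_op :: "('o, 'a, 'z) ab_category_scheme \<Rightarrow> 'o \<Rightarrow> 'a ring"
  where "End_op C Q =
    \<lparr>carrier = Hom C Q Q, mult = (\<lambda>s t. t \<cdot>\<^bsub>C\<^esub> s), one = Ident C Q,
     zero = Null C Q Q, add = Add C\<rparr>"

definition Theta :: "('o, 'a, 'z) ab_category_scheme \<Rightarrow> 'o \<Rightarrow> 'o \<Rightarrow> ('a, 'a) module"
  where "Theta C Q X =
    \<lparr>carrier = Hom C Q X, mult = undefined, one = undefined,
     zero = Null C Q X, add = Add C, smult = (\<lambda>s f. f \<cdot>\<^bsub>C\<^esub> s)\<rparr>"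

definition Theta_arr :: "('o, 'a, 'z) ab_category_scheme \<Rightarrow> 'o \<Rightarrow> 'a \<Rightarrow> 'a \<Rightarrow> 'a"
  where "Theta_arr C Q f = (\<lambda>g \<in> Hom C Q (Dom C f). f \<cdot>\<^bsub>C\<^esub> g)"

text \<open>
  A chain map from a free resolution of \<open>Theta C Q B\<close> to the image under \<open>Theta C Q\<close> of a
  resolution of \<open>B\<close>, lifting the identity of \<open>Theta C Q B\<close>.
\<close>

definition comparison_map ::
    "('o, 'a, 'z) ab_category_scheme \<Rightarrow> 'o \<Rightarrow> (nat \<Rightarrow> 'o) \<Rightarrow> 'a \<Rightarrow> (nat \<Rightarrow> 'a)
      \<Rightarrow> (nat \<Rightarrow> 'x set) \<Rightarrow> (('x \<Rightarrow> 'a) \<Rightarrow> 'a) \<Rightarrow> (nat \<Rightarrow> ('x \<Rightarrow> 'a) \<Rightarrow> ('x \<Rightarrow> 'a))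
      \<Rightarrow> (nat \<Rightarrow> ('x \<Rightarrow> 'a) \<Rightarrow> 'a) \<Rightarrow> bool"
  where "comparison_map C Q P e d X e' d' \<phi> \<longleftrightarrow>
    (let S = End_op C Q; F = (\<lambda>n. free_lmod S (X n)) in
      (\<forall>n. \<phi> n \<in> lmod_hom S (F n) (Theta C Q (P n))) \<and>
      compose (carrier (F 0)) (Theta_arr C Q e) (\<phi> 0) = e' \<and>
      (\<forall>n. compose (carrier (F (Suc n))) (Theta_arr C Q (d n)) (\<phi> (Suc n)) =
           compose (carrier (F (Suc n))) (\<phi> n) (d' n)))"

text \<open>
  The map on \<open>Ext\<^sup>i\<close> induced by \<open>Theta C Q\<close>: the class of a cocycle \<open>f : P i \<rightarrow> Y\<close> goes to the class
  of \<open>Theta(f) \<circ> \<phi> i\<close>. The representative-free form below sends a coset \<open>K\<close> of coboundaries to the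
  sum of the coboundaries with the image of \<open>K\<close>, again a single coset.
\<close>

definition Ext_map ::
    "('o, 'a, 'z) ab_category_scheme \<Rightarrow> 'o \<Rightarrow> (nat \<Rightarrow> 'x set) \<Rightarrow> (nat \<Rightarrow> ('x \<Rightarrow> 'a) \<Rightarrow> ('x \<Rightarrow> 'a))
      \<Rightarrow> (nat \<Rightarrow> ('x \<Rightarrow> 'a) \<Rightarrow> 'a) \<Rightarrow> 'o \<Rightarrow> nat \<Rightarrow> 'a set \<Rightarrow> (('x \<Rightarrow> 'a) \<Rightarrow> 'a) set"
  where "Ext_map C Q X d' \<phi> Y i K =
    (let S = End_op C Q; F = free_lmod S (X i); N = Theta C Q Y in
      lmod_coboundaries S X d' N i <#>\<^bsub>lmod_hom_group S F N\<^esub>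
        ((\<lambda>f. compose (carrier F) (Theta_arr C Q f) (\<phi> i)) ` K))"

text \<open>
  The comparison is required to be an isomorphism for every choice of resolutions and comparison map.
  Bases are taken in the type \<open>'a list\<close>: it is infinite and at least as large as \<open>'a\<close>, so there are
  no more than \<open>|'a list|\<close> finitely supported functions from it to \<open>'a\<close>, and every left module
  over \<open>End_op C Q\<close> with carrier in \<open>'a\<close>, in particular \<open>Theta C Q B\<close>, has a free resolution of
  this form.
\<close>

definition n_good :: "('o, 'a, 'z) ab_category_scheme \<Rightarrow> 'o \<Rightarrow> nat \<Rightarrow> bool"
  where "n_good C Q n \<longleftrightarrow>
    (\<forall>B \<in> Obj C. \<forall>Y \<in> Obj C. \<forall>i \<le> n. \<forall>P e d. \<forall>X :: nat \<Rightarrow> 'a list set. \<forall>e' d' \<phi>.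
       projective_resolution C B P e d \<and>
       free_resolution (End_op C Q) (Theta C Q B) X e' d' \<and>
       comparison_map C Q P e d X e' d' \<phi> \<longrightarrow>
       Ext_map C Q X d' \<phi> Y i \<in>
         iso (Ext_group C P d Y i) (lmod_Ext_group (End_op C Q) X d' (Theta C Q Y) i))"

definition good :: "('o, 'a, 'z) ab_category_scheme \<Rightarrow> 'o \<Rightarrow> bool"
  where "good C Q \<longleftrightarrow> (\<forall>n. n_good C Q n)"

end

theory Submission
  imports Defs
begin

text \<open>
  In the lemmas, \<open>C\<close> is the abelian category and \<open>B\<close> one of its objects. Write \<open>S\<close> for the ring
  \<open>End_op C Q\<close> and \<open>\<Theta>\<close> for \<open>Hom(Q, -)\<close>. A family of arrows \<open>Q \<rightarrow> Y\<close> indexed by \<open>X\<close> is the same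
  thing as an \<open>S\<close>-linear map from the free module on \<open>X\<close> to \<open>\<Theta> Y\<close>, and, if \<open>X\<close> is small, the same
  thing as an arrow from the coproduct \<open>Q^(X)\<close> to \<open>Y\<close>. So a free resolution of \<open>\<Theta> B\<close> with small
  bases \<open>X n\<close> gives a complex \<open>D\<close> of objects \<open>D n = Q^(X n)\<close> over \<open>B\<close>, and cochains on the free
  resolution with values in \<open>\<Theta> Y\<close> are cochains on \<open>D\<close> with values in \<open>Y\<close>. The theorem reduces to
  the statement that \<open>D\<close> is a projective resolution of \<open>B\<close> (\<open>realization_lifting\<close>): then both Ext
  groups are the cohomology of the same complex.

  Exactness of \<open>D\<close> has to be tested on arrows \<open>P \<rightarrow> D n\<close>. The free resolution only provides it for
  the \<^emph>\<open>finite\<close> arrows \<open>Q \<rightarrow> D n\<close>, the finite sums \<open>\<Sum>x. \<iota> x \<cdot> c x\<close>. An arbitrary arrow \<open>P \<rightarrow> D n\<close> is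
  supported on at most \<open>l\<close> of the summands, because \<open>P\<close> is presentable and \<open>D n\<close> is a directed
  colimit of its subcoproducts with at most \<open>l\<close> summands (\<open>presentable_supported_on\<close>). To get from
  \<open>l\<close> summands to finitely many, the equality \<open>l * l = l\<close> is used: as \<open>Q\<close> is a coproduct of \<open>l\<close>
  copies of \<open>P\<close>, any family of at most \<open>l\<close> elements of \<open>\<Theta> M\<close> consists of multiples of one single
  element (\<open>power_assembly\<close>). By induction on \<open>n\<close> this gives, on each subcoproduct of \<open>D n\<close> with
  at most \<open>l\<close> summands, a homotopy between the inclusion and an arrow \<open>w \<cdot> \<rho>\<close> that factors through
  a finite \<open>w : Q \<rightarrow> D n\<close> (\<open>local_contraction\<close>). A cycle \<open>f : P \<rightarrow> D n\<close> is thus a boundary plus the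
  finite cycle \<open>w \<cdot> \<rho> \<cdot> f\<close>, which is a boundary by exactness of the free resolution (\<open>\<delta>_exact_P\<close>).

  The bases in the definition of a good generator may be too large for the coproduct \<open>Q^(X)\<close> to
  exist. A small free resolution of \<open>\<Theta> B\<close> is therefore constructed, and the given free resolution
  is compared with it by chain maps in both directions and a homotopy; likewise the given
  projective resolution of \<open>B\<close> is compared with \<open>D\<close>. These maps and homotopies give surjectivity
  (\<open>cocycle_lift\<close>) and injectivity (\<open>cocycle_bounds\<close>) of the map on Ext groups.
\<close>

section \<open>Left modules and their maps\<close>

locale lmod = R: ring R + M: abelian_group M
  for R :: "('s, 'y) ring_scheme" and M :: "('s, 'm, 'z) module_scheme" +
  assumes smult_closed: "r \<in> carrier R \<Longrightarrow> x \<in> carrier M \<Longrightarrow> r \<odot>\<^bsub>M\<^esub> x \<in> carrier M"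
    and smult_l_distr: "r \<in> carrier R \<Longrightarrow> s \<in> carrier R \<Longrightarrow> x \<in> carrier M
      \<Longrightarrow> (r \<oplus>\<^bsub>R\<^esub> s) \<odot>\<^bsub>M\<^esub> x = r \<odot>\<^bsub>M\<^esub> x \<oplus>\<^bsub>M\<^esub> s \<odot>\<^bsub>M\<^esub> x"
    and smult_r_distr: "r \<in> carrier R \<Longrightarrow> x \<in> carrier M \<Longrightarrow> y \<in> carrier M
      \<Longrightarrow> r \<odot>\<^bsub>M\<^esub> (x \<oplus>\<^bsub>M\<^esub> y) = r \<odot>\<^bsub>M\<^esub> x \<oplus>\<^bsub>M\<^esub> r \<odot>\<^bsub>M\<^esub> y"
    and smult_assoc: "r \<in> carrier R \<Longrightarrow> s \<in> carrier R \<Longrightarrow> x \<in> carrier M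
      \<Longrightarrow> (r \<otimes>\<^bsub>R\<^esub> s) \<odot>\<^bsub>M\<^esub> x = r \<odot>\<^bsub>M\<^esub> (s \<odot>\<^bsub>M\<^esub> x)"
    and smult_one: "x \<in> carrier M \<Longrightarrow> \<one>\<^bsub>R\<^esub> \<odot>\<^bsub>M\<^esub> x = x"
begin

lemma zero_smult:
  assumes "x \<in> carrier M"
  shows "\<zero>\<^bsub>R\<^esub> \<odot>\<^bsub>M\<^esub> x = \<zero>\<^bsub>M\<^esub>"
proof -
  have "\<zero>\<^bsub>R\<^esub> \<odot>\<^bsub>M\<^esub> x \<oplus>\<^bsub>M\<^esub> \<zero>\<^bsub>R\<^esub> \<odot>\<^bsub>M\<^esub> x = \<zero>\<^bsub>R\<^esub> \<odot>\<^bsub>M\<^esub> x"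
    using smult_l_distr[of "\<zero>\<^bsub>R\<^esub>" "\<zero>\<^bsub>R\<^esub>" x] assms by simp
  then show ?thesis using assms by (simp add: smult_closed)
qed

lemma smult_zero:
  assumes "r \<in> carrier R"
  shows "r \<odot>\<^bsub>M\<^esub> \<zero>\<^bsub>M\<^esub> = \<zero>\<^bsub>M\<^esub>"
proof -
  have "r \<odot>\<^bsub>M\<^esub> \<zero>\<^bsub>M\<^esub> \<oplus>\<^bsub>M\<^esub> r \<odot>\<^bsub>M\<^esub> \<zero>\<^bsub>M\<^esub> = r \<odot>\<^bsub>M\<^esub> \<zero>\<^bsub>M\<^esub>"
    using smult_r_distr[of r "\<zero>\<^bsub>M\<^esub>" "\<zero>\<^bsub>M\<^esub>"] assms by simp
  then show ?thesis using assms by (simp add: smult_closed)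
qed

end

lemma lmod_hom_closed: "h \<in> lmod_hom R M N \<Longrightarrow> x \<in> carrier M \<Longrightarrow> h x \<in> carrier N"
  by (auto simp: lmod_hom_def PiE_def)

lemma lmod_hom_add: "h \<in> lmod_hom R M N \<Longrightarrow> x \<in> carrier M \<Longrightarrow> y \<in> carrier M
    \<Longrightarrow> h (x \<oplus>\<^bsub>M\<^esub> y) = h x \<oplus>\<^bsub>N\<^esub> h y"
  by (auto simp: lmod_hom_def)

lemma lmod_hom_smult: "h \<in> lmod_hom R M N \<Longrightarrow> r \<in> carrier R \<Longrightarrow> x \<in> carrier M
    \<Longrightarrow> h (r \<odot>\<^bsub>M\<^esub> x) = r \<odot>\<^bsub>N\<^esub> h x"
  by (auto simp: lmod_hom_def)

lemma lmod_hom_zero: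
  assumes "lmod R M" "lmod R N" "h \<in> lmod_hom R M N"
  shows "h \<zero>\<^bsub>M\<^esub> = \<zero>\<^bsub>N\<^esub>"
proof -
  interpret M: lmod R M by fact
  interpret N: lmod R N by fact
  have "h \<zero>\<^bsub>M\<^esub> \<oplus>\<^bsub>N\<^esub> h \<zero>\<^bsub>M\<^esub> = h \<zero>\<^bsub>M\<^esub>"
    using lmod_hom_add[OF assms(3), of "\<zero>\<^bsub>M\<^esub>" "\<zero>\<^bsub>M\<^esub>"] by simp
  then show ?thesis
    using lmod_hom_closed[OF assms(3) M.M.zero_closed] by simp
qed

lemma lmod_homI:
  assumes "\<And>x. x \<in> carrier M \<Longrightarrow> h x \<in> carrier N"
    and "\<And>x y. x \<in> carrier M \<Longrightarrow> y \<in> carrier M \<Longrightarrow> h (x \<oplus>\<^bsub>M\<^esub> y) = h x \<oplus>\<^bsub>N\<^esub> h y"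
    and "\<And>r x. r \<in> carrier R \<Longrightarrow> x \<in> carrier M \<Longrightarrow> h (r \<odot>\<^bsub>M\<^esub> x) = r \<odot>\<^bsub>N\<^esub> h x"
    and "lmod R M"
  shows "restrict h (carrier M) \<in> lmod_hom R M N"
proof -
  interpret lmod R M by fact
  show ?thesis using assms(1-3) by (auto simp: lmod_hom_def smult_closed)
qed

lemma lmod_hom_compose:
  assumes "lmod R M" "f \<in> lmod_hom R M N" "g \<in> lmod_hom R N L"
  shows "compose (carrier M) g f \<in> lmod_hom R M L"
proof -
  have "restrict (\<lambda>x. g (f x)) (carrier M) \<in> lmod_hom R M L"
    by (rule lmod_homI) (use assms in \<open>auto simp: lmod_hom_closed lmod_hom_add lmod_hom_smult\<close>)
  then show ?thesis by (simp add: compose_def)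
qed

lemma lmod_hom_sum:
  assumes "lmod R M" "lmod R N" "f \<in> lmod_hom R M N" "g \<in> lmod_hom R M N"
  shows "(\<lambda>x\<in>carrier M. f x \<oplus>\<^bsub>N\<^esub> g x) \<in> lmod_hom R M N"
proof -
  interpret N: lmod R N by fact
  show ?thesis
    by (rule lmod_homI)
      (use assms in \<open>auto simp: lmod_hom_closed lmod_hom_add lmod_hom_smult N.smult_r_distr N.M.a_ac\<close>)
qed

lemma lmod_hom_group_comm:
  assumes "lmod R M" "lmod R N"
  shows "comm_group (lmod_hom_group R M N)"
proof -
  interpret M: lmod R M by fact
  interpret N: lmod R N by fact
  have zero: "lmod_zero M N \<in> lmod_hom R M N"
    unfolding lmod_zero_def by (rule lmod_homI) (auto simp: N.smult_zero assms)
  have neg: "(\<lambda>x\<in>carrier M. \<ominus>\<^bsub>N\<^esub> h x) \<in> lmod_hom R M N" if h: "h \<in> lmod_hom R M N" for h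
  proof (rule lmod_homI)
    fix x y assume "x \<in> carrier M" "y \<in> carrier M"
    then show "\<ominus>\<^bsub>N\<^esub> h (x \<oplus>\<^bsub>M\<^esub> y) = \<ominus>\<^bsub>N\<^esub> h x \<oplus>\<^bsub>N\<^esub> \<ominus>\<^bsub>N\<^esub> h y"
      using h by (simp add: lmod_hom_add lmod_hom_closed N.M.minus_add)
  next
    fix r x assume r: "r \<in> carrier R" and x: "x \<in> carrier M"
    have c: "h x \<in> carrier N" "\<ominus>\<^bsub>N\<^esub> h x \<in> carrier N" using h x by (auto simp: lmod_hom_closed)
    have "r \<odot>\<^bsub>N\<^esub> h x \<oplus>\<^bsub>N\<^esub> r \<odot>\<^bsub>N\<^esub> (\<ominus>\<^bsub>N\<^esub> h x) = \<zero>\<^bsub>N\<^esub>"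
      using c r by (simp flip: N.smult_r_distr add: N.M.r_neg N.smult_zero)
    then have "\<ominus>\<^bsub>N\<^esub> (r \<odot>\<^bsub>N\<^esub> h x) = r \<odot>\<^bsub>N\<^esub> (\<ominus>\<^bsub>N\<^esub> h x)"
      using c r by (metis N.M.add.inv_equality N.M.add.m_comm N.smult_closed)
    then show "\<ominus>\<^bsub>N\<^esub> h (r \<odot>\<^bsub>M\<^esub> x) = r \<odot>\<^bsub>N\<^esub> (\<ominus>\<^bsub>N\<^esub> h x)"
      using h r x by (simp add: lmod_hom_smult)
  qed (use h assms in \<open>auto simp: lmod_hom_closed\<close>)
  have ext: "f = g" if "f \<in> lmod_hom R M N" "g \<in> lmod_hom R M N" "\<And>x. x \<in> carrier M \<Longrightarrow> f x = g x" for f g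
    using that by (auto simp: lmod_hom_def intro: PiE_ext)
  show ?thesis
  proof (rule comm_groupI)
    fix f g k assume "f \<in> carrier (lmod_hom_group R M N)" "g \<in> carrier (lmod_hom_group R M N)"
      "k \<in> carrier (lmod_hom_group R M N)"
    then show "f \<otimes>\<^bsub>lmod_hom_group R M N\<^esub> g \<otimes>\<^bsub>lmod_hom_group R M N\<^esub> k
        = f \<otimes>\<^bsub>lmod_hom_group R M N\<^esub> (g \<otimes>\<^bsub>lmod_hom_group R M N\<^esub> k)"
      by (auto simp: lmod_hom_group_def lmod_hom_closed N.M.a_assoc intro!: restrict_ext)
  next
    fix f g assume "f \<in> carrier (lmod_hom_group R M N)" "g \<in> carrier (lmod_hom_group R M N)"
    then show "f \<otimes>\<^bsub>lmod_hom_group R M N\<^esub> g = g \<otimes>\<^bsub>lmod_hom_group R M N\<^esub> f"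
      by (auto simp: lmod_hom_group_def lmod_hom_closed N.M.a_comm intro!: restrict_ext)
  next
    fix f assume f: "f \<in> carrier (lmod_hom_group R M N)"
    then have f': "f \<in> lmod_hom R M N" by (simp add: lmod_hom_group_def)
    show "\<one>\<^bsub>lmod_hom_group R M N\<^esub> \<otimes>\<^bsub>lmod_hom_group R M N\<^esub> f = f"
      unfolding lmod_hom_group_def
      by simp (rule ext, use lmod_hom_sum[OF assms zero f'] f' in
        \<open>auto simp: lmod_zero_def lmod_hom_closed\<close>)
    have "(\<lambda>x\<in>carrier M. (\<lambda>x\<in>carrier M. \<ominus>\<^bsub>N\<^esub> f x) x \<oplus>\<^bsub>N\<^esub> f x) = lmod_zero M N"
      using f' by (auto simp: lmod_zero_def lmod_hom_closed N.M.l_neg intro!: restrict_ext)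
    then show "\<exists>g\<in>carrier (lmod_hom_group R M N). g \<otimes>\<^bsub>lmod_hom_group R M N\<^esub> f = \<one>\<^bsub>lmod_hom_group R M N\<^esub>"
      using neg[OF f'] unfolding lmod_hom_group_def by (simp del: restrict_apply) blast
  qed (auto simp: lmod_hom_group_def zero lmod_hom_sum assms)
qed

section \<open>Free modules\<close>

lemma free_lmod_carrier:
  "c \<in> carrier (free_lmod R X) \<longleftrightarrow>
    (\<forall>x. c x \<in> carrier R) \<and> (\<forall>x. x \<notin> X \<longrightarrow> c x = \<zero>\<^bsub>R\<^esub>) \<and> finite {x. c x \<noteq> \<zero>\<^bsub>R\<^esub>}"
  by (auto simp: free_lmod_def)

lemma free_lmod_lmod:
  fixes R :: "('s, 'y) ring_scheme" and X :: "'x set"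
  assumes "ring R"
  shows "lmod R (free_lmod R X)"
proof -
  interpret ring R by fact
  let ?F = "free_lmod R X"
  have fin: "finite {x. c x \<oplus>\<^bsub>R\<^esub> c' x \<noteq> \<zero>\<^bsub>R\<^esub>}"
    if "finite {x. c x \<noteq> \<zero>\<^bsub>R\<^esub>}" "finite {x. c' x \<noteq> \<zero>\<^bsub>R\<^esub>}" for c c' :: "'x \<Rightarrow> 's"
    by (rule finite_subset[OF _ finite_UnI[OF that]]) auto
  have fin': "finite {x. r \<otimes>\<^bsub>R\<^esub> c x \<noteq> \<zero>\<^bsub>R\<^esub>}"
    if "finite {x. c x \<noteq> \<zero>\<^bsub>R\<^esub>}" "r \<in> carrier R" for c  :: "'x \<Rightarrow> 's" and r
    by (rule finite_subset[OF _ that(1)]) (use that in auto)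
  have ops: "c \<oplus>\<^bsub>?F\<^esub> c' = (\<lambda>x. c x \<oplus>\<^bsub>R\<^esub> c' x)" "\<zero>\<^bsub>?F\<^esub> = (\<lambda>x. \<zero>\<^bsub>R\<^esub>)"
    "r \<odot>\<^bsub>?F\<^esub> c = (\<lambda>x. r \<otimes>\<^bsub>R\<^esub> c x)" for c c' r
    by (simp_all add: free_lmod_def)
  have "abelian_group ?F"
  proof (rule abelian_groupI)
    fix c assume c: "c \<in> carrier ?F"
    have "{x. \<ominus>\<^bsub>R\<^esub> c x \<noteq> \<zero>\<^bsub>R\<^esub>} \<subseteq> {x. c x \<noteq> \<zero>\<^bsub>R\<^esub>}" by auto
    then have "(\<lambda>x. \<ominus>\<^bsub>R\<^esub> c x) \<in> carrier ?F"
      using c by (auto simp: free_lmod_carrier dest: finite_subset)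
    moreover have "(\<lambda>x. \<ominus>\<^bsub>R\<^esub> c x) \<oplus>\<^bsub>?F\<^esub> c = \<zero>\<^bsub>?F\<^esub>"
      using c by (auto simp: ops free_lmod_carrier l_neg)
    ultimately show "\<exists>y\<in>carrier ?F. y \<oplus>\<^bsub>?F\<^esub> c = \<zero>\<^bsub>?F\<^esub>" by blast
  qed (auto simp: ops free_lmod_carrier fin a_ac)
  then show ?thesis
    by (intro lmod.intro lmod_axioms.intro assms)
      (auto simp: ops free_lmod_carrier fin' l_distr r_distr m_assoc)
qed

definition unit_vec :: "('s, 'y) ring_scheme \<Rightarrow> 'x \<Rightarrow> 'x \<Rightarrow> 's"
  where "unit_vec R x = (\<lambda>y. if y = x then \<one>\<^bsub>R\<^esub> else \<zero>\<^bsub>R\<^esub>)"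

lemma unit_vec_closed:
  assumes "ring R" "x \<in> X"
  shows "unit_vec R x \<in> carrier (free_lmod R X)"
proof -
  interpret ring R by fact
  have "{y. unit_vec R x y \<noteq> \<zero>\<^bsub>R\<^esub>} \<subseteq> {x}" by (auto simp: unit_vec_def)
  then show ?thesis using assms(2)
    by (auto simp: free_lmod_def unit_vec_def intro: finite_subset)
qed

text \<open>
  Restricting the hypothesis to the support of \<open>c\<close> is what later shows that a finite sum of
  coproduct injections is supported on a finite set.
\<close>

lemma free_lmod_hom_eq_on:
  assumes "lmod R N" "f \<in> lmod_hom R (free_lmod R X) N" "g \<in> lmod_hom R (free_lmod R X) N"
    and "c \<in> carrier (free_lmod R X)"
    and "\<And>x. x \<in> X \<Longrightarrow> c x \<noteq> \<zero>\<^bsub>R\<^esub> \<Longrightarrow> f (unit_vec R x) = g (unit_vec R x)"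
  shows "f c = g c"
proof -
  interpret N: lmod R N by fact
  let ?F = "free_lmod R X"
  have F: "lmod R ?F" by (rule free_lmod_lmod) (rule N.R.ring_axioms)
  interpret F: lmod R ?F by fact
  have "finite A \<Longrightarrow> {x. c x \<noteq> \<zero>\<^bsub>R\<^esub>} = A \<Longrightarrow> c \<in> carrier ?F
      \<Longrightarrow> (\<And>x. x \<in> X \<Longrightarrow> c x \<noteq> \<zero>\<^bsub>R\<^esub> \<Longrightarrow> f (unit_vec R x) = g (unit_vec R x)) \<Longrightarrow> f c = g c" for A
  proof (induction A arbitrary: c rule: finite_induct)
    case empty
    then have "c = \<zero>\<^bsub>?F\<^esub>" by (auto simp: free_lmod_def)
    then show ?case using lmod_hom_zero[OF F assms(1) assms(2)] lmod_hom_zero[OF F assms(1) assms(3)] by simp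
  next
    case (insert a A)
    let ?c = "c(a := \<zero>\<^bsub>R\<^esub>)"
    have A: "{x. ?c x \<noteq> \<zero>\<^bsub>R\<^esub>} = A" using insert.hyps insert.prems(1) by auto
    have a: "a \<in> X" "c a \<noteq> \<zero>\<^bsub>R\<^esub>" "c a \<in> carrier R" using insert.prems by (auto simp: free_lmod_def)
    have c': "?c \<in> carrier ?F" using insert.prems insert.hyps A by (auto simp: free_lmod_def)
    have u: "unit_vec R a \<in> carrier ?F" using a by (auto intro: unit_vec_closed N.R.ring_axioms)
    have eq: "c = ?c \<oplus>\<^bsub>?F\<^esub> c a \<odot>\<^bsub>?F\<^esub> unit_vec R a"
    proof
      fix x
      have "c x \<in> carrier R" using insert.prems(2) by (auto simp: free_lmod_def)
      then show "c x = (?c \<oplus>\<^bsub>?F\<^esub> c a \<odot>\<^bsub>?F\<^esub> unit_vec R a) x"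
        using a by (auto simp: free_lmod_def unit_vec_def)
    qed
    have IH: "f ?c = g ?c"
      by (rule insert.IH[OF A c']) (use insert.prems(3) in \<open>auto split: if_splits\<close>)
    have fg: "f (unit_vec R a) = g (unit_vec R a)" using insert.prems(3) a by blast
    have *: "h c = h ?c \<oplus>\<^bsub>N\<^esub> c a \<odot>\<^bsub>N\<^esub> h (unit_vec R a)" if h: "h \<in> lmod_hom R ?F N" for h
      using arg_cong[OF eq, of h] a u c' lmod_hom_add[OF h] lmod_hom_smult[OF h] F.smult_closed by metis
    show ?case using *[OF assms(2)] *[OF assms(3)] IH fg by simp
  qed
  then show ?thesis using assms(4,5) by (auto simp: free_lmod_def)
qed

lemma free_lmod_hom_ext:
  assumes "lmod R N" "f \<in> lmod_hom R (free_lmod R X) N" "g \<in> lmod_hom R (free_lmod R X) N"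
    and "\<And>x. x \<in> X \<Longrightarrow> f (unit_vec R x) = g (unit_vec R x)"
  shows "f = g"
proof (rule PiE_ext)
  show "f \<in> carrier (free_lmod R X) \<rightarrow>\<^sub>E carrier N" "g \<in> carrier (free_lmod R X) \<rightarrow>\<^sub>E carrier N"
    using assms by (auto simp: lmod_hom_def)
  show "f c = g c" if "c \<in> carrier (free_lmod R X)" for c
    by (rule free_lmod_hom_eq_on[OF assms(1-3) that assms(4)])
qed

text \<open>
  The value at \<open>c\<close> is the sum of \<open>c x \<odot> m x\<close> over the support of \<open>c\<close>; sums over larger finite sets
  agree with it, which makes it additive.
\<close>

lemma free_lmod_hom_exists:
  assumes "lmod R N" "\<And>x. x \<in> X \<Longrightarrow> m x \<in> carrier N"
  obtains f where "f \<in> lmod_hom R (free_lmod R X) N" "\<And>x. x \<in> X \<Longrightarrow> f (unit_vec R x) = m x"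
proof -
  interpret N: lmod R N by fact
  let ?F = "free_lmod R X"
  have F: "lmod R ?F" by (rule free_lmod_lmod) (rule N.R.ring_axioms)
  define f where "f c = finsum N (\<lambda>x. c x \<odot>\<^bsub>N\<^esub> m x) {x. c x \<noteq> \<zero>\<^bsub>R\<^esub>}" for c
  have cl: "c x \<odot>\<^bsub>N\<^esub> m x \<in> carrier N" if "c \<in> carrier ?F" "x \<in> X" for c x
    using that assms(2) by (auto simp: free_lmod_def intro!: N.smult_closed)
  have sup: "f c = finsum N (\<lambda>x. c x \<odot>\<^bsub>N\<^esub> m x) A"
    if c: "c \<in> carrier ?F" and A: "finite A" "{x. c x \<noteq> \<zero>\<^bsub>R\<^esub>} \<subseteq> A" "A \<subseteq> X" for c A
    unfolding f_def
  proof (rule N.M.add.finprod_mono_neutral_cong_left)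
    show "c i \<odot>\<^bsub>N\<^esub> m i = \<zero>\<^bsub>N\<^esub>" if "i \<in> A - {x. c x \<noteq> \<zero>\<^bsub>R\<^esub>}" for i
      using that A(3) assms(2)[of i] by (auto intro: N.zero_smult)
  qed (use A cl[OF c] in auto)
  have coeff: "c x \<in> carrier R" if "c \<in> carrier ?F" for c x
    using that by (auto simp: free_lmod_def)
  have ops: "(c \<oplus>\<^bsub>?F\<^esub> c') x = c x \<oplus>\<^bsub>R\<^esub> c' x" "(r \<odot>\<^bsub>?F\<^esub> c) x = r \<otimes>\<^bsub>R\<^esub> c x" for c c' r x
    by (simp_all add: free_lmod_def)
  have "restrict f (carrier ?F) \<in> lmod_hom R ?F N"
  proof (rule lmod_homI)
    fix c assume c: "c \<in> carrier ?F"
    show "f c \<in> carrier N" unfolding f_def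
      by (rule N.M.finsum_closed) (use c cl in \<open>auto simp: free_lmod_def\<close>)
  next
    fix c c' assume c: "c \<in> carrier ?F" "c' \<in> carrier ?F"
    let ?A = "{x. c x \<noteq> \<zero>\<^bsub>R\<^esub>} \<union> {x. c' x \<noteq> \<zero>\<^bsub>R\<^esub>}"
    have A: "finite ?A" "?A \<subseteq> X" using c by (auto simp: free_lmod_def)
    have s: "c \<oplus>\<^bsub>?F\<^esub> c' \<in> carrier ?F"
      using F c by (meson abelian_groupE(1) lmod.axioms(2))
    have "f (c \<oplus>\<^bsub>?F\<^esub> c') = finsum N (\<lambda>x. (c \<oplus>\<^bsub>?F\<^esub> c') x \<odot>\<^bsub>N\<^esub> m x) ?A"
      by (rule sup[OF s A(1) _ A(2)]) (auto simp: free_lmod_def)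
    also have "\<dots> = finsum N (\<lambda>x. c x \<odot>\<^bsub>N\<^esub> m x \<oplus>\<^bsub>N\<^esub> c' x \<odot>\<^bsub>N\<^esub> m x) ?A"
    proof (rule N.M.finsum_cong')
      fix x assume "x \<in> ?A"
      with A(2) have "x \<in> X" by blast
      then show "(c \<oplus>\<^bsub>?F\<^esub> c') x \<odot>\<^bsub>N\<^esub> m x = c x \<odot>\<^bsub>N\<^esub> m x \<oplus>\<^bsub>N\<^esub> c' x \<odot>\<^bsub>N\<^esub> m x"
        using c assms(2) by (simp add: ops coeff N.smult_l_distr)
    qed (use cl[OF c(1)] cl[OF c(2)] A(2) in blast)+
    also have "\<dots> = f c \<oplus>\<^bsub>N\<^esub> f c'"
      using A(2) cl[OF c(1)] cl[OF c(2)]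
      by (subst N.M.finsum_addf) (auto simp: sup[OF c(1) A(1) _ A(2)] sup[OF c(2) A(1) _ A(2)])
    finally show "f (c \<oplus>\<^bsub>?F\<^esub> c') = f c \<oplus>\<^bsub>N\<^esub> f c'" .
  next
    fix r c assume r: "r \<in> carrier R" and c: "c \<in> carrier ?F"
    let ?A = "{x. c x \<noteq> \<zero>\<^bsub>R\<^esub>}"
    have A: "finite ?A" "?A \<subseteq> X" using c by (auto simp: free_lmod_def)
    have s: "r \<odot>\<^bsub>?F\<^esub> c \<in> carrier ?F"
      using F r c by (meson lmod.smult_closed)
    have "f (r \<odot>\<^bsub>?F\<^esub> c) = finsum N (\<lambda>x. (r \<odot>\<^bsub>?F\<^esub> c) x \<odot>\<^bsub>N\<^esub> m x) ?A"
      by (rule sup[OF s A(1) _ A(2)]) (use r in \<open>auto simp: free_lmod_def\<close>)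
    also have "\<dots> = finsum N (\<lambda>x. r \<odot>\<^bsub>N\<^esub> (c x \<odot>\<^bsub>N\<^esub> m x)) ?A"
    proof (rule N.M.finsum_cong')
      fix x assume "x \<in> ?A"
      with A(2) have "x \<in> X" by blast
      then show "(r \<odot>\<^bsub>?F\<^esub> c) x \<odot>\<^bsub>N\<^esub> m x = r \<odot>\<^bsub>N\<^esub> (c x \<odot>\<^bsub>N\<^esub> m x)"
        using c r assms(2) by (simp add: ops coeff N.smult_assoc)
    qed (use cl[OF c] N.smult_closed[OF r] A(2) in blast)+
    also have "\<dots> = r \<odot>\<^bsub>N\<^esub> f c"
    proof -
      have "finite B \<Longrightarrow> B \<subseteq> X \<Longrightarrow> finsum N (\<lambda>x. r \<odot>\<^bsub>N\<^esub> (c x \<odot>\<^bsub>N\<^esub> m x)) B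
          = r \<odot>\<^bsub>N\<^esub> finsum N (\<lambda>x. c x \<odot>\<^bsub>N\<^esub> m x) B" for B
      proof (induction B rule: finite_induct)
        case empty then show ?case using r by (simp add: N.smult_zero)
      next
        case (insert b B)
        have f1: "(\<lambda>x. c x \<odot>\<^bsub>N\<^esub> m x) \<in> B \<rightarrow> carrier N" and b1: "c b \<odot>\<^bsub>N\<^esub> m b \<in> carrier N"
          using insert.prems cl[OF c] by auto
        then have f2: "(\<lambda>x. r \<odot>\<^bsub>N\<^esub> (c x \<odot>\<^bsub>N\<^esub> m x)) \<in> B \<rightarrow> carrier N"
          and b2: "r \<odot>\<^bsub>N\<^esub> (c b \<odot>\<^bsub>N\<^esub> m b) \<in> carrier N"
          using N.smult_closed[OF r] by auto
        show ?case
          using insert.IH insert.prems insert.hyps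
          by (simp add: N.M.finsum_insert f1 f2 b1 b2 N.smult_r_distr r N.M.finsum_closed)
      qed
      then show ?thesis using A by (simp add: f_def)
    qed
    finally show "f (r \<odot>\<^bsub>?F\<^esub> c) = r \<odot>\<^bsub>N\<^esub> f c" .
  qed (rule F)
  moreover have "restrict f (carrier ?F) (unit_vec R x) = m x" if x: "x \<in> X" for x
  proof -
    have u: "unit_vec R x \<in> carrier ?F" using x by (auto intro: unit_vec_closed N.R.ring_axioms)
    have "f (unit_vec R x) = finsum N (\<lambda>y. unit_vec R x y \<odot>\<^bsub>N\<^esub> m y) {x}"
      by (rule sup[OF u]) (use x in \<open>auto simp: unit_vec_def split: if_splits\<close>)
    then show ?thesis using u x assms(2) by (simp add: unit_vec_def N.smult_one)
  qed
  ultimately show ?thesis using that by blast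
qed

section \<open>Independence of the free resolution\<close>

text \<open>
  Free resolutions of the same module are compared in the usual way. Equations are written without
  subtraction: exactness is used in the form that two elements with the same boundary differ by a
  boundary, and a homotopy satisfies \<open>c = \<alpha> c + h (d c) + d (h c)\<close>.
\<close>

lemma lmod_kernel_coset:
  assumes "lmod R M" "lmod R N" "f \<in> lmod_hom R M N"
    and "I = {c \<in> carrier M. f c = \<zero>\<^bsub>N\<^esub>}"
    and "a \<in> carrier M" "b \<in> carrier M" "f a = f b"
  shows "\<exists>k \<in> I. a = b \<oplus>\<^bsub>M\<^esub> k"
proof -
  interpret M: lmod R M by fact
  interpret N: lmod R N by fact
  let ?k = "\<ominus>\<^bsub>M\<^esub> b \<oplus>\<^bsub>M\<^esub> a"
  have k: "?k \<in> carrier M" and a: "a = b \<oplus>\<^bsub>M\<^esub> ?k"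
    using assms(5,6) by (auto simp: M.M.a_assoc[symmetric] M.M.r_neg)
  have "f b \<oplus>\<^bsub>N\<^esub> f ?k = f b"
    using lmod_hom_add[OF assms(3,6) k] a assms(7) by simp
  then have "f ?k = \<zero>\<^bsub>N\<^esub>"
    using lmod_hom_closed[OF assms(3)] assms(6) k by simp
  then show ?thesis using a k assms(4) by blast
qed

lemma free_lmod_lift:
  assumes "lmod R N" "lmod R N'" "d \<in> lmod_hom R N' N" "g \<in> lmod_hom R (free_lmod R X) N"
    and "\<And>x. x \<in> X \<Longrightarrow> g (unit_vec R x) \<in> d ` carrier N'"
  obtains k where "k \<in> lmod_hom R (free_lmod R X) N'"
    and "\<And>c. c \<in> carrier (free_lmod R X) \<Longrightarrow> d (k c) = g c"
proof -
  have R: "ring R" using assms(1) by (rule lmod.axioms)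
  from assms(5) have "\<forall>x\<in>X. \<exists>m. m \<in> carrier N' \<and> d m = g (unit_vec R x)" by force
  then obtain m where m: "\<And>x. x \<in> X \<Longrightarrow> m x \<in> carrier N' \<and> d (m x) = g (unit_vec R x)" by metis
  obtain k where k: "k \<in> lmod_hom R (free_lmod R X) N'" "\<And>x. x \<in> X \<Longrightarrow> k (unit_vec R x) = m x"
    using free_lmod_hom_exists[OF assms(2), of X m] m by blast
  have "compose (carrier (free_lmod R X)) d k = g"
    by (rule free_lmod_hom_ext[OF assms(1) lmod_hom_compose[OF free_lmod_lmod[OF R] k(1) assms(3)] assms(4)])
      (simp add: compose_def unit_vec_closed[OF R] k(2) m)
  then have "d (k c) = g c" if "c \<in> carrier (free_lmod R X)" for c
    using that by (metis compose_eq)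
  with k(1) that show ?thesis by blast
qed

locale free_res =
  fixes R :: "('s, 'y) ring_scheme" and M :: "('s, 'm, 'z) module_scheme"
    and X :: "nat \<Rightarrow> 'x set" and e d
  assumes lmod: "lmod R M" and resolution: "free_resolution R M X e d"
begin

abbreviation "F n \<equiv> free_lmod R (X n)"

lemma R: "ring R" using lmod by (rule lmod.axioms)

lemma F_lmod: "lmod R (F n)" by (rule free_lmod_lmod[OF R])

lemma e_hom: "e \<in> lmod_hom R (F 0) M" and d_hom: "d n \<in> lmod_hom R (F (Suc n)) (F n)"
  and e_surj: "e ` carrier (F 0) = carrier M"
  and d0_image: "d 0 ` carrier (F 1) = {c \<in> carrier (F 0). e c = \<zero>\<^bsub>M\<^esub>}"
  and d_image: "d (Suc n) ` carrier (F (Suc (Suc n))) =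
      {c \<in> carrier (F (Suc n)). d n c = \<zero>\<^bsub>F n\<^esub>}"
  using resolution by (auto simp: free_resolution_def)

lemma e_d: "c \<in> carrier (F (Suc 0)) \<Longrightarrow> e (d 0 c) = \<zero>\<^bsub>M\<^esub>"
  using d0_image by auto

lemma d_d: "c \<in> carrier (F (Suc (Suc n))) \<Longrightarrow> d n (d (Suc n) c) = \<zero>\<^bsub>F n\<^esub>"
  using d_image by blast

lemma e_eqD:
  assumes "a \<in> carrier (F 0)" "b \<in> carrier (F 0)" "e a = e b"
  shows "\<exists>k \<in> carrier (F (Suc 0)). a = b \<oplus>\<^bsub>F 0\<^esub> d 0 k"
  using lmod_kernel_coset[where f=e, OF F_lmod lmod e_hom d0_image assms] by auto

lemma d_eqD:
  assumes "a \<in> carrier (F (Suc n))" "b \<in> carrier (F (Suc n))" "d n a = d n b"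
  shows "\<exists>k \<in> carrier (F (Suc (Suc n))). a = b \<oplus>\<^bsub>F (Suc n)\<^esub> d (Suc n) k"
  using lmod_kernel_coset[where f="d n", OF F_lmod F_lmod d_hom d_image assms] by auto

end

lemma free_comparison_exists:
  assumes "free_res R M X e d" "free_res R M X' e' d'"
  obtains \<alpha> where "\<And>n. \<alpha> n \<in> lmod_hom R (free_lmod R (X n)) (free_lmod R (X' n))"
    and "\<And>c. c \<in> carrier (free_lmod R (X 0)) \<Longrightarrow> e' (\<alpha> 0 c) = e c"
    and "\<And>n c. c \<in> carrier (free_lmod R (X (Suc n))) \<Longrightarrow> d' n (\<alpha> (Suc n) c) = \<alpha> n (d n c)"
proof -
  interpret A: free_res R M X e d by fact
  interpret B: free_res R M X' e' d' by fact
  define ker where "ker n = (case n of 0 \<Rightarrow> {c \<in> carrier (B.F 0). e' c = \<zero>\<^bsub>M\<^esub>}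
    | Suc m \<Rightarrow> {c \<in> carrier (B.F (Suc m)). d' m c = \<zero>\<^bsub>B.F m\<^esub>})" for n
  have ker: "ker n = d' n ` carrier (B.F (Suc n))" for n
    using B.d0_image B.d_image by (auto simp: ker_def split: nat.splits)
  \<comment> \<open>The last clause says that the next boundary goes to a cycle, so that the recursion
    can continue.\<close>
  define P where "P n \<alpha> \<longleftrightarrow> \<alpha> \<in> lmod_hom R (A.F n) (B.F n) \<and>
    (n = 0 \<longrightarrow> (\<forall>c \<in> carrier (A.F 0). e' (\<alpha> c) = e c)) \<and>
    (\<forall>c \<in> carrier (A.F (Suc n)). \<alpha> (d n c) \<in> ker n)" for n \<alpha>
  have "\<exists>f. \<forall>n. P n (f n) \<and> (\<forall>c \<in> carrier (A.F (Suc n)). d' n (f (Suc n) c) = f n (d n c))"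
  proof (rule dependent_nat_choice)
    obtain k where k: "k \<in> lmod_hom R (A.F 0) (B.F 0)" "\<And>c. c \<in> carrier (A.F 0) \<Longrightarrow> e' (k c) = e c"
      using free_lmod_lift[OF A.lmod B.F_lmod B.e_hom A.e_hom] B.e_surj
        lmod_hom_closed[OF A.e_hom] unit_vec_closed[OF A.R] by metis
    then have P0: "P 0 k"
      using A.e_d lmod_hom_closed[OF A.d_hom] lmod_hom_closed[OF k(1)]
      by (auto simp: P_def ker_def)
    show "\<exists>\<alpha>. P 0 \<alpha>" by (rule exI[of _ k]) (rule P0)
  next
    fix \<alpha> n assume "P n \<alpha>"
    then have \<alpha>: "\<alpha> \<in> lmod_hom R (A.F n) (B.F n)"
      and cyc: "\<And>c. c \<in> carrier (A.F (Suc n)) \<Longrightarrow> \<alpha> (d n c) \<in> ker n" by (auto simp: P_def)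
    let ?g = "compose (carrier (A.F (Suc n))) \<alpha> (d n)"
    have g: "?g \<in> lmod_hom R (A.F (Suc n)) (B.F n)"
      by (rule lmod_hom_compose[OF A.F_lmod A.d_hom \<alpha>])
    have img: "?g (unit_vec R x) \<in> d' n ` carrier (B.F (Suc n))" if "x \<in> X (Suc n)" for x
      using cyc unit_vec_closed[OF A.R that] by (simp add: compose_eq ker)
    obtain k where k: "k \<in> lmod_hom R (A.F (Suc n)) (B.F (Suc n))"
      "\<And>c. c \<in> carrier (A.F (Suc n)) \<Longrightarrow> d' n (k c) = ?g c"
      by (rule free_lmod_lift[OF B.F_lmod B.F_lmod B.d_hom g img]) blast+
    have "k (d (Suc n) c) \<in> ker (Suc n)" if c: "c \<in> carrier (A.F (Suc (Suc n)))" for c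
    proof -
      have dc: "d (Suc n) c \<in> carrier (A.F (Suc n))" by (rule lmod_hom_closed[OF A.d_hom c])
      have "d' n (k (d (Suc n) c)) = \<zero>\<^bsub>B.F n\<^esub>"
        using k(2)[OF dc] dc A.d_d[OF c] lmod_hom_zero[OF A.F_lmod B.F_lmod \<alpha>] by (simp add: compose_eq)
      then show ?thesis using lmod_hom_closed[OF k(1) dc] by (simp add: ker_def)
    qed
    then have "P (Suc n) k" using k(1) by (simp add: P_def)
    moreover have "\<forall>c \<in> carrier (A.F (Suc n)). d' n (k c) = \<alpha> (d n c)"
      using k(2) by (simp add: compose_eq)
    ultimately show "\<exists>k. P (Suc n) k \<and> (\<forall>c \<in> carrier (A.F (Suc n)). d' n (k c) = \<alpha> (d n c))" by blast
  qed
  then obtain \<alpha> where "\<And>n. P n (\<alpha> n)"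
    "\<And>n c. c \<in> carrier (A.F (Suc n)) \<Longrightarrow> d' n (\<alpha> (Suc n) c) = \<alpha> n (d n c)" by blast
  then show ?thesis using that[of \<alpha>] by (auto simp: P_def)
qed

lemma (in free_res) homotopy_exists:
  assumes \<alpha>: "\<And>n. \<alpha> n \<in> lmod_hom R (F n) (F n)"
    and e_\<alpha>: "\<And>c. c \<in> carrier (F 0) \<Longrightarrow> e (\<alpha> 0 c) = e c"
    and d_\<alpha>: "\<And>n c. c \<in> carrier (F (Suc n)) \<Longrightarrow> d n (\<alpha> (Suc n) c) = \<alpha> n (d n c)"
  obtains h where "\<And>n. h n \<in> lmod_hom R (F n) (F (Suc n))"
    and "\<And>c. c \<in> carrier (F 0) \<Longrightarrow> c = \<alpha> 0 c \<oplus>\<^bsub>F 0\<^esub> d 0 (h 0 c)"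
    and "\<And>n c. c \<in> carrier (F (Suc n)) \<Longrightarrow>
      c = \<alpha> (Suc n) c \<oplus>\<^bsub>F (Suc n)\<^esub> h n (d n c) \<oplus>\<^bsub>F (Suc n)\<^esub> d (Suc n) (h (Suc n) c)"
proof -
  have idh: "(\<lambda>c\<in>carrier (F n). c) \<in> lmod_hom R (F n) (F n)" for n
    by (rule lmod_homI) (auto intro: F_lmod)
  \<comment> \<open>solving \<open>c = g c + d k c\<close> for \<open>k\<close> on the basis suffices\<close>
  have solve: "\<exists>k \<in> lmod_hom R (F n) (F (Suc n)). \<forall>c \<in> carrier (F n). c = g c \<oplus>\<^bsub>F n\<^esub> d n (k c)"
    if g: "g \<in> lmod_hom R (F n) (F n)"
      and ex: "\<And>x. x \<in> X n \<Longrightarrow> \<exists>k\<in>carrier (F (Suc n)). unit_vec R x = g (unit_vec R x) \<oplus>\<^bsub>F n\<^esub> d n k" for g n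
  proof -
    obtain k where k: "\<And>x. x \<in> X n \<Longrightarrow> k x \<in> carrier (F (Suc n)) \<and>
        unit_vec R x = g (unit_vec R x) \<oplus>\<^bsub>F n\<^esub> d n (k x)"
      using ex by metis
    obtain h where h: "h \<in> lmod_hom R (F n) (F (Suc n))" "\<And>x. x \<in> X n \<Longrightarrow> h (unit_vec R x) = k x"
      using free_lmod_hom_exists[OF F_lmod, of "X n" k "Suc n"] k by blast
    let ?s = "\<lambda>c\<in>carrier (F n). g c \<oplus>\<^bsub>F n\<^esub> compose (carrier (F n)) (d n) h c"
    have sc: "?s c = g c \<oplus>\<^bsub>F n\<^esub> d n (h c)" if "c \<in> carrier (F n)" for c
      using that by (simp add: compose_eq)
    have eq: "(\<lambda>c\<in>carrier (F n). c) = ?s"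
    proof (rule free_lmod_hom_ext[OF F_lmod idh])
      show "?s \<in> lmod_hom R (F n) (F n)"
        by (rule lmod_hom_sum[OF F_lmod F_lmod g lmod_hom_compose[OF F_lmod h(1) d_hom]])
      fix x assume x: "x \<in> X n"
      have "?s (unit_vec R x) = unit_vec R x"
        unfolding sc[OF unit_vec_closed[OF R x]] h(2)[OF x] using k[OF x] by (metis (no_types))
      then show "(\<lambda>c\<in>carrier (F n). c) (unit_vec R x) = ?s (unit_vec R x)"
        using unit_vec_closed[OF R x] by (metis restrict_apply')
    qed
    have "c = g c \<oplus>\<^bsub>F n\<^esub> d n (h c)" if c: "c \<in> carrier (F n)" for c
    proof -
      have "(\<lambda>c\<in>carrier (F n). c) c = c" using c by simp
      then show ?thesis unfolding eq sc[OF c] by (rule sym)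
    qed
    then show ?thesis using h(1) by blast
  qed
  define g where "g n h' = (case n of 0 \<Rightarrow> \<alpha> 0
    | Suc m \<Rightarrow> (\<lambda>c\<in>carrier (F n). \<alpha> n c \<oplus>\<^bsub>F n\<^esub> compose (carrier (F n)) h' (d m) c))" for n h'
  \<comment> \<open>The last clause is the homotopy equation on boundaries, where the summand
    \<open>h (d c)\<close> is zero.\<close>
  define P where "P n h \<longleftrightarrow> h \<in> lmod_hom R (F n) (F (Suc n)) \<and>
    (n = 0 \<longrightarrow> (\<forall>c \<in> carrier (F 0). c = \<alpha> 0 c \<oplus>\<^bsub>F 0\<^esub> d 0 (h c))) \<and>
    (\<forall>c \<in> carrier (F (Suc n)). d n c = \<alpha> n (d n c) \<oplus>\<^bsub>F n\<^esub> d n (h (d n c)))" for n h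
  have "\<exists>f. \<forall>n. P n (f n) \<and> (\<forall>c \<in> carrier (F (Suc n)).
      c = \<alpha> (Suc n) c \<oplus>\<^bsub>F (Suc n)\<^esub> f n (d n c) \<oplus>\<^bsub>F (Suc n)\<^esub> d (Suc n) (f (Suc n) c))"
  proof (rule dependent_nat_choice)
    have "\<exists>k\<in>carrier (F (Suc 0)). unit_vec R x = \<alpha> 0 (unit_vec R x) \<oplus>\<^bsub>F 0\<^esub> d 0 k" if "x \<in> X 0" for x
      using unit_vec_closed[OF R that] e_eqD[of "unit_vec R x" "\<alpha> 0 (unit_vec R x)"]
        lmod_hom_closed[OF \<alpha>] e_\<alpha> by simp
    then obtain h where "h \<in> lmod_hom R (F 0) (F (Suc 0))"
      "\<forall>c \<in> carrier (F 0). c = \<alpha> 0 c \<oplus>\<^bsub>F 0\<^esub> d 0 (h c)"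
      using solve[OF \<alpha>] by blast
    then have "P 0 h" using lmod_hom_closed[OF d_hom] unfolding P_def by blast
    then show "\<exists>h. P 0 h" by blast
  next
    fix h n assume "P n h"
    then have h: "h \<in> lmod_hom R (F n) (F (Suc n))"
      and hd: "\<And>c. c \<in> carrier (F (Suc n)) \<Longrightarrow> d n c = \<alpha> n (d n c) \<oplus>\<^bsub>F n\<^esub> d n (h (d n c))"
      unfolding P_def by blast+
    let ?g = "\<lambda>c\<in>carrier (F (Suc n)). \<alpha> (Suc n) c \<oplus>\<^bsub>F (Suc n)\<^esub> compose (carrier (F (Suc n))) h (d n) c"
    have g: "?g \<in> lmod_hom R (F (Suc n)) (F (Suc n))"
      by (rule lmod_hom_sum[OF F_lmod F_lmod \<alpha> lmod_hom_compose[OF F_lmod d_hom h]])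
    have gc: "?g c = \<alpha> (Suc n) c \<oplus>\<^bsub>F (Suc n)\<^esub> h (d n c)" if "c \<in> carrier (F (Suc n))" for c
      using that by (simp add: compose_eq)
    have dg: "d n (?g c) = d n c" if c: "c \<in> carrier (F (Suc n))" for c
    proof -
      have "d n (?g c) = \<alpha> n (d n c) \<oplus>\<^bsub>F n\<^esub> d n (h (d n c))"
        unfolding gc[OF c] d_\<alpha>[OF c, symmetric]
        by (intro lmod_hom_add[OF d_hom] lmod_hom_closed[OF \<alpha>] lmod_hom_closed[OF h]
            lmod_hom_closed[OF d_hom] c)
      then show ?thesis unfolding hd[OF c, symmetric] .
    qed
    have "\<exists>k\<in>carrier (F (Suc (Suc n))). unit_vec R x = ?g (unit_vec R x) \<oplus>\<^bsub>F (Suc n)\<^esub> d (Suc n) k"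
      if "x \<in> X (Suc n)" for x
      by (rule d_eqD) (use unit_vec_closed[OF R that] lmod_hom_closed[OF g] dg in simp_all)
    then obtain k where k: "k \<in> lmod_hom R (F (Suc n)) (F (Suc (Suc n)))"
      and k2: "\<And>c. c \<in> carrier (F (Suc n)) \<Longrightarrow> c = ?g c \<oplus>\<^bsub>F (Suc n)\<^esub> d (Suc n) (k c)"
      using solve[OF g] by blast
    have k3: "c = \<alpha> (Suc n) c \<oplus>\<^bsub>F (Suc n)\<^esub> h (d n c) \<oplus>\<^bsub>F (Suc n)\<^esub> d (Suc n) (k c)"
      if "c \<in> carrier (F (Suc n))" for c using k2[OF that] unfolding gc[OF that] .
    have "d (Suc n) c = \<alpha> (Suc n) (d (Suc n) c) \<oplus>\<^bsub>F (Suc n)\<^esub> d (Suc n) (k (d (Suc n) c))"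
      if c: "c \<in> carrier (F (Suc (Suc n)))" for c
    proof -
      interpret Fn: lmod R "F (Suc n)" by (rule F_lmod)
      have dc: "d (Suc n) c \<in> carrier (F (Suc n))" by (rule lmod_hom_closed[OF d_hom c])
      have "h (d n (d (Suc n) c)) = \<zero>\<^bsub>F (Suc n)\<^esub>"
        using d_d[OF c] lmod_hom_zero[OF F_lmod F_lmod h] by simp
      then have z: "\<alpha> (Suc n) (d (Suc n) c) \<oplus>\<^bsub>F (Suc n)\<^esub> h (d n (d (Suc n) c)) = \<alpha> (Suc n) (d (Suc n) c)"
        using lmod_hom_closed[OF \<alpha> dc] by simp
      from k3[OF dc, unfolded z] show ?thesis .
    qed
    then have "P (Suc n) k" using k unfolding P_def by blast
    then show "\<exists>k. P (Suc n) k \<and> (\<forall>c \<in> carrier (F (Suc n)).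
      c = \<alpha> (Suc n) c \<oplus>\<^bsub>F (Suc n)\<^esub> h (d n c) \<oplus>\<^bsub>F (Suc n)\<^esub> d (Suc n) (k c))"
      by (intro exI[of _ k] conjI ballI k3)
  qed
  then obtain h where h: "\<forall>n. P n (h n) \<and> (\<forall>c \<in> carrier (F (Suc n)).
      c = \<alpha> (Suc n) c \<oplus>\<^bsub>F (Suc n)\<^esub> h n (d n c) \<oplus>\<^bsub>F (Suc n)\<^esub> d (Suc n) (h (Suc n) c))" ..
  then have P: "P n (h n)" for n by blast
  note P' = P[unfolded P_def]
  show ?thesis
    by (rule that[of h, OF conjunct1[OF P'] bspec[OF mp[OF conjunct1[OF conjunct2[OF P'[of 0]]] refl]]
          bspec[OF conjunct2[OF spec[OF h]]]])
qed

section \<open>Arrows of an abelian category\<close>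

context category
begin

lemma Hom_Obj: "f \<in> Hom C X Y \<Longrightarrow> X \<in> Obj C" "f \<in> Hom C X Y \<Longrightarrow> Y \<in> Obj C"
  using Dom_Obj Cod_Obj by (auto simp: Hom_def)

lemma coproduct_Obj: "is_coproduct C I F L \<iota> \<Longrightarrow> L \<in> Obj C"
  by (simp add: is_coproduct_def)

lemma coproduct_inj: "is_coproduct C I F L \<iota> \<Longrightarrow> i \<in> I \<Longrightarrow> \<iota> i \<in> Hom C (F i) L"
  by (simp add: is_coproduct_def)

lemma coproduct_ex1:
  assumes "is_coproduct C I F L \<iota>" "Y \<in> Obj C" "\<And>i. i \<in> I \<Longrightarrow> g i \<in> Hom C (F i) Y"
  shows "\<exists>!h. h \<in> Hom C L Y \<and> (\<forall>i \<in> I. h \<cdot> \<iota> i = g i)"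
proof -
  have "\<forall>Y \<in> Obj C. \<forall>g. (\<forall>i \<in> I. g i \<in> Hom C (F i) Y) \<longrightarrow>
      (\<exists>!h. h \<in> Hom C L Y \<and> (\<forall>i \<in> I. h \<cdot> \<iota> i = g i))"
    using assms(1) unfolding is_coproduct_def by blast
  from this[THEN bspec, OF assms(2), THEN spec, of g] assms(3) show ?thesis by blast
qed

lemma coproduct_map:
  assumes "is_coproduct C I F L \<iota>" "Y \<in> Obj C" "\<And>i. i \<in> I \<Longrightarrow> g i \<in> Hom C (F i) Y"
  obtains h where "h \<in> Hom C L Y" "\<And>i. i \<in> I \<Longrightarrow> h \<cdot> \<iota> i = g i"
  using coproduct_ex1[OF assms] by blast

lemma coproduct_eqI:
  assumes "is_coproduct C I F L \<iota>" "h \<in> Hom C L Y" "h' \<in> Hom C L Y"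
    and "\<And>i. i \<in> I \<Longrightarrow> h \<cdot> \<iota> i = h' \<cdot> \<iota> i"
  shows "h = h'"
proof -
  have "\<exists>!k. k \<in> Hom C L Y \<and> (\<forall>i \<in> I. k \<cdot> \<iota> i = h' \<cdot> \<iota> i)"
    by (rule coproduct_ex1[OF assms(1) Hom_Obj(2)[OF assms(2)]])
      (rule Comp_Hom[OF coproduct_inj[OF assms(1)] assms(3)])
  moreover have "\<forall>i\<in>I. h \<cdot> \<iota> i = h' \<cdot> \<iota> i" using assms(4) by blast
  ultimately show ?thesis using assms(2,3) by blast
qed

lemma projective_coproduct:
  assumes "is_coproduct C I F L \<iota>" "\<And>i. i \<in> I \<Longrightarrow> projective C (F i)"
  shows "projective C L"
  unfolding projective_def
proof (intro conjI allI impI ballI)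
  show "L \<in> Obj C" using assms(1) by (rule coproduct_Obj)
  fix e f assume e: "epi_arr C e" and f: "f \<in> Hom C L (Cod C e)"
  have e': "e \<in> Hom C (Dom C e) (Cod C e)" using e by (auto simp: epi_arr_def Hom_def)
  have "\<exists>g \<in> Hom C (F i) (Dom C e). e \<cdot> g = f \<cdot> \<iota> i" if "i \<in> I" for i
    using assms(2)[OF that] e Comp_Hom[OF coproduct_inj[OF assms(1) that] f]
    unfolding projective_def by blast
  then obtain g where g: "\<And>i. i \<in> I \<Longrightarrow> g i \<in> Hom C (F i) (Dom C e) \<and> e \<cdot> g i = f \<cdot> \<iota> i" by metis
  obtain h where h: "h \<in> Hom C L (Dom C e)" "\<And>i. i \<in> I \<Longrightarrow> h \<cdot> \<iota> i = g i"
    using coproduct_map[OF assms(1), of "Dom C e" g] g Hom_Obj(1)[OF e'] by blast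
  have "e \<cdot> h = f"
  proof (rule coproduct_eqI[OF assms(1) Comp_Hom[OF h(1) e'] f])
    fix i assume "i \<in> I"
    then show "(e \<cdot> h) \<cdot> \<iota> i = f \<cdot> \<iota> i"
      using Comp_assoc[OF coproduct_inj[OF assms(1)] h(1) e'] h(2) g by simp
  qed
  then show "\<exists>g\<in>Hom C L (Dom C e). e \<cdot> g = f" using h(1) by blast
qed

end

context abelian_category
begin

lemma hom_group_simps [simp]:
  "carrier (hom_group C X Y) = Hom C X Y" "f \<otimes>\<^bsub>hom_group C X Y\<^esub> g = Add C f g"
  "\<one>\<^bsub>hom_group C X Y\<^esub> = Null C X Y"
  by (simp_all add: hom_group_def)

lemma Null_Hom:
  assumes "X \<in> Obj C" "Y \<in> Obj C"
  shows "Null C X Y \<in> Hom C X Y"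
proof -
  interpret comm_group "hom_group C X Y" using assms by (rule hom_comm_group)
  show ?thesis using one_closed by simp
qed

lemma Add_Hom:
  assumes "f \<in> Hom C X Y" "g \<in> Hom C X Y"
  shows "Add C f g \<in> Hom C X Y"
proof -
  interpret comm_group "hom_group C X Y" using Hom_Obj[OF assms(1)] by (rule hom_comm_group)
  show ?thesis using m_closed[of f g] assms by simp
qed

lemma Add_assoc:
  assumes "f \<in> Hom C X Y" "g \<in> Hom C X Y" "h \<in> Hom C X Y"
  shows "Add C (Add C f g) h = Add C f (Add C g h)"
proof -
  interpret comm_group "hom_group C X Y" using Hom_Obj[OF assms(1)] by (rule hom_comm_group)
  show ?thesis using m_assoc[of f g h] assms by simp
qed

lemma Add_comm:
  assumes "f \<in> Hom C X Y" "g \<in> Hom C X Y"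
  shows "Add C f g = Add C g f"
proof -
  interpret comm_group "hom_group C X Y" using Hom_Obj[OF assms(1)] by (rule hom_comm_group)
  show ?thesis using m_comm[of f g] assms by simp
qed

lemma Add_Null:
  assumes "f \<in> Hom C X Y"
  shows "Add C f (Null C X Y) = f" "Add C (Null C X Y) f = f"
proof -
  interpret comm_group "hom_group C X Y" using Hom_Obj[OF assms(1)] by (rule hom_comm_group)
  show "Add C f (Null C X Y) = f" "Add C (Null C X Y) f = f"
    using r_one[of f] l_one[of f] assms by simp_all
qed

lemma Neg_exists:
  assumes "f \<in> Hom C X Y"
  obtains g where "g \<in> Hom C X Y" "Add C f g = Null C X Y" "Add C g f = Null C X Y"
proof -
  interpret comm_group "hom_group C X Y" using Hom_Obj[OF assms(1)] by (rule hom_comm_group)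
  show ?thesis
    using that[of "inv\<^bsub>hom_group C X Y\<^esub> f"] inv_closed[of f] r_inv[of f] l_inv[of f] assms by simp
qed

lemma Add_cancel:
  assumes "f \<in> Hom C X Y" "g \<in> Hom C X Y" "h \<in> Hom C X Y" "Add C f g = Add C f h"
  shows "g = h"
proof -
  obtain n where n: "n \<in> Hom C X Y" "Add C n f = Null C X Y" using Neg_exists[OF assms(1)] by blast
  show ?thesis
    using assms n Add_assoc[OF n(1) assms(1,2)] Add_assoc[OF n(1) assms(1,3)] Add_Null by metis
qed

lemma Comp_Null:
  assumes "g \<in> Hom C Y Z" "X \<in> Obj C"
  shows "g \<cdot> Null C X Y = Null C X Z"
proof -
  have 0: "Null C X Y \<in> Hom C X Y" "Null C X Z \<in> Hom C X Z"
    using assms Hom_Obj by (auto intro: Null_Hom)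
  have c: "g \<cdot> Null C X Y \<in> Hom C X Z" using 0 assms by (blast intro: Comp_Hom)
  have "Add C (g \<cdot> Null C X Y) (g \<cdot> Null C X Y) = Add C (g \<cdot> Null C X Y) (Null C X Z)"
    using Comp_Add[OF 0(1) 0(1) assms(1)] Add_Null[OF 0(1)] Add_Null[OF c] by simp
  then show ?thesis using Add_cancel c 0 by blast
qed

lemma Null_Comp:
  assumes "f \<in> Hom C X Y" "Z \<in> Obj C"
  shows "Null C Y Z \<cdot> f = Null C X Z"
proof -
  have 0: "Null C Y Z \<in> Hom C Y Z" "Null C X Z \<in> Hom C X Z"
    using assms Hom_Obj by (auto intro: Null_Hom)
  have c: "Null C Y Z \<cdot> f \<in> Hom C X Z" using 0 assms by (blast intro: Comp_Hom)
  have "Add C (Null C Y Z \<cdot> f) (Null C Y Z \<cdot> f) = Add C (Null C Y Z \<cdot> f) (Null C X Z)"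
    using Add_Comp[OF assms(1) 0(1) 0(1)] Add_Null[OF 0(1)] Add_Null[OF c] by simp
  then show ?thesis using Add_cancel c 0 by blast
qed

lemma End_op_ring:
  assumes "Q \<in> Obj C"
  shows "ring (End_op C Q)"
proof (rule ringI)
  show "abelian_group (End_op C Q)"
  proof (rule abelian_groupI)
    fix f assume "f \<in> carrier (End_op C Q)"
    then have f: "f \<in> Hom C Q Q" by (simp add: End_op_def)
    show "\<exists>g\<in>carrier (End_op C Q). g \<oplus>\<^bsub>End_op C Q\<^esub> f = \<zero>\<^bsub>End_op C Q\<^esub>"
    proof -
      obtain g where "g \<in> Hom C Q Q" "Add C g f = Null C Q Q" using f by (rule Neg_exists)
      then show ?thesis by (auto simp: End_op_def)
    qed
  qed (use assms in \<open>auto simp: End_op_def Null_Hom Add_Hom Add_Null intro: Add_assoc Add_comm\<close>)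
  show "monoid (End_op C Q)"
    by (rule monoidI)
      (auto simp: End_op_def Ident_Comp Comp_Ident Comp_assoc[of _ Q Q _ Q _ Q]
        intro: Comp_Hom Ident_Hom[OF assms])
qed (auto simp: End_op_def Comp_Add[of _ Q Q _ _ Q] Add_Comp[of _ Q Q _ Q])

lemma Theta_lmod:
  assumes "Q \<in> Obj C" "X \<in> Obj C"
  shows "lmod (End_op C Q) (Theta C Q X)"
proof (intro lmod.intro lmod_axioms.intro End_op_ring assms)
  show "abelian_group (Theta C Q X)"
  proof (rule abelian_groupI)
    fix f assume "f \<in> carrier (Theta C Q X)"
    then have f: "f \<in> Hom C Q X" by (simp add: Theta_def)
    show "\<exists>g\<in>carrier (Theta C Q X). g \<oplus>\<^bsub>Theta C Q X\<^esub> f = \<zero>\<^bsub>Theta C Q X\<^esub>"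
    proof -
      obtain g where "g \<in> Hom C Q X" "Add C g f = Null C Q X" using f by (rule Neg_exists)
      then show ?thesis by (auto simp: Theta_def)
    qed
  qed (use assms in \<open>auto simp: Theta_def Null_Hom Add_Hom Add_Null intro: Add_assoc Add_comm\<close>)
qed (auto simp: End_op_def Theta_def Comp_Add[of _ Q Q _ _ X] Add_Comp[of _ Q Q _ X] Comp_Ident
    Comp_assoc[of _ Q Q _ Q _ X] intro: Comp_Hom)

lemma Theta_simps:
  "carrier (Theta C Q X) = Hom C Q X" "f \<oplus>\<^bsub>Theta C Q X\<^esub> g = Add C f g"
  "\<zero>\<^bsub>Theta C Q X\<^esub> = Null C Q X" "s \<odot>\<^bsub>Theta C Q X\<^esub> f = f \<cdot> s"
  by (simp_all add: Theta_def)

lemma End_op_simps: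
  "carrier (End_op C Q) = Hom C Q Q" "f \<oplus>\<^bsub>End_op C Q\<^esub> g = Add C f g"
  "\<zero>\<^bsub>End_op C Q\<^esub> = Null C Q Q" "\<one>\<^bsub>End_op C Q\<^esub> = Ident C Q" "s \<otimes>\<^bsub>End_op C Q\<^esub> f = f \<cdot> s"
  by (simp_all add: End_op_def)

lemma Theta_arr_apply: "f \<in> Hom C X Y \<Longrightarrow> g \<in> Hom C Q X \<Longrightarrow> Theta_arr C Q f g = f \<cdot> g"
  by (simp add: Theta_arr_def Hom_def)

lemma Theta_arr_hom:
  assumes "Q \<in> Obj C" "f \<in> Hom C X Y"
  shows "Theta_arr C Q f \<in> lmod_hom (End_op C Q) (Theta C Q X) (Theta C Q Y)"
proof -
  have "restrict (\<lambda>g. f \<cdot> g) (carrier (Theta C Q X)) \<in> lmod_hom (End_op C Q) (Theta C Q X) (Theta C Q Y)"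
    by (rule lmod_homI) (use assms Hom_Obj(1)[OF assms(2)] in
      \<open>auto simp: Theta_simps End_op_simps Comp_Add Comp_assoc intro: Comp_Hom Theta_lmod\<close>)
  moreover have "Dom C f = X" using assms(2) by (simp add: Hom_def)
  ultimately show ?thesis by (simp add: Theta_arr_def Theta_simps)
qed

lemma generator_of_retract:
  assumes "generator C P" "\<iota> \<in> Hom C P Q" "\<pi> \<in> Hom C Q P" "\<pi> \<cdot> \<iota> = Ident C P"
  shows "generator C Q"
  unfolding generator_def
proof (intro conjI ballI impI)
  show "Q \<in> Obj C" using assms(2) by (rule Hom_Obj)
  fix X Y f g assume f: "f \<in> Hom C X Y" and g: "g \<in> Hom C X Y" and ne: "f \<noteq> g"
  then obtain h where h: "h \<in> Hom C P X" "f \<cdot> h \<noteq> g \<cdot> h"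
    using assms(1) Hom_Obj[OF f] unfolding generator_def by blast
  have hp: "h \<cdot> \<pi> \<in> Hom C Q X" by (rule Comp_Hom[OF assms(3) h(1)])
  have *: "(k \<cdot> (h \<cdot> \<pi>)) \<cdot> \<iota> = k \<cdot> h" if "k \<in> Hom C X Y" for k
    using Comp_assoc[OF assms(2) hp that] Comp_assoc[OF assms(2,3) h(1)] assms(4) Comp_Ident[OF h(1)] by simp
  show "\<exists>h\<in>Hom C Q X. f \<cdot> h \<noteq> g \<cdot> h"
    by (rule bexI[OF _ hp]) (use *[OF f] *[OF g] h(2) in auto)
qed

end

section \<open>Small sets and small coproducts\<close>

lemma ordLess_embedding:
  assumes "|A| <o u" "Card_order u"
  obtains g where "inj_on g A" "g ` A \<subseteq> Field u"
proof -
  have "|A| \<le>o |Field u|"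
    using ordLess_imp_ordLeq[OF assms(1)] ordIso_symmetric[OF card_of_Field_ordIso[OF assms(2)]]
    by (rule ordLeq_ordIso_trans)
  then show ?thesis using that card_of_ordLeq[of A "Field u"] by blast
qed

lemma finite_ordLess_Cinfinite:
  assumes "finite A" "Cinfinite u"
  shows "|A| <o u"
proof -
  have "Well_order |A|" by (rule card_of_Well_order)
  moreover have "Well_order u" using assms(2) by (simp add: card_order_on_def)
  ultimately show ?thesis
    using assms finite_ordLess_infinite[of "|A|" u] by (simp add: Field_card_of cinfinite_def)
qed

lemma ordLess_square:
  assumes "|A| <o u" "Cinfinite u"
  shows "|A \<times> A| <o u"
proof (cases "finite A")
  case True
  then show ?thesis using assms(2) by (intro finite_ordLess_Cinfinite) auto
next
  case False
  then have "|A \<times> A| =o |A|"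
    by (intro card_of_Times_infinite_simps) (auto intro: card_of_mono1)
  then show ?thesis using assms(1) by (rule ordIso_ordLess_trans)
qed

text \<open>
  A nonempty set of cardinality at most \<open>l\<close> is an image of \<open>Field l\<close>, so there are at most
  \<open>|I| ^c l\<close> of them, plus the empty set.
\<close>

lemma small_subsets:
  assumes u: "smallness_cardinal u l" and l: "Card_order l" and I: "|I| <o u"
  shows "|{Z. Z \<subseteq> I \<and> |Z| \<le>o l}| <o u"
proof -
  have cu: "Cinfinite u" using u by (simp add: smallness_cardinal_def)
  then have inf: "\<not> finite (Field u)" and card: "Card_order u" by (auto simp: cinfinite_def)
  obtain e where e: "inj_on e I" "e ` I \<subseteq> Field u" using I card by (rule ordLess_embedding)
  have eI: "|e ` I| <o u" using card_of_image I by (rule ordLeq_ordLess_trans)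
  then have pow: "|Func (Field l) (e ` I)| <o u"
    using u e(2) by (auto simp: smallness_cardinal_def cexp_def Field_card_of)
  let ?\<Phi> = "\<lambda>f. inv_into I e ` f ` Field l"
  have "{Z. Z \<subseteq> I \<and> |Z| \<le>o l} \<subseteq> {{}} \<union> ?\<Phi> ` Func (Field l) (e ` I)"
  proof
    fix Z assume "Z \<in> {Z. Z \<subseteq> I \<and> |Z| \<le>o l}"
    then have Z: "Z \<subseteq> I" "|Z| \<le>o l" by auto
    show "Z \<in> {{}} \<union> ?\<Phi> ` Func (Field l) (e ` I)"
    proof (cases "Z = {}")
      case False
      have "|Z| \<le>o |Field l|"
        using Z(2) ordIso_symmetric[OF card_of_Field_ordIso[OF l]] by (rule ordLeq_ordIso_trans)
      then obtain p where p: "p ` Field l = Z"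
        using card_of_ordLeq2[OF False, of "Field l"] by blast
      let ?f = "\<lambda>x. if x \<in> Field l then e (p x) else undefined"
      have "?f \<in> Func (Field l) (e ` I)" using p Z by (auto simp: Func_def)
      moreover have "?\<Phi> ?f = Z"
      proof -
        have "?f ` Field l = e ` Z" unfolding p[symmetric] image_image by (rule image_cong) auto
        then show ?thesis using inv_into_image_cancel[OF e(1) Z(1)] by simp
      qed
      ultimately show ?thesis by blast
    qed simp
  qed
  moreover have "|{{}} \<union> ?\<Phi> ` Func (Field l) (e ` I)| <o u"
    by (rule card_of_Un_ordLess_infinite_Field[OF inf card])
      (auto intro: finite_ordLess_Cinfinite[OF _ cu] ordLeq_ordLess_trans[OF card_of_image pow])
  ultimately show ?thesis by (rule ordLeq_ordLess_trans[OF card_of_mono1])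
qed

text \<open>
  Cocompleteness speaks of diagrams indexed in the type of \<open>u\<close>; a small set \<open>I\<close> of any type embeds
  there and becomes a discrete category.
\<close>

lemma (in category) small_coproduct_exists:
  assumes "cocomplete u C" "Card_order u" "|I| <o u" and F: "\<And>i. i \<in> I \<Longrightarrow> F i \<in> Obj C"
  shows "\<exists>L \<iota>. is_coproduct C I F L \<iota>"
proof -
  obtain g where g: "inj_on g I" "g ` I \<subseteq> Field u" using assms(3,2) by (rule ordLess_embedding)
  define J where "J = \<lparr>Obj = g ` I, Arr = g ` I, Dom = (\<lambda>x. x), Cod = (\<lambda>x. x),
    Ident = (\<lambda>x. x), Comp = (\<lambda>b a. a)\<rparr>"
  have HomJ: "Hom J x y = {a \<in> g ` I. a = x \<and> a = y}" for x y by (auto simp: Hom_def J_def)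
  have J: "Obj J = g ` I" "Arr J = g ` I" "Dom J = (\<lambda>x. x)" "Cod J = (\<lambda>x. x)" "Ident J x = x"
    "b \<cdot>\<^bsub>J\<^esub> a = a" for x a b
    by (simp_all add: J_def)
  have "category J" by unfold_locales (auto simp: HomJ J)
  moreover have "|Arr J| <o u"
    using ordLeq_ordLess_trans[OF card_of_image assms(3)] by (simp add: J_def)
  ultimately have small: "small_category u J" by (simp add: small_category_def)
  define Fo where "Fo x = F (inv_into I g x)" for x
  define Fa where "Fa x = Ident C (Fo x)" for x
  have Fo: "Fo (g i) = F i" if "i \<in> I" for i using that g(1) by (simp add: Fo_def)
  have "is_functor J C Fo Fa"
    unfolding is_functor_def
    by (auto simp: HomJ J Fa_def Fo F Ident_Hom Ident_Comp[OF Ident_Hom])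
  then obtain L t where L: "is_colimit J C Fo Fa L t"
    using assms(1) small unfolding cocomplete_def by blast
  have cocone: "is_cocone J C Fo Fa Y s \<longleftrightarrow> Y \<in> Obj C \<and> (\<forall>i \<in> I. s (g i) \<in> Hom C (F i) Y)" for Y s
    by (auto simp: is_cocone_def HomJ J Fa_def Fo Comp_Ident)
  have "is_coproduct C I F L (\<lambda>i. t (g i))"
    unfolding is_coproduct_def
  proof (intro conjI ballI allI impI)
    have Lc: "is_cocone J C Fo Fa L t" using L by (simp add: is_colimit_def)
    then show "L \<in> Obj C" by (simp add: cocone)
    fix i assume "i \<in> I"
    then show "F i \<in> Obj C" "t (g i) \<in> Hom C (F i) L" using Lc F by (simp_all add: cocone)
  next
    fix Y s assume Y: "Y \<in> Obj C" and s: "\<forall>i\<in>I. s i \<in> Hom C (F i) Y"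
    have "is_cocone J C Fo Fa Y (\<lambda>x. s (inv_into I g x))" using Y s g(1) by (simp add: cocone)
    then have "\<exists>!h. h \<in> Hom C L Y \<and> (\<forall>j \<in> Obj J. h \<cdot>\<^bsub>C\<^esub> t j = s (inv_into I g j))"
      using L by (simp add: is_colimit_def)
    then show "\<exists>!h. h \<in> Hom C L Y \<and> (\<forall>i\<in>I. h \<cdot>\<^bsub>C\<^esub> t (g i) = s i)"
      using g(1) by (simp add: J_def)
  qed
  then show ?thesis by blast
qed

section \<open>Presentable objects\<close>

text \<open>
  An arrow \<open>f\<close> into a coproduct \<open>L\<close> is supported on \<open>Z\<close> when it factors through the subcoproduct
  indexed by \<open>Z\<close>; arrows out of \<open>L\<close> see \<open>f\<close> only through their restrictions to the summands in
  \<open>Z\<close>. This consequence is taken as the definition, as it mentions no choice of a subcoproduct.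
\<close>

definition supported_on ::
    "('o, 'a, 'z) category_scheme \<Rightarrow> 'o \<Rightarrow> ('i \<Rightarrow> 'a) \<Rightarrow> 'i set \<Rightarrow> 'a \<Rightarrow> bool"
  where "supported_on C L \<iota> Z f \<longleftrightarrow> (\<forall>Y. \<forall>h \<in> Hom C L Y. \<forall>h' \<in> Hom C L Y.
    (\<forall>z \<in> Z. h \<cdot>\<^bsub>C\<^esub> \<iota> z = h' \<cdot>\<^bsub>C\<^esub> \<iota> z) \<longrightarrow> h \<cdot>\<^bsub>C\<^esub> f = h' \<cdot>\<^bsub>C\<^esub> f)"

lemma supported_onD:
  assumes "supported_on C L \<iota> Z f" "h \<in> Hom C L Y" "h' \<in> Hom C L Y"
    and "\<And>z. z \<in> Z \<Longrightarrow> h \<cdot>\<^bsub>C\<^esub> \<iota> z = h' \<cdot>\<^bsub>C\<^esub> \<iota> z"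
  shows "h \<cdot>\<^bsub>C\<^esub> f = h' \<cdot>\<^bsub>C\<^esub> f"
  using assms unfolding supported_on_def by blast

text \<open>
  The coproduct \<open>L\<close> is the colimit of its subcoproducts \<open>G Z\<close> indexed by the subsets \<open>Z\<close> of \<open>I\<close>
  with at most \<open>l\<close> elements. Unions of at most \<open>l\<close> such sets are again of this kind, so the
  diagram is filtered for the successor of \<open>l\<close>, and it is small because \<open>u\<close> is closed under \<open>l\<close>-th
  powers. Hence an arrow from a presentable object factors through one \<open>G Z\<close>.
\<close>

lemma (in category) presentable_supported_on:
  fixes u :: "'u rel"
  assumes coc: "cocomplete u C"
    and u: "smallness_cardinal u l" and l: "Cinfinite l"
    and P: "presentable u (cardSuc l) C P"
    and L: "is_coproduct C I F L \<iota>" and I: "|I| <o u" and f: "f \<in> Hom C P L"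
  obtains Z where "Z \<subseteq> I" "|Z| \<le>o l" "supported_on C L \<iota> Z f"
proof -
  have lc: "Card_order l" and linf: "\<not> finite (Field l)" using l by (auto simp: cinfinite_def)
  have cu: "Cinfinite u" using u by (simp add: smallness_cardinal_def)
  define \<Z> where "\<Z> = {Z. Z \<subseteq> I \<and> |Z| \<le>o l}"
  have Zs: "|\<Z> \<times> \<Z>| <o u"
    unfolding \<Z>_def by (rule ordLess_square[OF small_subsets[OF u lc I] cu])
  then obtain enc :: "_ \<Rightarrow> 'u" where enc: "inj_on enc (\<Z> \<times> \<Z>)"
    by (rule ordLess_embedding) (use cu in blast)+
  define dec where "dec = inv_into (\<Z> \<times> \<Z>) enc"
  have dec: "dec (enc (Z, Z')) = (Z, Z')" if "Z \<in> \<Z>" "Z' \<in> \<Z>" for Z Z'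
    using enc that by (simp add: dec_def)
  let ?ob = "\<lambda>Z. enc (Z, Z)"
  \<comment> \<open>The poset of the sets \<open>Z\<close>, coded in the type of \<open>u\<close>: the arrow from \<open>Z\<close> to \<open>Z'\<close> is
    the code of the pair, and an object is its identity arrow.\<close>
  define J where "J = \<lparr>Obj = ?ob ` \<Z>, Arr = enc ` {(Z, Z') \<in> \<Z> \<times> \<Z>. Z \<subseteq> Z'},
    Dom = (\<lambda>a. ?ob (fst (dec a))), Cod = (\<lambda>a. ?ob (snd (dec a))),
    Ident = (\<lambda>x. x), Comp = (\<lambda>b a. enc (fst (dec a), snd (dec b)))\<rparr>"
  have ob_eq: "?ob Z = ?ob Z' \<longleftrightarrow> Z = Z'" if "Z \<in> \<Z>" "Z' \<in> \<Z>" for Z Z'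
    using inj_on_eq_iff[OF enc, of "(Z, Z)" "(Z', Z')"] that by simp
  have ObjJ: "Obj J = ?ob ` \<Z>" by (simp add: J_def)
  have HomJ: "a \<in> Hom J x y \<longleftrightarrow> (\<exists>Z Z'. Z \<in> \<Z> \<and> Z' \<in> \<Z> \<and> Z \<subseteq> Z' \<and>
      x = ?ob Z \<and> y = ?ob Z' \<and> a = enc (Z, Z'))" for a x y
  proof
    assume "a \<in> Hom J x y"
    then have a: "a \<in> Arr J" "Dom J a = x" "Cod J a = y" by (simp_all add: Hom_def)
    then obtain Z Z' where "Z \<in> \<Z>" "Z' \<in> \<Z>" "Z \<subseteq> Z'" "a = enc (Z, Z')" by (auto simp: J_def)
    with a(2,3) show "\<exists>Z Z'. Z \<in> \<Z> \<and> Z' \<in> \<Z> \<and> Z \<subseteq> Z' \<and> x = ?ob Z \<and> y = ?ob Z' \<and> a = enc (Z, Z')"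
      by (intro exI[of _ Z] exI[of _ Z']) (simp add: J_def dec)
  qed (auto simp: Hom_def J_def dec)
  have CompJ: "enc (Z', Z'') \<cdot>\<^bsub>J\<^esub> enc (Z, Z') = enc (Z, Z'')"
    if "Z \<in> \<Z>" "Z' \<in> \<Z>" "Z'' \<in> \<Z>" for Z Z' Z''
    using that by (simp add: J_def dec)
  have IdJ: "Ident J x = x" for x by (simp add: J_def)
  have HomJE: "\<exists>Z Z'. Z \<in> \<Z> \<and> Z' \<in> \<Z> \<and> Z \<subseteq> Z' \<and> x = ?ob Z \<and> y = ?ob Z' \<and> a = enc (Z, Z')"
    if "a \<in> Hom J x y" for a x y using that by (simp add: HomJ)
  have HomJ_ob: "a \<in> Hom J (?ob Z) (?ob Z') \<longleftrightarrow> Z \<subseteq> Z' \<and> a = enc (Z, Z')" if "Z \<in> \<Z>" "Z' \<in> \<Z>" for a Z Z'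
    unfolding HomJ using that ob_eq[OF that(1)] ob_eq[OF that(2)] by blast
  have catJ: "category J"
  proof
    show "Dom J f \<in> Obj J" "Cod J f \<in> Obj J" if "f \<in> Arr J" for f
      using that by (auto simp: J_def dec)
    show "Ident J X \<in> Hom J X X" if "X \<in> Obj J" for X
      using that by (auto simp: HomJ ObjJ IdJ)
  next
    fix f X Y assume "f \<in> Hom J X Y"
    then obtain Z Z' where "Z \<in> \<Z>" "Z' \<in> \<Z>" "X = ?ob Z" "Y = ?ob Z'" "f = enc (Z, Z')"
      using HomJE by blast
    then show "f \<cdot>\<^bsub>J\<^esub> Ident J X = f" "Ident J Y \<cdot>\<^bsub>J\<^esub> f = f" by (simp_all add: IdJ CompJ)
  next
    fix f g X Y W assume "f \<in> Hom J X Y" "g \<in> Hom J Y W"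
    then obtain Z Z' Z1 Z2 where *: "Z \<in> \<Z>" "Z' \<in> \<Z>" "Z \<subseteq> Z'" "X = ?ob Z" "Y = ?ob Z'" "f = enc (Z, Z')"
      "Z1 \<in> \<Z>" "Z2 \<in> \<Z>" "Z1 \<subseteq> Z2" "Y = ?ob Z1" "W = ?ob Z2" "g = enc (Z1, Z2)"
      using HomJE by metis
    then have "Z1 = Z'" using ob_eq by metis
    with * show "g \<cdot>\<^bsub>J\<^esub> f \<in> Hom J X W" by (auto simp: CompJ HomJ)
  next
    fix f g h X Y W V assume "f \<in> Hom J X Y" "g \<in> Hom J Y W" "h \<in> Hom J W V"
    then obtain Z Z' Z1 Z2 Z3 Z4 where *: "Z \<in> \<Z>" "Z' \<in> \<Z>" "Y = ?ob Z'" "f = enc (Z, Z')"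
      "Z1 \<in> \<Z>" "Z2 \<in> \<Z>" "Y = ?ob Z1" "W = ?ob Z2" "g = enc (Z1, Z2)"
      "Z3 \<in> \<Z>" "Z4 \<in> \<Z>" "W = ?ob Z3" "h = enc (Z3, Z4)"
      using HomJE by metis
    then have "Z1 = Z'" "Z3 = Z2" using ob_eq by metis+
    with * show "(h \<cdot>\<^bsub>J\<^esub> g) \<cdot>\<^bsub>J\<^esub> f = h \<cdot>\<^bsub>J\<^esub> (g \<cdot>\<^bsub>J\<^esub> f)" by (simp add: CompJ)
  qed
  have "Arr J \<subseteq> enc ` (\<Z> \<times> \<Z>)" by (auto simp: J_def)
  then have "|Arr J| <o u"
    using ordLeq_ordLess_trans[OF ordLeq_transitive[OF card_of_mono1 card_of_image] Zs] by blast
  with catJ have smallJ: "small_category u J" by (simp add: small_category_def)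
  have filt: "filtered_category (cardSuc l) J"
    unfolding filtered_category_def
  proof (intro conjI allI impI catJ)
    fix D E assume DE: "D \<subseteq> Obj J \<and> E \<subseteq> Arr J \<and> |D| <o cardSuc l \<and> |E| <o cardSuc l \<and>
      (\<forall>e\<in>E. Dom J e \<in> D \<and> Cod J e \<in> D)"
    then have "|D| \<le>o l"
      using cardSuc_ordLeq_ordLess[OF lc card_of_Card_order] by blast
    let ?U = "\<Union>x\<in>D. fst (dec x)"
    have D: "\<exists>Z \<in> \<Z>. x = ?ob Z" if "x \<in> D" for x using DE that by (auto simp: ObjJ)
    have fD: "fst (dec x) \<in> \<Z>" if x: "x \<in> D" for x using D[OF x] by (auto simp: dec)
    have "|?U| \<le>o l"
      by (rule card_of_UNION_ordLeq_infinite_Field[OF linf lc \<open>|D| \<le>o l\<close>])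
        (use fD in \<open>auto simp: \<Z>_def\<close>)
    then have U: "?U \<in> \<Z>" using fD by (auto simp: \<Z>_def)
    show "\<exists>c\<in>Obj J. \<exists>t. (\<forall>x\<in>D. t x \<in> Hom J x c) \<and> (\<forall>e\<in>E. t (Cod J e) \<cdot>\<^bsub>J\<^esub> e = t (Dom J e))"
    proof (intro bexI exI conjI ballI)
      show "?ob ?U \<in> Obj J" using U by (simp add: ObjJ)
      show "(\<lambda>x. enc (fst (dec x), ?U)) x \<in> Hom J x (?ob ?U)" if x: "x \<in> D" for x
      proof -
        obtain Z where Z: "Z \<in> \<Z>" "x = ?ob Z" using D[OF x] by blast
        then have "Z \<subseteq> ?U" using x dec[OF Z(1,1)] by force
        then show ?thesis using Z U by (auto simp: HomJ dec)
      qed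
      fix a assume "a \<in> E"
      then have "a \<in> Arr J" using DE by blast
      then obtain Z Z' where Z: "Z \<in> \<Z>" "Z' \<in> \<Z>" "a = enc (Z, Z')" by (auto simp: J_def)
      then have "Cod J a = ?ob Z'" "Dom J a = ?ob Z" by (simp_all add: J_def dec)
      then show "(\<lambda>x. enc (fst (dec x), ?U)) (Cod J a) \<cdot>\<^bsub>J\<^esub> a = (\<lambda>x. enc (fst (dec x), ?U)) (Dom J a)"
        using Z U by (simp add: dec CompJ)
    qed
  qed
  have Fi: "F i \<in> Obj C" if "i \<in> I" for i using L that by (simp add: is_coproduct_def)
  have "\<exists>G j. is_coproduct C Z F G j" if Z: "Z \<in> \<Z>" for Z
  proof (rule small_coproduct_exists[OF coc])
    have "|Z| \<le>o |I|" using Z by (auto simp: \<Z>_def intro: card_of_mono1)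
    then show "|Z| <o u" using I by (rule ordLeq_ordLess_trans)
  qed (use cu Z Fi in \<open>auto simp: \<Z>_def\<close>)
  then obtain G j where G: "\<And>Z. Z \<in> \<Z> \<Longrightarrow> is_coproduct C Z F (G Z) (j Z)" by metis
  have GO: "G Z \<in> Obj C" if "Z \<in> \<Z>" for Z using G[OF that] by (rule coproduct_Obj)
  have jH: "j Z i \<in> Hom C (F i) (G Z)" if "Z \<in> \<Z>" "i \<in> Z" for Z i
    using G[OF that(1)] that(2) by (rule coproduct_inj)
  have "\<exists>T. T \<in> Hom C (G Z) (G Z') \<and> (\<forall>i\<in>Z. T \<cdot> j Z i = j Z' i)"
    if "Z \<in> \<Z>" "Z' \<in> \<Z>" "Z \<subseteq> Z'" for Z Z'
    by (rule ex1_implies_ex[OF coproduct_ex1[OF G[OF that(1)] GO[OF that(2)]]])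
      (use jH[OF that(2)] that(3) in blast)
  then obtain T where TH: "\<And>Z Z'. Z \<in> \<Z> \<Longrightarrow> Z' \<in> \<Z> \<Longrightarrow> Z \<subseteq> Z' \<Longrightarrow> T Z Z' \<in> Hom C (G Z) (G Z')"
    and Tj: "\<And>Z Z' i. Z \<in> \<Z> \<Longrightarrow> Z' \<in> \<Z> \<Longrightarrow> Z \<subseteq> Z' \<Longrightarrow> i \<in> Z \<Longrightarrow> T Z Z' \<cdot> j Z i = j Z' i"
    by metis
  have "\<exists>t. t \<in> Hom C (G Z) L \<and> (\<forall>i\<in>Z. t \<cdot> j Z i = \<iota> i)" if Z: "Z \<in> \<Z>" for Z
    by (rule ex1_implies_ex[OF coproduct_ex1[OF G[OF Z] coproduct_Obj[OF L]]])
      (use coproduct_inj[OF L] Z in \<open>auto simp: \<Z>_def\<close>)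
  then obtain t where tH: "\<And>Z. Z \<in> \<Z> \<Longrightarrow> t Z \<in> Hom C (G Z) L"
    and tj: "\<And>Z i. Z \<in> \<Z> \<Longrightarrow> i \<in> Z \<Longrightarrow> t Z \<cdot> j Z i = \<iota> i" by metis
  define Fo where "Fo x = G (fst (dec x))" for x
  define Fa where "Fa a = T (fst (dec a)) (snd (dec a))" for a
  define t' where "t' x = t (fst (dec x))" for x
  have Fo: "Fo (?ob Z) = G Z" if "Z \<in> \<Z>" for Z using that by (simp add: Fo_def dec)
  have Fa: "Fa (enc (Z, Z')) = T Z Z'" if "Z \<in> \<Z>" "Z' \<in> \<Z>" for Z Z' using that by (simp add: Fa_def dec)
  have t': "t' (?ob Z) = t Z" if "Z \<in> \<Z>" for Z using that by (simp add: t'_def dec)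
  have T_id: "T Z Z = Ident C (G Z)" if Z: "Z \<in> \<Z>" for Z
    by (rule coproduct_eqI[OF G[OF Z] TH[OF Z Z subset_refl] Ident_Hom[OF GO[OF Z]]])
      (simp add: Tj Z Ident_Comp[OF jH[OF Z]])
  have T_comp: "T Z Z'' = T Z' Z'' \<cdot> T Z Z'"
    if Z: "Z \<in> \<Z>" "Z' \<in> \<Z>" "Z'' \<in> \<Z>" "Z \<subseteq> Z'" "Z' \<subseteq> Z''" for Z Z' Z''
  proof (rule coproduct_eqI[OF G[OF Z(1)]])
    show "T Z Z'' \<in> Hom C (G Z) (G Z'')" using Z by (intro TH) auto
    show "T Z' Z'' \<cdot> T Z Z' \<in> Hom C (G Z) (G Z'')" using Z by (intro Comp_Hom[OF TH TH])
    fix i assume i: "i \<in> Z"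
    have "(T Z' Z'' \<cdot> T Z Z') \<cdot> j Z i = T Z' Z'' \<cdot> (T Z Z' \<cdot> j Z i)"
      by (rule Comp_assoc[OF jH[OF Z(1) i] TH[OF Z(1,2,4)] TH[OF Z(2,3,5)]])
    then show "T Z Z'' \<cdot> j Z i = (T Z' Z'' \<cdot> T Z Z') \<cdot> j Z i" using Z i Tj by auto
  qed
  have functorial: "is_functor J C Fo Fa"
    unfolding is_functor_def
  proof (intro conjI ballI)
    fix x assume "x \<in> Obj J"
    then obtain Z where Z: "Z \<in> \<Z>" "x = ?ob Z" by (auto simp: ObjJ)
    then show "Fo x \<in> Obj C" "Fa (Ident J x) = Ident C (Fo x)" by (simp_all add: Fo Fa IdJ GO T_id)
  next
    fix x y a assume "a \<in> Hom J x y"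
    from HomJE[OF this] show "Fa a \<in> Hom C (Fo x) (Fo y)" by (auto simp: Fo Fa intro: TH)
  next
    fix x y w a b assume "a \<in> Hom J x y" "b \<in> Hom J y w"
    from HomJE[OF this(1)] HomJE[OF this(2)]
    obtain Z Z' Z1 Z2 where *: "Z \<in> \<Z>" "Z' \<in> \<Z>" "Z \<subseteq> Z'" "x = ?ob Z" "y = ?ob Z'" "a = enc (Z, Z')"
      "Z1 \<in> \<Z>" "Z2 \<in> \<Z>" "Z1 \<subseteq> Z2" "y = ?ob Z1" "w = ?ob Z2" "b = enc (Z1, Z2)" by blast
    then have "Z1 = Z'" using ob_eq by metis
    with * show "Fa (b \<cdot>\<^bsub>J\<^esub> a) = Fa b \<cdot> Fa a" using T_comp[of Z Z' Z2] by (simp add: CompJ Fa)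
  qed
  have cocone: "is_cocone J C Fo Fa Y s \<longleftrightarrow> Y \<in> Obj C \<and>
      (\<forall>Z\<in>\<Z>. s (?ob Z) \<in> Hom C (G Z) Y) \<and>
      (\<forall>Z\<in>\<Z>. \<forall>Z'\<in>\<Z>. Z \<subseteq> Z' \<longrightarrow> s (?ob Z') \<cdot> T Z Z' = s (?ob Z))" for Y s
    unfolding is_cocone_def ObjJ ball_simps by (simp add: HomJ_ob Fo Fa cong: conj_cong)
  have tT: "t Z' \<cdot> T Z Z' = t Z" if Z: "Z \<in> \<Z>" "Z' \<in> \<Z>" "Z \<subseteq> Z'" for Z Z'
  proof (rule coproduct_eqI[OF G[OF Z(1)] Comp_Hom[OF TH[OF Z] tH[OF Z(2)]] tH[OF Z(1)]])
    fix i assume i: "i \<in> Z"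
    have "(t Z' \<cdot> T Z Z') \<cdot> j Z i = t Z' \<cdot> (T Z Z' \<cdot> j Z i)"
      by (rule Comp_assoc[OF jH[OF Z(1) i] TH[OF Z] tH[OF Z(2)]])
    then show "(t Z' \<cdot> T Z Z') \<cdot> j Z i = t Z \<cdot> j Z i" using Z i Tj tj by auto
  qed
  have sing: "{i} \<in> \<Z>" if "i \<in> I" for i
  proof -
    have "|{i}| \<le>o l" by (rule ordLess_imp_ordLeq[OF finite_ordLess_Cinfinite[OF _ l]]) simp
    with that show ?thesis by (simp add: \<Z>_def)
  qed
  have "is_colimit J C Fo Fa L t'"
    unfolding is_colimit_def
  proof (intro conjI allI impI)
    show "is_cocone J C Fo Fa L t'"
      unfolding cocone using coproduct_Obj[OF L] tH tT by (auto simp: t')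
    fix Y s assume "is_cocone J C Fo Fa Y s"
    then have Y: "Y \<in> Obj C" and sH: "\<And>Z. Z \<in> \<Z> \<Longrightarrow> s (?ob Z) \<in> Hom C (G Z) Y"
      and sT: "\<And>Z Z'. Z \<in> \<Z> \<Longrightarrow> Z' \<in> \<Z> \<Longrightarrow> Z \<subseteq> Z' \<Longrightarrow> s (?ob Z') \<cdot> T Z Z' = s (?ob Z)"
      unfolding cocone by auto
    \<comment> \<open>The cocone is determined on \<open>L\<close> by its components at the singletons.\<close>
    obtain h where h: "h \<in> Hom C L Y" and hi: "\<And>i. i \<in> I \<Longrightarrow> h \<cdot> \<iota> i = s (?ob {i}) \<cdot> j {i} i"
    proof (rule coproduct_map[OF L Y])
      show "s (?ob {i}) \<cdot> j {i} i \<in> Hom C (F i) Y" if "i \<in> I" for i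
        using sing[OF that] by (intro Comp_Hom[OF jH sH]) auto
    qed blast
    have ht: "h \<cdot> t Z = s (?ob Z)" if Z: "Z \<in> \<Z>" for Z
    proof (rule coproduct_eqI[OF G[OF Z] Comp_Hom[OF tH[OF Z] h] sH[OF Z]])
      fix i assume i: "i \<in> Z"
      then have iI: "i \<in> I" using Z by (auto simp: \<Z>_def)
      have sub: "{i} \<subseteq> Z" using i by simp
      have "(h \<cdot> t Z) \<cdot> j Z i = h \<cdot> \<iota> i"
        using Comp_assoc[OF jH[OF Z i] tH[OF Z] h] tj[OF Z i] by simp
      also have "\<dots> = (s (?ob Z) \<cdot> T {i} Z) \<cdot> j {i} i"
        using hi[OF iI] sT[OF sing[OF iI] Z sub] by simp
      also have "\<dots> = s (?ob Z) \<cdot> j Z i"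
        using Comp_assoc[OF jH[OF sing[OF iI]] TH[OF sing[OF iI] Z sub] sH[OF Z]]
          Tj[OF sing[OF iI] Z sub] by simp
      finally show "(h \<cdot> t Z) \<cdot> j Z i = s (?ob Z) \<cdot> j Z i" .
    qed
    show "\<exists>!h. h \<in> Hom C L Y \<and> (\<forall>x\<in>Obj J. h \<cdot> t' x = s x)"
    proof (rule ex1I[of _ h])
      show "h \<in> Hom C L Y \<and> (\<forall>x\<in>Obj J. h \<cdot> t' x = s x)" using h ht by (auto simp: ObjJ t')
      fix k assume k: "k \<in> Hom C L Y \<and> (\<forall>x\<in>Obj J. k \<cdot> t' x = s x)"
      show "k = h"
      proof (rule coproduct_eqI[OF L _ h])
        show kH: "k \<in> Hom C L Y" using k by blast
        fix i assume i: "i \<in> I"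
        have kt: "k \<cdot> t {i} = h \<cdot> t {i}" using k ht[OF sing[OF i]] sing[OF i] by (auto simp: ObjJ t')
        have "x \<cdot> \<iota> i = (x \<cdot> t {i}) \<cdot> j {i} i" if "x \<in> Hom C L Y" for x
          using Comp_assoc[OF jH[OF sing[OF i]] tH[OF sing[OF i]] that] tj[OF sing[OF i]] by simp
        then show "k \<cdot> \<iota> i = h \<cdot> \<iota> i" using kt kH h by simp
      qed
    qed
  qed
  then have "Hom_preserves_colimit J C P Fo Fa L t'"
    using P smallJ filt functorial unfolding presentable_def by blast
  then obtain x g where x: "x \<in> Obj J" and g: "g \<in> Hom C P (Fo x)" and fx: "f = t' x \<cdot> g"
    using f unfolding Hom_preserves_colimit_def by blast
  then obtain Z where Z: "Z \<in> \<Z>" "x = ?ob Z" by (auto simp: ObjJ)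
  then have g: "g \<in> Hom C P (G Z)" and fZ: "f = t Z \<cdot> g" using g fx by (simp_all add: Fo t')
  have "supported_on C L \<iota> Z f"
    unfolding supported_on_def
  proof (intro allI ballI impI)
    fix Y h h' assume h: "h \<in> Hom C L Y" "h' \<in> Hom C L Y" and eq: "\<forall>z\<in>Z. h \<cdot> \<iota> z = h' \<cdot> \<iota> z"
    have "h \<cdot> t Z = h' \<cdot> t Z"
    proof (rule coproduct_eqI[OF G[OF Z(1)] Comp_Hom[OF tH[OF Z(1)] h(1)] Comp_Hom[OF tH[OF Z(1)] h(2)]])
      fix i assume i: "i \<in> Z"
      have "(x \<cdot> t Z) \<cdot> j Z i = x \<cdot> \<iota> i" if "x \<in> Hom C L Y" for x
        using Comp_assoc[OF jH[OF Z(1) i] tH[OF Z(1)] that] tj[OF Z(1) i] by simp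
      then show "(h \<cdot> t Z) \<cdot> j Z i = (h' \<cdot> t Z) \<cdot> j Z i" using h eq i by simp
    qed
    then show "h \<cdot> f = h' \<cdot> f"
      using Comp_assoc[OF g tH[OF Z(1)] h(1)] Comp_assoc[OF g tH[OF Z(1)] h(2)] fZ by simp
  qed
  then show ?thesis using that Z(1) by (auto simp: \<Z>_def)
qed

section \<open>Powers of a projective generator\<close>

context abelian_category
begin

text \<open>
  Conditional equations for the simplifier. All side conditions are about membership in \<open>Arr C\<close>,
  domains and codomains, so that they contain no variables that are absent from the left-hand
  side.
\<close>

lemma arrow_simps:
  "f \<in> Arr C \<Longrightarrow> g \<in> Arr C \<Longrightarrow> Cod C f = Dom C g \<Longrightarrow> g \<cdot> f \<in> Arr C"
  "f \<in> Arr C \<Longrightarrow> g \<in> Arr C \<Longrightarrow> Cod C f = Dom C g \<Longrightarrow> Dom C (g \<cdot> f) = Dom C f"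
  "f \<in> Arr C \<Longrightarrow> g \<in> Arr C \<Longrightarrow> Cod C f = Dom C g \<Longrightarrow> Cod C (g \<cdot> f) = Cod C g"
  "f \<in> Arr C \<Longrightarrow> g \<in> Arr C \<Longrightarrow> h \<in> Arr C \<Longrightarrow> Cod C f = Dom C g \<Longrightarrow> Cod C g = Dom C h
    \<Longrightarrow> (h \<cdot> g) \<cdot> f = h \<cdot> (g \<cdot> f)"
  "f \<in> Arr C \<Longrightarrow> g \<in> Arr C \<Longrightarrow> Dom C f = Dom C g \<Longrightarrow> Cod C f = Cod C g \<Longrightarrow> Add C f g \<in> Arr C"
  "f \<in> Arr C \<Longrightarrow> g \<in> Arr C \<Longrightarrow> Dom C f = Dom C g \<Longrightarrow> Cod C f = Cod C g \<Longrightarrow> Dom C (Add C f g) = Dom C f"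
  "f \<in> Arr C \<Longrightarrow> g \<in> Arr C \<Longrightarrow> Dom C f = Dom C g \<Longrightarrow> Cod C f = Cod C g \<Longrightarrow> Cod C (Add C f g) = Cod C f"
  "f \<in> Arr C \<Longrightarrow> f' \<in> Arr C \<Longrightarrow> Dom C f = Dom C f' \<Longrightarrow> Cod C f = Cod C f' \<Longrightarrow> g \<in> Arr C \<Longrightarrow> Dom C g = Cod C f
    \<Longrightarrow> g \<cdot> Add C f f' = Add C (g \<cdot> f) (g \<cdot> f')"
  "g \<in> Arr C \<Longrightarrow> g' \<in> Arr C \<Longrightarrow> Dom C g = Dom C g' \<Longrightarrow> Cod C g = Cod C g' \<Longrightarrow> f \<in> Arr C \<Longrightarrow> Cod C f = Dom C g
    \<Longrightarrow> Add C g g' \<cdot> f = Add C (g \<cdot> f) (g' \<cdot> f)"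
  "X \<in> Obj C \<Longrightarrow> Y \<in> Obj C \<Longrightarrow> Null C X Y \<in> Arr C"
  "X \<in> Obj C \<Longrightarrow> Y \<in> Obj C \<Longrightarrow> Dom C (Null C X Y) = X"
  "X \<in> Obj C \<Longrightarrow> Y \<in> Obj C \<Longrightarrow> Cod C (Null C X Y) = Y"
  "g \<in> Arr C \<Longrightarrow> X \<in> Obj C \<Longrightarrow> Dom C g = Y \<Longrightarrow> g \<cdot> Null C X Y = Null C X (Cod C g)"
  "f \<in> Arr C \<Longrightarrow> Z \<in> Obj C \<Longrightarrow> Cod C f = Y \<Longrightarrow> Null C Y Z \<cdot> f = Null C (Dom C f) Z"
  "f \<in> Arr C \<Longrightarrow> Dom C f = X \<Longrightarrow> Cod C f = Y \<Longrightarrow> Add C f (Null C X Y) = f"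
  "f \<in> Arr C \<Longrightarrow> Dom C f = X \<Longrightarrow> Cod C f = Y \<Longrightarrow> Add C (Null C X Y) f = f"
  "X \<in> Obj C \<Longrightarrow> Ident C X \<in> Arr C"
  "X \<in> Obj C \<Longrightarrow> Dom C (Ident C X) = X"
  "X \<in> Obj C \<Longrightarrow> Cod C (Ident C X) = X"
  "f \<in> Arr C \<Longrightarrow> Dom C f = X \<Longrightarrow> f \<cdot> Ident C X = f"
  "f \<in> Arr C \<Longrightarrow> Cod C f = X \<Longrightarrow> Ident C X \<cdot> f = f"
  "f \<in> Arr C \<Longrightarrow> Dom C f \<in> Obj C"
  "f \<in> Arr C \<Longrightarrow> Cod C f \<in> Obj C"
proof -
  have H: "f \<in> Arr C \<Longrightarrow> f \<in> Hom C (Dom C f) (Cod C f)" for f by (simp add: Hom_def)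
  { fix f g assume "f \<in> Arr C" "g \<in> Arr C" "Cod C f = Dom C g"
    then have "g \<cdot> f \<in> Hom C (Dom C f) (Cod C g)" using Comp_Hom[OF H[of f], of g "Cod C g"] by (simp add: Hom_def)
    then show "g \<cdot> f \<in> Arr C" "Dom C (g \<cdot> f) = Dom C f" "Cod C (g \<cdot> f) = Cod C g" by (simp_all add: Hom_def) }
  { fix f g assume "f \<in> Arr C" "g \<in> Arr C" "Dom C f = Dom C g" "Cod C f = Cod C g"
    then have "Add C f g \<in> Hom C (Dom C f) (Cod C f)" using Add_Hom[OF H[of f], of g] by (simp add: Hom_def)
    then show "Add C f g \<in> Arr C" "Dom C (Add C f g) = Dom C f" "Cod C (Add C f g) = Cod C f" by (simp_all add: Hom_def) }
  show "f \<in> Arr C \<Longrightarrow> g \<in> Arr C \<Longrightarrow> h \<in> Arr C \<Longrightarrow> Cod C f = Dom C g \<Longrightarrow> Cod C g = Dom C h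
    \<Longrightarrow> (h \<cdot> g) \<cdot> f = h \<cdot> (g \<cdot> f)"
    using Comp_assoc[OF H[of f], of g "Cod C g" h "Cod C h"] by (simp add: Hom_def)
  show "f \<in> Arr C \<Longrightarrow> f' \<in> Arr C \<Longrightarrow> Dom C f = Dom C f' \<Longrightarrow> Cod C f = Cod C f' \<Longrightarrow> g \<in> Arr C \<Longrightarrow> Dom C g = Cod C f
    \<Longrightarrow> g \<cdot> Add C f f' = Add C (g \<cdot> f) (g \<cdot> f')"
    using Comp_Add[OF H[of f], of f' g "Cod C g"] by (simp add: Hom_def)
  show "g \<in> Arr C \<Longrightarrow> g' \<in> Arr C \<Longrightarrow> Dom C g = Dom C g' \<Longrightarrow> Cod C g = Cod C g' \<Longrightarrow> f \<in> Arr C \<Longrightarrow> Cod C f = Dom C g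
    \<Longrightarrow> Add C g g' \<cdot> f = Add C (g \<cdot> f) (g' \<cdot> f)"
    using Add_Comp[OF H[of f], of g "Cod C g" g'] by (simp add: Hom_def)
  { fix X Y assume "X \<in> Obj C" "Y \<in> Obj C"
    then have "Null C X Y \<in> Hom C X Y" by (rule Null_Hom)
    then show "Null C X Y \<in> Arr C" "Dom C (Null C X Y) = X" "Cod C (Null C X Y) = Y" by (simp_all add: Hom_def) }
  show "g \<in> Arr C \<Longrightarrow> X \<in> Obj C \<Longrightarrow> Dom C g = Y \<Longrightarrow> g \<cdot> Null C X Y = Null C X (Cod C g)" for g Y
    using Comp_Null[OF H[of g]] by simp
  show "f \<in> Arr C \<Longrightarrow> Z \<in> Obj C \<Longrightarrow> Cod C f = Y \<Longrightarrow> Null C Y Z \<cdot> f = Null C (Dom C f) Z" for f Y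
    using Null_Comp[OF H[of f]] by simp
  show "f \<in> Arr C \<Longrightarrow> Dom C f = X \<Longrightarrow> Cod C f = Y \<Longrightarrow> Add C f (Null C X Y) = f"
    "f \<in> Arr C \<Longrightarrow> Dom C f = X \<Longrightarrow> Cod C f = Y \<Longrightarrow> Add C (Null C X Y) f = f" for f X Y
    using Add_Null[OF H[of f]] by simp_all
  { fix X assume "X \<in> Obj C"
    then have "Ident C X \<in> Hom C X X" by (rule Ident_Hom)
    then show "Ident C X \<in> Arr C" "Dom C (Ident C X) = X" "Cod C (Ident C X) = X" by (simp_all add: Hom_def) }
  show "f \<in> Arr C \<Longrightarrow> Dom C f = X \<Longrightarrow> f \<cdot> Ident C X = f" "f \<in> Arr C \<Longrightarrow> Cod C f = X \<Longrightarrow> Ident C X \<cdot> f = f" for f X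
    using Comp_Ident[OF H[of f]] Ident_Comp[OF H[of f]] by simp_all
qed (simp_all add: Dom_Obj Cod_Obj)

text \<open>
  A family of at most \<open>l\<close> elements \<open>m z\<close> of \<open>Hom C Q M\<close> amounts to at most \<open>l * l = l\<close> arrows
  \<open>P \<rightarrow> M\<close>, and these fit into a single \<open>m'\<close>, from which each \<open>m z\<close> is recovered by an endomorphism
  \<open>\<sigma> z\<close> that depends on \<open>z\<close> only. Whatever kills all \<open>m z\<close> also kills \<open>m'\<close>; this makes assembled
  elements inherit the property of being a cycle.
\<close>

lemma power_assembly:
  assumes Q: "is_coproduct C (Field l) (\<lambda>_. P) Q \<kappa>" and l: "Cinfinite l" and Z: "|Z| \<le>o l"
  obtains \<sigma> where "\<And>z. z \<in> Z \<Longrightarrow> \<sigma> z \<in> Hom C Q Q"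
    and "\<And>M m. M \<in> Obj C \<Longrightarrow> (\<And>z. z \<in> Z \<Longrightarrow> m z \<in> Hom C Q M) \<Longrightarrow>
      \<exists>m' \<in> Hom C Q M. (\<forall>z \<in> Z. m' \<cdot> \<sigma> z = m z) \<and>
        (\<forall>Y. \<forall>k \<in> Hom C M Y. (\<forall>z \<in> Z. k \<cdot> m z = Null C Q Y) \<longrightarrow> k \<cdot> m' = Null C Q Y)"
proof -
  have lc: "Card_order l" and linf: "\<not> finite (Field l)" using l by (auto simp: cinfinite_def)
  have "|Field l \<times> Z| \<le>o |Field l|"
  proof (cases "Z = {}")
    case True then show ?thesis by (simp add: card_of_empty)
  next
    case False
    have "|Z| \<le>o |Field l|"
      using Z ordIso_symmetric[OF card_of_Field_ordIso[OF lc]] by (rule ordLeq_ordIso_trans)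
    then show ?thesis using card_of_Times_infinite_simps(1)[OF linf False] ordIso_imp_ordLeq by blast
  qed
  then obtain \<phi> where inj: "inj_on \<phi> (Field l \<times> Z)" and img: "\<phi> ` (Field l \<times> Z) \<subseteq> Field l"
    using card_of_ordLeq[of "Field l \<times> Z" "Field l"] by blast
  have QO: "Q \<in> Obj C" using Q by (rule coproduct_Obj)
  obtain i0 where i0: "i0 \<in> Field l" using linf by fastforce
  have \<kappa>: "\<kappa> i \<in> Hom C P Q" if "i \<in> Field l" for i using Q that by (rule coproduct_inj)
  have PO: "P \<in> Obj C" using Hom_Obj(1)[OF \<kappa>[OF i0]] .
  have "\<exists>s. s \<in> Hom C Q Q \<and> (\<forall>i\<in>Field l. s \<cdot> \<kappa> i = \<kappa> (\<phi> (i, z)))" if z: "z \<in> Z" for z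
    by (rule ex1_implies_ex[OF coproduct_ex1[OF Q QO]]) (rule \<kappa>, use img z in blast)
  then obtain \<sigma> where \<sigma>: "\<And>z. z \<in> Z \<Longrightarrow> \<sigma> z \<in> Hom C Q Q"
    and \<sigma>\<kappa>: "\<And>z i. z \<in> Z \<Longrightarrow> i \<in> Field l \<Longrightarrow> \<sigma> z \<cdot> \<kappa> i = \<kappa> (\<phi> (i, z))" by metis
  show ?thesis
  proof (rule that[OF \<sigma>])
    fix M m assume M: "M \<in> Obj C" and m: "\<And>z. z \<in> Z \<Longrightarrow> m z \<in> Hom C Q M"
    define r where "r = inv_into (Field l \<times> Z) \<phi>"
    have r: "r (\<phi> (i, z)) = (i, z)" if "i \<in> Field l" "z \<in> Z" for i z
      using inj that by (simp add: r_def)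
    \<comment> \<open>Copies of \<open>P\<close> outside the image of \<open>\<phi>\<close> go to zero: otherwise \<open>k \<cdot> m'\<close> could be
      nonzero there.\<close>
    define g where "g j = (if j \<in> \<phi> ` (Field l \<times> Z) then m (snd (r j)) \<cdot> \<kappa> (fst (r j)) else Null C P M)" for j
    have g\<phi>: "g (\<phi> (i, z)) = m z \<cdot> \<kappa> i" if "i \<in> Field l" "z \<in> Z" for i z
      using r[OF that] that by (simp add: g_def)
    have gH: "g j \<in> Hom C P M" for j
    proof (cases "j \<in> \<phi> ` (Field l \<times> Z)")
      case True
      then obtain i z where "i \<in> Field l" "z \<in> Z" "j = \<phi> (i, z)" by blast
      then show ?thesis using g\<phi> Comp_Hom[OF \<kappa> m] by simp
    qed (simp add: g_def Null_Hom PO M)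
    have "\<exists>h. h \<in> Hom C Q M \<and> (\<forall>j\<in>Field l. h \<cdot> \<kappa> j = g j)"
      by (rule ex1_implies_ex[OF coproduct_ex1[OF Q M gH]])
    then obtain h where h: "h \<in> Hom C Q M" and h\<kappa>: "\<And>j. j \<in> Field l \<Longrightarrow> h \<cdot> \<kappa> j = g j" by blast
    show "\<exists>m' \<in> Hom C Q M. (\<forall>z \<in> Z. m' \<cdot> \<sigma> z = m z) \<and>
        (\<forall>Y. \<forall>k \<in> Hom C M Y. (\<forall>z \<in> Z. k \<cdot> m z = Null C Q Y) \<longrightarrow> k \<cdot> m' = Null C Q Y)"
    proof (intro bexI[OF _ h] conjI ballI allI impI)
      fix z assume z: "z \<in> Z"
      show "h \<cdot> \<sigma> z = m z"
      proof (rule coproduct_eqI[OF Q Comp_Hom[OF \<sigma>[OF z] h] m[OF z]])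
        fix i assume i: "i \<in> Field l"
        have "(h \<cdot> \<sigma> z) \<cdot> \<kappa> i = h \<cdot> \<kappa> (\<phi> (i, z))"
          using Comp_assoc[OF \<kappa>[OF i] \<sigma>[OF z] h] \<sigma>\<kappa>[OF z i] by simp
        also have "\<phi> (i, z) \<in> Field l" using img i z by blast
        then have "h \<cdot> \<kappa> (\<phi> (i, z)) = m z \<cdot> \<kappa> i" using h\<kappa> g\<phi>[OF i z] by simp
        finally show "(h \<cdot> \<sigma> z) \<cdot> \<kappa> i = m z \<cdot> \<kappa> i" .
      qed
    next
      fix Y k assume k: "k \<in> Hom C M Y" and k0: "\<forall>z \<in> Z. k \<cdot> m z = Null C Q Y"
      have YO: "Y \<in> Obj C" using k by (rule Hom_Obj)
      show "k \<cdot> h = Null C Q Y"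
      proof (rule coproduct_eqI[OF Q Comp_Hom[OF h k] Null_Hom[OF QO YO]])
        fix j assume j: "j \<in> Field l"
        have "(k \<cdot> h) \<cdot> \<kappa> j = k \<cdot> g j" using Comp_assoc[OF \<kappa>[OF j] h k] h\<kappa>[OF j] by simp
        also have "\<dots> = Null C P Y"
        proof (cases "j \<in> \<phi> ` (Field l \<times> Z)")
          case True
          then obtain i z where iz: "i \<in> Field l" "z \<in> Z" "j = \<phi> (i, z)" by blast
          then have "k \<cdot> g j = (k \<cdot> m z) \<cdot> \<kappa> i" using g\<phi> Comp_assoc[OF \<kappa>[OF iz(1)] m[OF iz(2)] k] by simp
          then show ?thesis using k0 iz Null_Comp[OF \<kappa>[OF iz(1)] YO] by simp
        next
          case False
          then show ?thesis using Comp_Null[OF k PO] by (simp add: g_def)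
        qed
        finally show "(k \<cdot> h) \<cdot> \<kappa> j = Null C Q Y \<cdot> \<kappa> j" using Null_Comp[OF \<kappa>[OF j] YO] by simp
      qed
    qed
  qed
qed

end

locale power_generator = abelian_category C
  for C :: "('o, 'a, 'z) ab_category_scheme" (structure) +
  fixes u :: "'u rel" and l :: "'l rel" and P Q :: 'o and \<kappa> :: "'l \<Rightarrow> 'a"
  assumes l: "Cinfinite l" and u: "smallness_cardinal u l"
    and cocomplete: "cocomplete u C"
    and Hom_small: "X \<in> Obj C \<Longrightarrow> Y \<in> Obj C \<Longrightarrow> |Hom C X Y| <o u"
    and P_projective: "projective C P" and P_generator: "generator C P"
    and P_presentable: "presentable u (cardSuc l) C P"
    and Q_power: "is_coproduct C (Field l) (\<lambda>_. P) Q \<kappa>"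
begin

lemma u': "Cinfinite u" "Card_order u" using u by (auto simp: smallness_cardinal_def)

lemma Q_Obj: "Q \<in> Obj C" using Q_power by (rule coproduct_Obj)

lemma P_Obj: "P \<in> Obj C" using P_projective by (simp add: projective_def)

lemma Q_projective: "projective C Q"
  using Q_power P_projective by (rule projective_coproduct)

lemma P_retract: "\<exists>j \<in> Hom C P Q. \<exists>p \<in> Hom C Q P. p \<cdot> j = Ident C P"
proof -
  obtain i where i: "i \<in> Field l" using l by (fastforce simp: cinfinite_def)
  have "\<exists>h. h \<in> Hom C Q P \<and> (\<forall>j\<in>Field l. h \<cdot> \<kappa> j = Ident C P)"
    by (rule ex1_implies_ex[OF coproduct_ex1[OF Q_power P_Obj]]) (rule Ident_Hom[OF P_Obj])
  then show ?thesis using coproduct_inj[OF Q_power i] i by blast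
qed

lemma Q_generator: "generator C Q"
  using P_retract generator_of_retract[OF P_generator] by blast

end

section \<open>The complex of coproducts of a free resolution\<close>

text \<open>
  The resolution \<open>(X, e, d)\<close> of \<open>\<Theta> B\<close> is turned into the complex \<open>(D, \<epsilon>, bd)\<close> over \<open>B\<close>. The map
  \<open>J n\<close>, which sends a finitely supported family of scalars to the corresponding finite sum of
  injections, is the unit of the correspondence between the two.
\<close>

locale free_realization = power_generator C u l P Q \<kappa> +
  free: free_res "End_op C Q" "Theta C Q B" X e d
  for C :: "('o, 'a, 'z) ab_category_scheme" (structure)
    and u :: "'u rel" and l :: "'l rel" and P Q \<kappa> B
    and X :: "nat \<Rightarrow> 'x set" and e d +
  fixes D \<iota> J bd \<epsilon>
  assumes B: "B \<in> Obj C"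
    and X_small: "|X n| <o u"
    and D: "is_coproduct C (X n) (\<lambda>_. Q) (D n) (\<iota> n)"
    and J_hom: "J n \<in> lmod_hom (End_op C Q) (free_lmod (End_op C Q) (X n)) (Theta C Q (D n))"
    and J_unit: "x \<in> X n \<Longrightarrow> J n (unit_vec (End_op C Q) x) = \<iota> n x"
    and bd: "bd n \<in> Hom C (D (Suc n)) (D n)"
    and bd_\<iota>: "x \<in> X (Suc n) \<Longrightarrow> bd n \<cdot> \<iota> (Suc n) x = J n (d n (unit_vec (End_op C Q) x))"
    and \<epsilon>: "\<epsilon> \<in> Hom C (D 0) B"
    and \<epsilon>_\<iota>: "x \<in> X 0 \<Longrightarrow> \<epsilon> \<cdot> \<iota> 0 x = e (unit_vec (End_op C Q) x)"

lemma (in power_generator) free_realization_exists: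
  assumes "free_res (End_op C Q) (Theta C Q B) X e d" "B \<in> Obj C" "\<And>n. |X n| <o u"
  obtains D \<iota> J bd \<epsilon> where "free_realization C u l P Q \<kappa> B X e d D \<iota> J bd \<epsilon>"
proof -
  let ?S = "End_op C Q"
  interpret free: free_res ?S "Theta C Q B" X e d by fact
  have "\<exists>L \<iota>. is_coproduct C (X n) (\<lambda>_. Q) L \<iota>" for n
    by (rule small_coproduct_exists[OF cocomplete u'(2) assms(3) Q_Obj])
  then obtain D \<iota> where D: "\<And>n. is_coproduct C (X n) (\<lambda>_. Q) (D n) (\<iota> n)" by metis
  have DO: "D n \<in> Obj C" for n using D by (rule coproduct_Obj)
  have "\<exists>J. J \<in> lmod_hom ?S (free.F n) (Theta C Q (D n)) \<and> (\<forall>x \<in> X n. J (unit_vec ?S x) = \<iota> n x)" for n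
  proof -
    have cl: "\<iota> n x \<in> carrier (Theta C Q (D n))" if "x \<in> X n" for x
      using coproduct_inj[OF D that] by (simp add: Theta_simps)
    obtain J' where "J' \<in> lmod_hom ?S (free.F n) (Theta C Q (D n))" "\<And>x. x \<in> X n \<Longrightarrow> J' (unit_vec ?S x) = \<iota> n x"
      by (rule free_lmod_hom_exists[OF Theta_lmod[OF Q_Obj DO] cl]) blast+
    then show ?thesis by blast
  qed
  then obtain J where J: "\<And>n. J n \<in> lmod_hom ?S (free.F n) (Theta C Q (D n))"
    and Ju: "\<And>n x. x \<in> X n \<Longrightarrow> J n (unit_vec ?S x) = \<iota> n x" by metis
  have JH: "J n c \<in> Hom C Q (D n)" if "c \<in> carrier (free.F n)" for n c
    using lmod_hom_closed[OF J that] by (simp add: Theta_simps)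
  have "\<exists>m. m \<in> Hom C (D (Suc n)) (D n) \<and>
      (\<forall>x \<in> X (Suc n). m \<cdot> \<iota> (Suc n) x = J n (d n (unit_vec ?S x)))" for n
    by (rule ex1_implies_ex[OF coproduct_ex1[OF D DO]])
      (intro JH lmod_hom_closed[OF free.d_hom] unit_vec_closed[OF free.R])
  then obtain bd where bd: "\<And>n. bd n \<in> Hom C (D (Suc n)) (D n)"
    "\<And>n x. x \<in> X (Suc n) \<Longrightarrow> bd n \<cdot> \<iota> (Suc n) x = J n (d n (unit_vec ?S x))" by metis
  have eH: "e c \<in> Hom C Q B" if "c \<in> carrier (free.F 0)" for c
    using lmod_hom_closed[OF free.e_hom that] by (simp add: Theta_simps)
  have "\<exists>m. m \<in> Hom C (D 0) B \<and> (\<forall>x \<in> X 0. m \<cdot> \<iota> 0 x = e (unit_vec ?S x))"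
    by (rule ex1_implies_ex[OF coproduct_ex1[OF D assms(2)]]) (intro eH unit_vec_closed[OF free.R])
  then obtain \<epsilon> where \<epsilon>: "\<epsilon> \<in> Hom C (D 0) B" "\<And>x. x \<in> X 0 \<Longrightarrow> \<epsilon> \<cdot> \<iota> 0 x = e (unit_vec ?S x)" by blast
  have "free_realization C u l P Q \<kappa> B X e d D \<iota> J bd \<epsilon>"
    by (intro free_realization.intro free_realization_axioms.intro)
      (fact power_generator_axioms | fact assms D J Ju bd \<epsilon>)+
  then show ?thesis by (rule that)
qed

context free_realization
begin

abbreviation "S \<equiv> End_op C Q"

lemma D_Obj: "D n \<in> Obj C" using D by (rule coproduct_Obj)

lemma \<iota>_Hom: "x \<in> X n \<Longrightarrow> \<iota> n x \<in> Hom C Q (D n)" using D by (rule coproduct_inj)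

lemma D_map:
  assumes "Y \<in> Obj C" "\<And>x. x \<in> X n \<Longrightarrow> g x \<in> Hom C Q Y"
  obtains h where "h \<in> Hom C (D n) Y" "\<And>x. x \<in> X n \<Longrightarrow> h \<cdot> \<iota> n x = g x"
  by (rule coproduct_map[OF D assms]) blast+

lemma D_eqI:
  assumes "h \<in> Hom C (D n) Y" "h' \<in> Hom C (D n) Y" "\<And>x. x \<in> X n \<Longrightarrow> h \<cdot> \<iota> n x = h' \<cdot> \<iota> n x"
  shows "h = h'"
  by (rule coproduct_eqI[OF D assms])

lemma J_Hom: "c \<in> carrier (free.F n) \<Longrightarrow> J n c \<in> Hom C Q (D n)"
  using lmod_hom_closed[OF J_hom] by (simp add: Theta_simps)

text \<open>
  Composition with \<open>J n\<close> is how an arrow out of \<open>D n\<close> becomes an \<open>S\<close>-linear map; such maps are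
  determined by their values on the basis.
\<close>

lemma Comp_J:
  assumes "m \<in> Hom C (D n) Y" "g \<in> lmod_hom S (free.F n) (Theta C Q Y)"
    and "c \<in> carrier (free.F n)" "\<And>x. x \<in> X n \<Longrightarrow> c x \<noteq> \<zero>\<^bsub>S\<^esub> \<Longrightarrow> m \<cdot> \<iota> n x = g (unit_vec S x)"
  shows "m \<cdot> J n c = g c"
proof -
  let ?m = "compose (carrier (free.F n)) (Theta_arr C Q m) (J n)"
  have YO: "Y \<in> Obj C" using assms(1) by (rule Hom_Obj)
  have mJ: "?m c = m \<cdot> J n c" if "c \<in> carrier (free.F n)" for c
    using that by (simp add: compose_eq Theta_arr_apply[OF assms(1) J_Hom])
  have m: "?m \<in> lmod_hom S (free.F n) (Theta C Q Y)"
    by (rule lmod_hom_compose[OF free.F_lmod J_hom Theta_arr_hom[OF Q_Obj assms(1)]])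
  have "?m c = g c"
    by (rule free_lmod_hom_eq_on[OF Theta_lmod[OF Q_Obj YO] m assms(2,3)])
      (use assms(4) mJ[OF unit_vec_closed[OF free.R]] J_unit in simp)
  then show ?thesis using mJ[OF assms(3)] by simp
qed

lemma bd_J:
  assumes "c \<in> carrier (free.F (Suc n))"
  shows "bd n \<cdot> J (Suc n) c = J n (d n c)"
proof -
  have "bd n \<cdot> J (Suc n) c = compose (carrier (free.F (Suc n))) (J n) (d n) c"
    by (rule Comp_J[OF bd lmod_hom_compose[OF free.F_lmod free.d_hom J_hom] assms])
      (simp add: bd_\<iota> compose_eq unit_vec_closed[OF free.R])
  then show ?thesis using assms by (simp add: compose_eq)
qed

lemma \<epsilon>_J: "c \<in> carrier (free.F 0) \<Longrightarrow> \<epsilon> \<cdot> J 0 c = e c"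
  by (rule Comp_J[OF \<epsilon> free.e_hom]) (simp_all add: \<epsilon>_\<iota>)

lemma J_supported:
  assumes "c \<in> carrier (free.F n)"
  shows "supported_on C (D n) (\<iota> n) {x \<in> X n. c x \<noteq> \<zero>\<^bsub>S\<^esub>} (J n c)"
  unfolding supported_on_def
proof (intro allI ballI impI)
  fix Y h h'
  assume h: "h \<in> Hom C (D n) Y" "h' \<in> Hom C (D n) Y"
    and eq: "\<forall>z\<in>{x \<in> X n. c x \<noteq> \<zero>\<^bsub>S\<^esub>}. h \<cdot> \<iota> n z = h' \<cdot> \<iota> n z"
  let ?h' = "compose (carrier (free.F n)) (Theta_arr C Q h') (J n)"
  have h'J: "?h' c = h' \<cdot> J n c" if "c \<in> carrier (free.F n)" for c
    using that by (simp add: compose_eq Theta_arr_apply[OF h(2) J_Hom])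
  have "h \<cdot> J n c = ?h' c"
    by (rule Comp_J[OF h(1) lmod_hom_compose[OF free.F_lmod J_hom Theta_arr_hom[OF Q_Obj h(2)]] assms])
      (use eq h'J[OF unit_vec_closed[OF free.R]] J_unit in auto)
  then show "h \<cdot> J n c = h' \<cdot> J n c" using h'J[OF assms] by simp
qed

text \<open>
  The coefficient at \<open>y\<close> is recovered by the projection of \<open>D n\<close> to the summand \<open>y\<close>.
\<close>

lemma J_inj:
  assumes "c \<in> carrier (free.F n)" "c' \<in> carrier (free.F n)" "J n c = J n c'"
  shows "c = c'"
proof
  fix y
  show "c y = c' y"
  proof (cases "y \<in> X n")
    case False
    then show ?thesis using assms(1,2) by (auto simp: free_lmod_carrier)
  next
    case True
    obtain p where p: "p \<in> Hom C (D n) Q"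
      "\<And>x. x \<in> X n \<Longrightarrow> p \<cdot> \<iota> n x = (if x = y then Ident C Q else Null C Q Q)"
      by (rule D_map[OF Q_Obj, of n "\<lambda>x. if x = y then Ident C Q else Null C Q Q"])
        (auto simp: Q_Obj Ident_Hom Null_Hom)
    have co: "(\<lambda>c\<in>carrier (free.F n). c y) \<in> lmod_hom S (free.F n) (Theta C Q Q)"
      by (rule lmod_homI[OF _ _ _ free.F_lmod])
        (auto simp: free_lmod_def Theta_simps End_op_simps)
    have "p \<cdot> J n c = c y" if c: "c \<in> carrier (free.F n)" for c
    proof -
      have "p \<cdot> J n c = (\<lambda>c\<in>carrier (free.F n). c y) c"
        by (rule Comp_J[OF p(1) co c])
          (use p(2) unit_vec_closed[OF free.R, of _ "X n"] in \<open>simp add: unit_vec_def End_op_simps\<close>)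
      then show ?thesis using c by simp
    qed
    from this[OF assms(1)] this[OF assms(2)] show ?thesis using assms(3) by simp
  qed
qed

lemma \<epsilon>_bd: "\<epsilon> \<cdot> bd 0 = Null C (D (Suc 0)) B"
proof (rule D_eqI[OF Comp_Hom[OF bd \<epsilon>] Null_Hom[OF D_Obj B]])
  fix x assume x: "x \<in> X (Suc 0)"
  let ?c = "unit_vec S x"
  have c: "?c \<in> carrier (free.F (Suc 0))" using x by (rule unit_vec_closed[OF free.R])
  have "(\<epsilon> \<cdot> bd 0) \<cdot> \<iota> (Suc 0) x = \<epsilon> \<cdot> J 0 (d 0 ?c)"
    using Comp_assoc[OF \<iota>_Hom[OF x] bd \<epsilon>] bd_\<iota>[OF x] by simp
  also have "\<dots> = Null C Q B"
    using \<epsilon>_J[OF lmod_hom_closed[OF free.d_hom c]] free.e_d[OF c] by (simp add: Theta_simps)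
  finally show "(\<epsilon> \<cdot> bd 0) \<cdot> \<iota> (Suc 0) x = Null C (D (Suc 0)) B \<cdot> \<iota> (Suc 0) x"
    using Null_Comp[OF \<iota>_Hom[OF x] B] by simp
qed

lemma bd_bd: "bd n \<cdot> bd (Suc n) = Null C (D (Suc (Suc n))) (D n)"
proof (rule D_eqI[OF Comp_Hom[OF bd bd] Null_Hom[OF D_Obj D_Obj]])
  fix x assume x: "x \<in> X (Suc (Suc n))"
  let ?c = "unit_vec S x"
  have c: "?c \<in> carrier (free.F (Suc (Suc n)))" using x by (rule unit_vec_closed[OF free.R])
  have "(bd n \<cdot> bd (Suc n)) \<cdot> \<iota> (Suc (Suc n)) x = bd n \<cdot> J (Suc n) (d (Suc n) ?c)"
    using Comp_assoc[OF \<iota>_Hom[OF x] bd bd] bd_\<iota>[OF x] by simp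
  also have "\<dots> = Null C Q (D n)"
    using bd_J[OF lmod_hom_closed[OF free.d_hom c]] free.d_d[OF c]
      lmod_hom_zero[OF free.F_lmod Theta_lmod[OF Q_Obj D_Obj] J_hom] by (simp add: Theta_simps)
  finally show "(bd n \<cdot> bd (Suc n)) \<cdot> \<iota> (Suc (Suc n)) x = Null C (D (Suc (Suc n))) (D n) \<cdot> \<iota> (Suc (Suc n)) x"
    using Null_Comp[OF \<iota>_Hom[OF x] D_Obj] by simp
qed

text \<open>
  The augmented complex \<open>A\<close> has \<open>B\<close> in position 0 and \<open>D n\<close> in position \<open>Suc n\<close>, which allows
  arguments on \<open>\<epsilon>\<close> and \<open>bd\<close> to be given once. The elements of \<open>Fin n\<close> are the finite elements of
  \<open>\<Theta> (A n)\<close>; those of \<open>\<Theta> B\<close> all count as finite. The lemmas below say that \<open>Fin\<close> is an exact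
  complex of \<open>S\<close>-modules and that an arrow out of \<open>D n\<close> preserves finiteness as soon as it does so
  on the injections.
\<close>

definition A :: "nat \<Rightarrow> 'o" where "A n = (case n of 0 \<Rightarrow> B | Suc m \<Rightarrow> D m)"
definition \<delta> :: "nat \<Rightarrow> 'a" where "\<delta> n = (case n of 0 \<Rightarrow> \<epsilon> | Suc m \<Rightarrow> bd m)"
definition Fin :: "nat \<Rightarrow> 'a set"
  where "Fin n = (case n of 0 \<Rightarrow> Hom C Q B | Suc m \<Rightarrow> J m ` carrier (free.F m))"

lemma A_simps [simp]: "A 0 = B" "A (Suc n) = D n" by (simp_all add: A_def)

lemma A_Obj: "A n \<in> Obj C" by (cases n) (simp_all add: B D_Obj)

lemma \<delta>_Hom: "\<delta> n \<in> Hom C (D n) (A n)"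
  by (cases n) (simp_all add: \<delta>_def \<epsilon> bd)

lemma \<delta>_\<delta>: "\<delta> n \<cdot> \<delta> (Suc n) = Null C (D (Suc n)) (A n)"
  by (cases n) (simp_all add: \<delta>_def \<epsilon>_bd bd_bd)

lemma Fin_Hom: "f \<in> Fin n \<Longrightarrow> f \<in> Hom C Q (A n)"
  by (cases n) (auto simp: Fin_def J_Hom)

lemma Fin_Comp:
  assumes "f \<in> Fin n" "s \<in> Hom C Q Q"
  shows "f \<cdot> s \<in> Fin n"
proof (cases n)
  case 0
  then show ?thesis using assms Comp_Hom by (auto simp: Fin_def)
next
  case (Suc m)
  then obtain c where c: "c \<in> carrier (free.F m)" "f = J m c" using assms(1) by (auto simp: Fin_def)
  interpret Fm: lmod S "free.F m" by (rule free.F_lmod)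
  have s: "s \<in> carrier S" using assms(2) by (simp add: End_op_simps)
  have "f \<cdot> s = J m (s \<odot>\<^bsub>free.F m\<^esub> c)"
    using lmod_hom_smult[OF J_hom s c(1)] c(2) by (simp add: Theta_simps)
  then show ?thesis using Fm.smult_closed[OF s c(1)] Suc by (simp add: Fin_def)
qed

lemma Fin_Add:
  assumes "f \<in> Fin n" "g \<in> Fin n"
  shows "Add C f g \<in> Fin n"
proof (cases n)
  case 0
  then show ?thesis using assms Add_Hom by (auto simp: Fin_def)
next
  case (Suc m)
  then obtain c c' where c: "c \<in> carrier (free.F m)" "f = J m c" "c' \<in> carrier (free.F m)" "g = J m c'"
    using assms by (auto simp: Fin_def)
  interpret Fm: lmod S "free.F m" by (rule free.F_lmod)
  have "Add C f g = J m (c \<oplus>\<^bsub>free.F m\<^esub> c')"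
    using lmod_hom_add[OF J_hom c(1,3)] c(2,4) by (simp add: Theta_simps)
  then show ?thesis using Fm.M.a_closed[OF c(1,3)] Suc by (simp add: Fin_def)
qed

lemma Fin_Null: "Null C Q (D n) \<in> Fin (Suc n)"
proof -
  interpret Fm: lmod S "free.F n" by (rule free.F_lmod)
  have "Null C Q (D n) = J n \<zero>\<^bsub>free.F n\<^esub>"
    using lmod_hom_zero[OF free.F_lmod Theta_lmod[OF Q_Obj D_Obj] J_hom] by (simp add: Theta_simps)
  then show ?thesis using Fm.M.zero_closed by (simp add: Fin_def)
qed

lemma \<iota>_Fin: "x \<in> X n \<Longrightarrow> \<iota> n x \<in> Fin (Suc n)"
  using J_unit unit_vec_closed[OF free.R] by (force simp: Fin_def)

lemma \<delta>_Fin: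
  assumes "f \<in> Fin (Suc n)"
  shows "\<delta> n \<cdot> f \<in> Fin n"
proof (cases n)
  case 0
  then show ?thesis using Comp_Hom[OF Fin_Hom[OF assms], of "\<delta> n"] \<delta>_Hom[of n] by (simp add: Fin_def)
next
  case (Suc m)
  then obtain c where c: "c \<in> carrier (free.F n)" "f = J n c" using assms by (auto simp: Fin_def)
  then show ?thesis
    using bd_J lmod_hom_closed[OF free.d_hom] Suc by (auto simp: Fin_def \<delta>_def)
qed

lemma Fin_lift:
  assumes "f \<in> Fin n" "\<And>m. n = Suc m \<Longrightarrow> \<delta> m \<cdot> f = Null C Q (A m)"
  shows "\<exists>g \<in> Fin (Suc n). \<delta> n \<cdot> g = f"
proof (cases n)
  case 0
  then have "f \<in> e ` carrier (free.F 0)" using assms(1) free.e_surj by (simp add: Fin_def Theta_simps)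
  then show ?thesis using \<epsilon>_J 0 by (auto simp: Fin_def \<delta>_def)
next
  case (Suc m)
  then obtain c where c: "c \<in> carrier (free.F m)" "f = J m c" using assms(1) by (auto simp: Fin_def)
  have "c \<in> d m ` carrier (free.F (Suc m))"
  proof (cases m)
    case 0
    then have "e c = \<zero>\<^bsub>Theta C Q B\<^esub>" using c assms(2)[OF Suc] \<epsilon>_J[of c] by (simp add: \<delta>_def Theta_simps)
    then show ?thesis using free.d0_image c(1) 0 by simp
  next
    case (Suc k)
    interpret Fk: lmod S "free.F k" by (rule free.F_lmod)
    have dc: "d k c \<in> carrier (free.F k)" using c(1) Suc lmod_hom_closed[OF free.d_hom] by simp
    have "J k (d k c) = J k \<zero>\<^bsub>free.F k\<^esub>"
      using c assms(2)[OF \<open>n = Suc m\<close>] bd_J[of c k] Suc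
        lmod_hom_zero[OF free.F_lmod Theta_lmod[OF Q_Obj D_Obj] J_hom] by (simp add: \<delta>_def Theta_simps)
    then have "d k c = \<zero>\<^bsub>free.F k\<^esub>" by (rule J_inj[OF dc Fk.M.zero_closed])
    then show ?thesis using free.d_image c(1) Suc by simp
  qed
  then show ?thesis using bd_J Suc c(2) by (auto simp: Fin_def \<delta>_def)
qed

lemma Fin_difference:
  assumes "f \<in> Fin (Suc n)" "g \<in> Fin (Suc n)" "\<delta> n \<cdot> f = \<delta> n \<cdot> g"
  shows "\<exists>h \<in> Fin (Suc (Suc n)). f = Add C g (\<delta> (Suc n) \<cdot> h)"
proof -
  obtain a b where a: "a \<in> carrier (free.F n)" "f = J n a" and b: "b \<in> carrier (free.F n)" "g = J n b"
    using assms by (auto simp: Fin_def)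
  have "\<exists>k \<in> carrier (free.F (Suc n)). a = b \<oplus>\<^bsub>free.F n\<^esub> d n k"
  proof (cases n)
    case 0
    then have "e a = e b" using a b assms(3) \<epsilon>_J by (simp add: \<delta>_def)
    then show ?thesis using free.e_eqD a(1) b(1) 0 by simp
  next
    case (Suc m)
    then have ab: "a \<in> carrier (free.F (Suc m))" "b \<in> carrier (free.F (Suc m))" using a b by auto
    have "J m (d m a) = J m (d m b)" using a b assms(3) bd_J[OF ab(1)] bd_J[OF ab(2)] Suc by (simp add: \<delta>_def)
    then have "d m a = d m b" by (rule J_inj[OF lmod_hom_closed[OF free.d_hom ab(1)] lmod_hom_closed[OF free.d_hom ab(2)]])
    then show ?thesis using free.d_eqD[OF ab] Suc by simp
  qed
  then obtain k where k: "k \<in> carrier (free.F (Suc n))" and ak: "a = b \<oplus>\<^bsub>free.F n\<^esub> d n k" by blast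
  have "J n a = Add C (J n b) (J n (d n k))"
    unfolding ak using lmod_hom_add[OF J_hom b(1) lmod_hom_closed[OF free.d_hom k]] by (simp add: Theta_simps)
  then have "f = Add C g (\<delta> (Suc n) \<cdot> J (Suc n) k)" unfolding a(2) b(2) by (simp add: \<delta>_def bd_J[OF k])
  then show ?thesis using k by (auto simp: Fin_def)
qed

lemma Fin_finite_support:
  assumes "f \<in> Fin (Suc n)"
  shows "\<exists>Z \<subseteq> X n. finite Z \<and> supported_on C (D n) (\<iota> n) Z f"
proof -
  obtain c where c: "c \<in> carrier (free.F n)" "f = J n c" using assms by (auto simp: Fin_def)
  let ?Z = "{x \<in> X n. c x \<noteq> \<zero>\<^bsub>S\<^esub>}"
  have "finite {x. c x \<noteq> \<zero>\<^bsub>S\<^esub>}" using c(1) free_lmod_carrier by blast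
  then have "finite ?Z" by (rule rev_finite_subset) blast
  moreover have "supported_on C (D n) (\<iota> n) ?Z f" unfolding c(2) by (rule J_supported[OF c(1)])
  moreover have "?Z \<subseteq> X n" by blast
  ultimately show ?thesis by (intro exI[of _ ?Z] conjI)
qed

lemma Fin_map:
  assumes "\<eta> \<in> Hom C (D n) (A m)" "\<And>x. x \<in> X n \<Longrightarrow> \<eta> \<cdot> \<iota> n x \<in> Fin m" "f \<in> Fin (Suc n)"
  shows "\<eta> \<cdot> f \<in> Fin m"
proof (cases m)
  case 0
  then show ?thesis using Comp_Hom[OF Fin_Hom[OF assms(3)], of \<eta>] assms(1) by (simp add: Fin_def)
next
  case (Suc k)
  obtain c where c: "c \<in> carrier (free.F n)" "f = J n c" using assms(3) by (auto simp: Fin_def)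
  have "\<forall>x\<in>X n. \<exists>g. g \<in> carrier (free.F k) \<and> J k g = \<eta> \<cdot> \<iota> n x" using assms(2) Suc by (force simp: Fin_def)
  then obtain g where g: "\<And>x. x \<in> X n \<Longrightarrow> g x \<in> carrier (free.F k) \<and> J k (g x) = \<eta> \<cdot> \<iota> n x" by metis
  obtain G where G: "G \<in> lmod_hom S (free.F n) (free.F k)" "\<And>x. x \<in> X n \<Longrightarrow> G (unit_vec S x) = g x"
    by (rule free_lmod_hom_exists[OF free.F_lmod, of "X n" g k]) (use g in blast)+
  have \<eta>: "\<eta> \<in> Hom C (D n) (D k)" using assms(1) Suc by simp
  have "\<eta> \<cdot> J n c = compose (carrier (free.F n)) (J k) G c"
    by (rule Comp_J[OF \<eta> lmod_hom_compose[OF free.F_lmod G(1) J_hom] c(1)])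
      (simp add: compose_eq unit_vec_closed[OF free.R] G(2) g)
  then show ?thesis using c lmod_hom_closed[OF G(1) c(1)] Suc by (simp add: compose_eq Fin_def)
qed

end

section \<open>Exactness of the complex of coproducts\<close>

context free_realization
begin

text \<open>
  On arrows supported on \<open>Z\<close>, the identity of \<open>D n\<close> is homotopic to \<open>w \<cdot> \<rho>\<close>, which factors through
  a single finite element \<open>w\<close>. The homotopy consists of \<open>\<eta>'\<close>, which comes from one degree below,
  and of \<open>\<eta>\<close>, which has to preserve finiteness for the sake of the degree above.
\<close>

definition contracts :: "nat \<Rightarrow> 'x set \<Rightarrow> 'a \<Rightarrow> 'a \<Rightarrow> 'a \<Rightarrow> 'a \<Rightarrow> bool"
  where "contracts n Z \<eta>' \<eta> w \<rho> \<longleftrightarrow>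
    \<eta>' \<in> Hom C (A n) (D n) \<and> \<eta> \<in> Hom C (D n) (D (Suc n)) \<and>
    (\<forall>x \<in> X n. \<eta> \<cdot> \<iota> n x \<in> Fin (Suc (Suc n))) \<and> w \<in> Fin (Suc n) \<and> \<rho> \<in> Hom C (D n) Q \<and>
    (\<forall>R. \<forall>f \<in> Hom C R (D n). supported_on C (D n) (\<iota> n) Z f \<longrightarrow>
      f = Add C (\<eta>' \<cdot> (\<delta> n \<cdot> f)) (Add C (\<delta> (Suc n) \<cdot> (\<eta> \<cdot> f)) (w \<cdot> (\<rho> \<cdot> f))))"

text \<open>
  Let \<open>w\<close> be a finite preimage of the cycle \<open>m\<close>. By the last hypothesis, \<open>\<iota> n z\<close> and
  \<open>\<eta>' \<cdot> \<delta> n \<cdot> \<iota> n z + w \<cdot> \<sigma> z\<close> have the same boundary. They are both finite, so they differ by the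
  boundary of a finite element, and this element is the value of \<open>\<eta>\<close> at \<open>z\<close>.
\<close>

lemma local_contraction_step:
  assumes Z: "Z \<subseteq> X n" and \<sigma>: "\<And>z. z \<in> Z \<Longrightarrow> \<sigma> z \<in> Hom C Q Q"
    and \<eta>': "\<eta>' \<in> Hom C (A n) (D n)" "\<And>f. f \<in> Fin n \<Longrightarrow> \<eta>' \<cdot> f \<in> Fin (Suc n)"
    and m: "m \<in> Fin n" "\<And>k. n = Suc k \<Longrightarrow> \<delta> k \<cdot> m = Null C Q (A k)"
    and eq: "\<And>z. z \<in> Z \<Longrightarrow> \<delta> n \<cdot> \<iota> n z = Add C (\<delta> n \<cdot> (\<eta>' \<cdot> (\<delta> n \<cdot> \<iota> n z))) (m \<cdot> \<sigma> z)"
  shows "\<exists>\<eta> w \<rho>. contracts n Z \<eta>' \<eta> w \<rho>"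
proof -
  obtain w where w: "w \<in> Fin (Suc n)" "\<delta> n \<cdot> w = m" using Fin_lift[OF m] by blast
  have wH: "w \<in> Hom C Q (D n)" using Fin_Hom[OF w(1)] by simp
  have dH: "\<delta> n \<in> Hom C (D n) (A n)" "\<delta> (Suc n) \<in> Hom C (D (Suc n)) (D n)"
    using \<delta>_Hom[of n] \<delta>_Hom[of "Suc n"] by simp_all
  have "\<exists>h \<in> Fin (Suc (Suc n)). \<iota> n z = Add C (Add C (\<eta>' \<cdot> (\<delta> n \<cdot> \<iota> n z)) (w \<cdot> \<sigma> z)) (\<delta> (Suc n) \<cdot> h)"
    if z: "z \<in> Z" for z
  proof (rule Fin_difference)
    have zX: "z \<in> X n" using z Z by blast
    show "\<iota> n z \<in> Fin (Suc n)" using zX by (rule \<iota>_Fin)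
    show "Add C (\<eta>' \<cdot> (\<delta> n \<cdot> \<iota> n z)) (w \<cdot> \<sigma> z) \<in> Fin (Suc n)"
      by (intro Fin_Add \<eta>'(2) \<delta>_Fin \<iota>_Fin zX Fin_Comp w(1) \<sigma> z)
    have "\<delta> n \<cdot> (w \<cdot> \<sigma> z) = m \<cdot> \<sigma> z" using Comp_assoc[OF \<sigma>[OF z] wH dH(1)] w(2) by simp
    then have "\<delta> n \<cdot> Add C (\<eta>' \<cdot> (\<delta> n \<cdot> \<iota> n z)) (w \<cdot> \<sigma> z)
        = Add C (\<delta> n \<cdot> (\<eta>' \<cdot> (\<delta> n \<cdot> \<iota> n z))) (m \<cdot> \<sigma> z)"
      using Comp_Add[OF Comp_Hom[OF Comp_Hom[OF \<iota>_Hom[OF zX] dH(1)] \<eta>'(1)] Comp_Hom[OF \<sigma>[OF z] wH] dH(1)] by simp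
    then show "\<delta> n \<cdot> \<iota> n z = \<delta> n \<cdot> Add C (\<eta>' \<cdot> (\<delta> n \<cdot> \<iota> n z)) (w \<cdot> \<sigma> z)"
      using eq[OF z] by (rule trans[rotated, OF sym])
  qed
  then obtain h where h: "\<And>z. z \<in> Z \<Longrightarrow> h z \<in> Fin (Suc (Suc n))"
    and \<iota>h: "\<And>z. z \<in> Z \<Longrightarrow> \<iota> n z = Add C (Add C (\<eta>' \<cdot> (\<delta> n \<cdot> \<iota> n z)) (w \<cdot> \<sigma> z)) (\<delta> (Suc n) \<cdot> h z)"
    by metis
  have hH: "h z \<in> Hom C Q (D (Suc n))" if "z \<in> Z" for z using Fin_Hom[OF h[OF that]] by simp
  obtain \<eta> where \<eta>: "\<eta> \<in> Hom C (D n) (D (Suc n))"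
    and \<eta>\<iota>: "\<And>x. x \<in> X n \<Longrightarrow> \<eta> \<cdot> \<iota> n x = (if x \<in> Z then h x else Null C Q (D (Suc n)))"
    by (rule D_map[OF D_Obj, of n "\<lambda>x. if x \<in> Z then h x else Null C Q (D (Suc n))" "Suc n"])
      (auto simp: hH Null_Hom Q_Obj D_Obj)
  obtain \<rho> where \<rho>: "\<rho> \<in> Hom C (D n) Q"
    and \<rho>\<iota>: "\<And>x. x \<in> X n \<Longrightarrow> \<rho> \<cdot> \<iota> n x = (if x \<in> Z then \<sigma> x else Null C Q Q)"
    by (rule D_map[OF Q_Obj, of n "\<lambda>x. if x \<in> Z then \<sigma> x else Null C Q Q"])
      (auto simp: \<sigma> Null_Hom Q_Obj)
  let ?E = "Add C (\<eta>' \<cdot> \<delta> n) (Add C (\<delta> (Suc n) \<cdot> \<eta>) (w \<cdot> \<rho>))"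
  have E_Hom: "?E \<in> Hom C (D n) (D n)"
    by (intro Add_Hom Comp_Hom[OF dH(1) \<eta>'(1)] Comp_Hom[OF \<eta> dH(2)] Comp_Hom[OF \<rho> wH])
  have E: "?E \<cdot> f = Add C (\<eta>' \<cdot> (\<delta> n \<cdot> f)) (Add C (\<delta> (Suc n) \<cdot> (\<eta> \<cdot> f)) (w \<cdot> (\<rho> \<cdot> f)))"
    if "f \<in> Hom C R (D n)" for R f
    using that \<eta> \<rho> wH dH \<eta>'(1) by (simp add: Hom_def arrow_simps)
  have E\<iota>: "?E \<cdot> \<iota> n z = \<iota> n z" if z: "z \<in> Z" for z
  proof -
    have zX: "z \<in> X n" using z Z by blast
    have c: "\<eta>' \<cdot> (\<delta> n \<cdot> \<iota> n z) \<in> Hom C Q (D n)" "w \<cdot> \<sigma> z \<in> Hom C Q (D n)" "\<delta> (Suc n) \<cdot> h z \<in> Hom C Q (D n)"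
      by (rule Comp_Hom[OF Comp_Hom[OF \<iota>_Hom[OF zX] dH(1)] \<eta>'(1)] Comp_Hom[OF \<sigma>[OF z] wH]
          Comp_Hom[OF hH[OF z] dH(2)])+
    have "?E \<cdot> \<iota> n z = Add C (\<eta>' \<cdot> (\<delta> n \<cdot> \<iota> n z)) (Add C (\<delta> (Suc n) \<cdot> h z) (w \<cdot> \<sigma> z))"
      unfolding E[OF \<iota>_Hom[OF zX]] \<eta>\<iota>[OF zX] \<rho>\<iota>[OF zX] using z by simp
    also have "\<dots> = Add C (Add C (\<eta>' \<cdot> (\<delta> n \<cdot> \<iota> n z)) (w \<cdot> \<sigma> z)) (\<delta> (Suc n) \<cdot> h z)"
      unfolding Add_comm[OF c(3,2)] by (rule Add_assoc[OF c, symmetric])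
    also have "\<dots> = \<iota> n z" by (rule \<iota>h[OF z, symmetric])
    finally show ?thesis .
  qed
  have "f = Add C (\<eta>' \<cdot> (\<delta> n \<cdot> f)) (Add C (\<delta> (Suc n) \<cdot> (\<eta> \<cdot> f)) (w \<cdot> (\<rho> \<cdot> f)))"
    if f: "f \<in> Hom C R (D n)" and supp: "supported_on C (D n) (\<iota> n) Z f" for R f
  proof -
    have "Ident C (D n) \<cdot> f = ?E \<cdot> f"
    proof (rule supported_onD[OF supp Ident_Hom[OF D_Obj] E_Hom])
      fix z assume z: "z \<in> Z"
      then have "z \<in> X n" using Z by blast
      from Ident_Comp[OF \<iota>_Hom[OF this]] E\<iota>[OF z] show "Ident C (D n) \<cdot> \<iota> n z = ?E \<cdot> \<iota> n z" by simp
    qed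
    then show ?thesis unfolding E[OF f] Ident_Comp[OF f] .
  qed
  moreover have "\<eta> \<cdot> \<iota> n x \<in> Fin (Suc (Suc n))" if "x \<in> X n" for x
    unfolding \<eta>\<iota>[OF that] using h Fin_Null by simp
  ultimately have "contracts n Z \<eta>' \<eta> w \<rho>"
    unfolding contracts_def using \<eta> w(1) \<rho> \<eta>'(1) by blast
  then show ?thesis by blast
qed

text \<open>
  In degree 0 the elements \<open>\<delta> 0 \<cdot> \<iota> 0 z\<close> of \<open>\<Theta> B\<close> are assembled into the element \<open>m\<close> that the
  previous lemma needs. In degree \<open>Suc n\<close> the boundaries \<open>\<delta> (Suc n) \<cdot> \<iota> (Suc n) z\<close> of all \<open>z\<close> in
  \<open>Z\<close> are finite sums, hence supported together on at most \<open>l\<close> elements of \<open>X n\<close>, and a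
  contraction there writes them as boundaries plus multiples \<open>w \<cdot> \<rho>\<close> of one finite element.
  Assembling the endomorphisms \<open>\<rho> \<cdot> \<delta> (Suc n) \<cdot> \<iota> (Suc n) z\<close> into \<open>v\<close> gives \<open>m = w \<cdot> v\<close>.
\<close>

lemma local_contraction:
  assumes "Z \<subseteq> X n" "|Z| \<le>o l"
  shows "\<exists>\<eta>' \<eta> w \<rho>. contracts n Z \<eta>' \<eta> w \<rho>"
  using assms
proof (induction n arbitrary: Z)
  case (0 Z)
  obtain \<sigma> where \<sigma>: "\<And>z. z \<in> Z \<Longrightarrow> \<sigma> z \<in> Hom C Q Q"
    and ass: "\<And>M m. M \<in> Obj C \<Longrightarrow> (\<And>z. z \<in> Z \<Longrightarrow> m z \<in> Hom C Q M) \<Longrightarrow>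
      \<exists>m' \<in> Hom C Q M. (\<forall>z \<in> Z. m' \<cdot> \<sigma> z = m z) \<and>
        (\<forall>Y. \<forall>k \<in> Hom C M Y. (\<forall>z \<in> Z. k \<cdot> m z = Null C Q Y) \<longrightarrow> k \<cdot> m' = Null C Q Y)"
    by (rule power_assembly[OF Q_power l 0(2)]) blast
  have dH: "\<delta> 0 \<in> Hom C (D 0) B" using \<delta>_Hom[of 0] by simp
  have d\<iota>: "\<delta> 0 \<cdot> \<iota> 0 z \<in> Hom C Q B" if "z \<in> Z" for z
    using that 0(1) by (intro Comp_Hom[OF \<iota>_Hom dH]) blast
  obtain m where m: "m \<in> Hom C Q B" "\<And>z. z \<in> Z \<Longrightarrow> m \<cdot> \<sigma> z = \<delta> 0 \<cdot> \<iota> 0 z"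
    using ass[where m = "\<lambda>z. \<delta> 0 \<cdot> \<iota> 0 z", OF B d\<iota>] by blast
  have N: "Null C B (D 0) \<in> Hom C (A 0) (D 0)" by (simp add: Null_Hom B D_Obj)
  have "\<exists>\<eta> w \<rho>. contracts 0 Z (Null C B (D 0)) \<eta> w \<rho>"
  proof (rule local_contraction_step[OF 0(1) \<sigma> N])
    show "Null C B (D 0) \<cdot> f \<in> Fin (Suc 0)" if "f \<in> Fin 0" for f
      using that Null_Comp[of f Q B "D 0"] Fin_Null[of 0] D_Obj by (simp add: Fin_def)
    show "m \<in> Fin 0" using m(1) by (simp add: Fin_def)
    fix z assume z: "z \<in> Z"
    have "\<delta> 0 \<cdot> (Null C B (D 0) \<cdot> (\<delta> 0 \<cdot> \<iota> 0 z)) = Null C Q B"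
      using Null_Comp[OF d\<iota>[OF z] D_Obj] Comp_Null[OF dH Q_Obj] by simp
    then show "\<delta> 0 \<cdot> \<iota> 0 z = Add C (\<delta> 0 \<cdot> (Null C B (D 0) \<cdot> (\<delta> 0 \<cdot> \<iota> 0 z))) (m \<cdot> \<sigma> z)"
      using m(2)[OF z] Add_Null(2)[OF d\<iota>[OF z]] by simp
  qed simp_all
  then show ?case by blast
next
  case (Suc n Z)
  have lc: "Card_order l" and linf: "\<not> finite (Field l)" using l by (auto simp: cinfinite_def)
  let ?f = "\<lambda>z. \<delta> (Suc n) \<cdot> \<iota> (Suc n) z"
  have fFin: "?f z \<in> Fin (Suc n)" if "z \<in> Z" for z
    using that Suc.prems(1) by (intro \<delta>_Fin \<iota>_Fin) blast
  have fH: "?f z \<in> Hom C Q (D n)" if "z \<in> Z" for z using Fin_Hom[OF fFin[OF that]] by simp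
  have dH: "\<delta> n \<in> Hom C (D n) (A n)" "\<delta> (Suc n) \<in> Hom C (D (Suc n)) (D n)"
    using \<delta>_Hom[of n] \<delta>_Hom[of "Suc n"] by simp_all
  have df: "\<delta> n \<cdot> ?f z = Null C Q (A n)" if "z \<in> Z" for z
  proof -
    have \<iota>z: "\<iota> (Suc n) z \<in> Hom C Q (D (Suc n))" using that Suc.prems(1) by (intro \<iota>_Hom) blast
    show ?thesis using Comp_assoc[OF \<iota>z dH(2,1)] \<delta>_\<delta>[of n] Null_Comp[OF \<iota>z A_Obj] by simp
  qed
  have "\<forall>z\<in>Z. \<exists>W. W \<subseteq> X n \<and> finite W \<and> supported_on C (D n) (\<iota> n) W (?f z)"
    using Fin_finite_support fFin by blast
  then obtain W where W: "\<And>z. z \<in> Z \<Longrightarrow> W z \<subseteq> X n \<and> finite (W z) \<and> supported_on C (D n) (\<iota> n) (W z) (?f z)"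
    by metis
  let ?U = "\<Union>z\<in>Z. W z"
  have "|?U| \<le>o l"
    by (rule card_of_UNION_ordLeq_infinite_Field[OF linf lc Suc.prems(2)])
      (use W finite_ordLess_Cinfinite[OF _ l] ordLess_imp_ordLeq in blast)
  moreover have "?U \<subseteq> X n" using W by blast
  ultimately obtain \<eta>' \<eta> w \<rho> where \<eta>': "\<eta>' \<in> Hom C (A n) (D n)"
    and \<eta>: "\<eta> \<in> Hom C (D n) (D (Suc n))" "\<And>x. x \<in> X n \<Longrightarrow> \<eta> \<cdot> \<iota> n x \<in> Fin (Suc (Suc n))"
    and w: "w \<in> Fin (Suc n)" and \<rho>: "\<rho> \<in> Hom C (D n) Q"
    and contr: "\<And>R f. f \<in> Hom C R (D n) \<Longrightarrow> supported_on C (D n) (\<iota> n) ?U f \<Longrightarrow>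
      f = Add C (\<eta>' \<cdot> (\<delta> n \<cdot> f)) (Add C (\<delta> (Suc n) \<cdot> (\<eta> \<cdot> f)) (w \<cdot> (\<rho> \<cdot> f)))"
    using Suc.IH[of ?U] unfolding contracts_def by blast
  have wH: "w \<in> Hom C Q (D n)" using Fin_Hom[OF w] by simp
  have \<rho>f: "\<rho> \<cdot> ?f z \<in> Hom C Q Q" if "z \<in> Z" for z by (rule Comp_Hom[OF fH[OF that] \<rho>])
  have f_eq: "?f z = Add C (\<delta> (Suc n) \<cdot> (\<eta> \<cdot> ?f z)) (w \<cdot> (\<rho> \<cdot> ?f z))" if z: "z \<in> Z" for z
  proof -
    have "supported_on C (D n) (\<iota> n) ?U (?f z)" using W[OF z] z unfolding supported_on_def by blast
    note eq = contr[OF fH[OF z] this]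
    have "\<eta>' \<cdot> (\<delta> n \<cdot> ?f z) = Null C Q (D n)" using df[OF z] Comp_Null[OF \<eta>' Q_Obj] by simp
    moreover have "Add C (\<delta> (Suc n) \<cdot> (\<eta> \<cdot> ?f z)) (w \<cdot> (\<rho> \<cdot> ?f z)) \<in> Hom C Q (D n)"
      by (intro Add_Hom Comp_Hom[OF Comp_Hom[OF fH[OF z] \<eta>(1)] dH(2)] Comp_Hom[OF \<rho>f[OF z] wH])
    ultimately show ?thesis using eq Add_Null(2) by metis
  qed
  obtain \<sigma> where \<sigma>: "\<And>z. z \<in> Z \<Longrightarrow> \<sigma> z \<in> Hom C Q Q"
    and ass: "\<And>M m. M \<in> Obj C \<Longrightarrow> (\<And>z. z \<in> Z \<Longrightarrow> m z \<in> Hom C Q M) \<Longrightarrow>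
      \<exists>m' \<in> Hom C Q M. (\<forall>z \<in> Z. m' \<cdot> \<sigma> z = m z) \<and>
        (\<forall>Y. \<forall>k \<in> Hom C M Y. (\<forall>z \<in> Z. k \<cdot> m z = Null C Q Y) \<longrightarrow> k \<cdot> m' = Null C Q Y)"
    by (rule power_assembly[OF Q_power l Suc.prems(2)]) blast
  obtain v where v: "v \<in> Hom C Q Q" and v\<sigma>: "\<And>z. z \<in> Z \<Longrightarrow> v \<cdot> \<sigma> z = \<rho> \<cdot> ?f z"
    and v0: "\<And>Y k. k \<in> Hom C Q Y \<Longrightarrow> (\<And>z. z \<in> Z \<Longrightarrow> k \<cdot> (\<rho> \<cdot> ?f z) = Null C Q Y) \<Longrightarrow> k \<cdot> v = Null C Q Y"
    using ass[where m = "\<lambda>z. \<rho> \<cdot> ?f z", OF Q_Obj \<rho>f] by blast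
  have \<eta>A: "\<eta> \<in> Hom C (A (Suc n)) (D (Suc n))" using \<eta>(1) by simp
  have "\<exists>\<eta>2 w2 \<rho>2. contracts (Suc n) Z \<eta> \<eta>2 w2 \<rho>2"
  proof (rule local_contraction_step[OF Suc.prems(1) \<sigma> \<eta>A])
    show "\<eta> \<cdot> f \<in> Fin (Suc (Suc n))" if "f \<in> Fin (Suc n)" for f
      by (rule Fin_map[of \<eta> n "Suc (Suc n)", OF _ _ that]) (use \<eta> in simp_all)
    show "w \<cdot> v \<in> Fin (Suc n)" using w v by (rule Fin_Comp)
    show "\<delta> k \<cdot> (w \<cdot> v) = Null C Q (A k)" if "Suc n = Suc k" for k
    proof -
      have k: "k = n" using that by simp
      have dw: "\<delta> n \<cdot> w \<in> Hom C Q (A n)" by (rule Comp_Hom[OF wH dH(1)])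
      have "(\<delta> n \<cdot> w) \<cdot> v = Null C Q (A n)"
      proof (rule v0[OF dw])
        fix z assume z: "z \<in> Z"
        have c: "w \<cdot> (\<rho> \<cdot> ?f z) \<in> Hom C Q (D n)" "\<eta> \<cdot> ?f z \<in> Hom C Q (D (Suc n))"
          by (rule Comp_Hom[OF \<rho>f[OF z] wH] Comp_Hom[OF fH[OF z] \<eta>(1)])+
        have c2: "\<delta> (Suc n) \<cdot> (\<eta> \<cdot> ?f z) \<in> Hom C Q (D n)" by (rule Comp_Hom[OF c(2) dH(2)])
        have "\<delta> n \<cdot> (\<delta> (Suc n) \<cdot> (\<eta> \<cdot> ?f z)) = Null C Q (A n)"
          using Comp_assoc[OF c(2) dH(2,1)] \<delta>_\<delta>[of n] Null_Comp[OF c(2) A_Obj] by simp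
        then have "\<delta> n \<cdot> ?f z = \<delta> n \<cdot> (w \<cdot> (\<rho> \<cdot> ?f z))"
          using arg_cong[OF f_eq[OF z], of "\<lambda>x. \<delta> n \<cdot> x"] Comp_Add[OF c2 c(1) dH(1)]
            Add_Null(2)[OF Comp_Hom[OF c(1) dH(1)]] by simp
        then show "(\<delta> n \<cdot> w) \<cdot> (\<rho> \<cdot> ?f z) = Null C Q (A n)"
          using Comp_assoc[OF \<rho>f[OF z] wH dH(1)] df[OF z] by simp
      qed
      then show ?thesis using Comp_assoc[OF v wH dH(1)] k by simp
    qed
    fix z assume z: "z \<in> Z"
    have "(w \<cdot> v) \<cdot> \<sigma> z = w \<cdot> (\<rho> \<cdot> ?f z)" using Comp_assoc[OF \<sigma>[OF z] v wH] v\<sigma>[OF z] by simp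
    then show "?f z = Add C (\<delta> (Suc n) \<cdot> (\<eta> \<cdot> ?f z)) ((w \<cdot> v) \<cdot> \<sigma> z)" using f_eq[OF z] by (metis (no_types))
  qed
  then show ?case by blast
qed

lemma \<delta>_surjective_P:
  assumes f: "f \<in> Hom C P B"
  shows "\<exists>g \<in> Hom C P (D 0). \<delta> 0 \<cdot> g = f"
proof -
  obtain j p where j: "j \<in> Hom C P Q" and p: "p \<in> Hom C Q P" and pj: "p \<cdot> j = Ident C P" using P_retract by blast
  have "f \<cdot> p \<in> Fin 0" using Comp_Hom[OF p f] by (simp add: Fin_def)
  then obtain g where g: "g \<in> Fin (Suc 0)" "\<delta> 0 \<cdot> g = f \<cdot> p" using Fin_lift[of _ 0] by blast
  have gH: "g \<in> Hom C Q (D 0)" using Fin_Hom[OF g(1)] by simp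
  have dH: "\<delta> 0 \<in> Hom C (D 0) B" using \<delta>_Hom[of 0] by simp
  have "\<delta> 0 \<cdot> (g \<cdot> j) = f"
    using Comp_assoc[OF j gH dH] g(2) Comp_assoc[OF j p f] pj Comp_Ident[OF f] by simp
  then show ?thesis using Comp_Hom[OF j gH] by blast
qed

text \<open>
  In \<open>f = \<eta>' \<cdot> \<delta> n \<cdot> f + \<delta> (Suc n) \<cdot> \<eta> \<cdot> f + w \<cdot> \<rho> \<cdot> f\<close> the first summand is zero and the second
  is a boundary. The third is a cycle; composed with the retraction of \<open>Q\<close> onto \<open>P\<close> it becomes a
  finite one, which is a boundary.
\<close>

lemma \<delta>_exact_P:
  assumes f: "f \<in> Hom C P (D n)" and f0: "\<delta> n \<cdot> f = Null C P (A n)"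
  shows "\<exists>g \<in> Hom C P (D (Suc n)). \<delta> (Suc n) \<cdot> g = f"
proof -
  obtain j p where j: "j \<in> Hom C P Q" and p: "p \<in> Hom C Q P" and pj: "p \<cdot> j = Ident C P" using P_retract by blast
  obtain Z where Z: "Z \<subseteq> X n" "|Z| \<le>o l" and supp: "supported_on C (D n) (\<iota> n) Z f"
    by (rule presentable_supported_on[OF cocomplete u l P_presentable D X_small f]) blast
  obtain \<eta>' \<eta> w \<rho> where \<eta>': "\<eta>' \<in> Hom C (A n) (D n)" and \<eta>: "\<eta> \<in> Hom C (D n) (D (Suc n))"
    and w: "w \<in> Fin (Suc n)" and \<rho>: "\<rho> \<in> Hom C (D n) Q"
    and contr: "\<And>R f. f \<in> Hom C R (D n) \<Longrightarrow> supported_on C (D n) (\<iota> n) Z f \<Longrightarrow>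
      f = Add C (\<eta>' \<cdot> (\<delta> n \<cdot> f)) (Add C (\<delta> (Suc n) \<cdot> (\<eta> \<cdot> f)) (w \<cdot> (\<rho> \<cdot> f)))"
    using local_contraction[OF Z] unfolding contracts_def by blast
  have wH: "w \<in> Hom C Q (D n)" using Fin_Hom[OF w] by simp
  have dH: "\<delta> n \<in> Hom C (D n) (A n)" "\<delta> (Suc n) \<in> Hom C (D (Suc n)) (D n)"
    using \<delta>_Hom[of n] \<delta>_Hom[of "Suc n"] by simp_all
  have \<eta>f: "\<eta> \<cdot> f \<in> Hom C P (D (Suc n))" by (rule Comp_Hom[OF f \<eta>])
  have \<rho>f: "\<rho> \<cdot> f \<in> Hom C P Q" by (rule Comp_Hom[OF f \<rho>])
  have \<rho>fp: "(\<rho> \<cdot> f) \<cdot> p \<in> Hom C Q Q" by (rule Comp_Hom[OF p \<rho>f])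
  let ?g = "w \<cdot> (\<rho> \<cdot> f)" and ?b = "\<delta> (Suc n) \<cdot> (\<eta> \<cdot> f)"
  have gH: "?g \<in> Hom C P (D n)" by (rule Comp_Hom[OF \<rho>f wH])
  have bH: "?b \<in> Hom C P (D n)" by (rule Comp_Hom[OF \<eta>f dH(2)])
  have f_eq: "f = Add C ?b ?g"
  proof -
    have "\<eta>' \<cdot> (\<delta> n \<cdot> f) = Null C P (D n)" using f0 Comp_Null[OF \<eta>' P_Obj] by simp
    then show ?thesis using contr[OF f supp] Add_Null(2)[OF Add_Hom[OF bH gH]] by metis
  qed
  have "\<delta> n \<cdot> ?b = Null C P (A n)"
    using Comp_assoc[OF \<eta>f dH(2,1)] \<delta>_\<delta>[of n] Null_Comp[OF \<eta>f A_Obj] by simp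
  then have g0: "\<delta> n \<cdot> ?g = Null C P (A n)"
    using arg_cong[OF f_eq, of "\<lambda>x. \<delta> n \<cdot> x"] Comp_Add[OF bH gH dH(1)] Add_Null(2)[OF Comp_Hom[OF gH dH(1)]] f0
    by simp
  have gp: "w \<cdot> ((\<rho> \<cdot> f) \<cdot> p) = ?g \<cdot> p" by (rule Comp_assoc[OF p \<rho>f wH, symmetric])
  have "\<exists>k \<in> Fin (Suc (Suc n)). \<delta> (Suc n) \<cdot> k = w \<cdot> ((\<rho> \<cdot> f) \<cdot> p)"
  proof (rule Fin_lift[OF Fin_Comp[OF w \<rho>fp]])
    fix m assume "Suc n = Suc m"
    then have m: "m = n" by simp
    show "\<delta> m \<cdot> (w \<cdot> ((\<rho> \<cdot> f) \<cdot> p)) = Null C Q (A m)"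
      unfolding m gp using Comp_assoc[OF p gH dH(1)] g0 Null_Comp[OF p A_Obj] by simp
  qed
  then obtain k where k: "k \<in> Fin (Suc (Suc n))" "\<delta> (Suc n) \<cdot> k = ?g \<cdot> p" unfolding gp by blast
  have kH: "k \<in> Hom C Q (D (Suc n))" using Fin_Hom[OF k(1)] by simp
  have kj: "k \<cdot> j \<in> Hom C P (D (Suc n))" by (rule Comp_Hom[OF j kH])
  have "\<delta> (Suc n) \<cdot> (k \<cdot> j) = ?g"
    using Comp_assoc[OF j kH dH(2)] k(2) Comp_assoc[OF j p gH] pj Comp_Ident[OF gH] by simp
  then have "\<delta> (Suc n) \<cdot> Add C (\<eta> \<cdot> f) (k \<cdot> j) = f"
    using Comp_Add[OF \<eta>f kj dH(2)] f_eq by simp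
  then show ?thesis using Add_Hom[OF \<eta>f kj] by blast
qed

end

section \<open>Small free resolutions\<close>

lemma finite_families_small:
  fixes R :: "('s, 'y) ring_scheme" and X :: "'x set"
  assumes u: "smallness_cardinal u l" and l: "Cinfinite l"
    and X: "|X| <o u" and R: "|carrier R| <o u"
  shows "|carrier (free_lmod R X)| <o u"
proof -
  have cu: "Cinfinite u" and lc: "Card_order l" using u l by (simp_all add: smallness_cardinal_def)
  have inf: "\<not> finite (Field u)" and uc: "Card_order u" using cu by (auto simp: cinfinite_def)
  define T where "T = X <+> carrier R"
  define K where "K = {Z. Z \<subseteq> T \<times> T \<and> |Z| \<le>o l}"
  \<comment> \<open>A family is coded by the graph of its restriction to the support, a finite subset
    of a small set.\<close>
  define graph :: "('x \<Rightarrow> 's) \<Rightarrow> (('x + 's) \<times> ('x + 's)) set"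
    where "graph c = (\<lambda>x. (Inl x, Inr (c x))) ` {x. c x \<noteq> \<zero>\<^bsub>R\<^esub>}" for c
  have "|T| <o u" unfolding T_def by (rule card_of_Plus_ordLess_infinite_Field[OF inf uc X R])
  then have K: "|K| <o u" unfolding K_def by (intro small_subsets[OF u lc] ordLess_square cu)
  have "graph c \<in> K" if "c \<in> carrier (free_lmod R X)" for c
  proof -
    from that[unfolded free_lmod_carrier]
    have fin: "finite {x. c x \<noteq> \<zero>\<^bsub>R\<^esub>}" and cl: "\<And>x. c x \<in> carrier R"
      and supp: "\<And>x. x \<notin> X \<Longrightarrow> c x = \<zero>\<^bsub>R\<^esub>" by simp_all
    have "finite (graph c)" unfolding graph_def using fin by (rule finite_imageI)
    then have "|graph c| \<le>o l" by (rule ordLess_imp_ordLeq[OF finite_ordLess_Cinfinite[OF _ l]])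
    moreover have "graph c \<subseteq> T \<times> T"
    proof
      fix p assume "p \<in> graph c"
      then obtain x where x: "c x \<noteq> \<zero>\<^bsub>R\<^esub>" "p = (Inl x, Inr (c x))" unfolding graph_def by blast
      then have "x \<in> X" using supp[of x] by argo
      then show "p \<in> T \<times> T" unfolding x(2) T_def using cl[of x] by (simp add: Plus_def)
    qed
    ultimately show ?thesis by (simp add: K_def)
  qed
  then have img: "graph ` carrier (free_lmod R X) \<subseteq> K" by (rule image_subsetI)
  have inj: "inj_on graph (carrier (free_lmod R X))"
  proof (rule inj_onI, rule ext)
    fix c c' :: "'x \<Rightarrow> 's" and x assume eq: "graph c = graph c'"
    have g: "(Inl x, Inr y) \<in> graph c \<longleftrightarrow> y = c x \<and> c x \<noteq> \<zero>\<^bsub>R\<^esub>" for c y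
      by (auto simp: graph_def)
    have "(y = c x \<and> c x \<noteq> \<zero>\<^bsub>R\<^esub>) = (y = c' x \<and> c' x \<noteq> \<zero>\<^bsub>R\<^esub>)" for y
      unfolding g[symmetric] eq by (rule refl)
    from this[of "c x"] this[of "c' x"] show "c x = c' x"
      by (cases "c x = \<zero>\<^bsub>R\<^esub>"; cases "c' x = \<zero>\<^bsub>R\<^esub>") simp_all
  qed
  have "|carrier (free_lmod R X)| \<le>o |K|"
    by (rule iffD1[OF card_of_ordLeq, OF exI[of _ graph], OF conjI[OF inj img]])
  then show ?thesis using K by (rule ordLeq_ordLess_trans)
qed

text \<open>
  The kernel itself serves as the basis, coded in the type of \<open>u\<close>. The code is needed to keep the
  type of the bases fixed along a resolution.
\<close>

lemma kernel_free_cover: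
  fixes u :: "'u rel"
  assumes N: "lmod R N" and L: "lmod R L" and f: "f \<in> lmod_hom R N L"
    and u: "Card_order u" and small: "|carrier N| <o u"
  obtains X :: "'u set" and g where "|X| <o u" "g \<in> lmod_hom R (free_lmod R X) N"
    "g ` carrier (free_lmod R X) = {c \<in> carrier N. f c = \<zero>\<^bsub>L\<^esub>}"
proof -
  interpret L: lmod R L by fact
  let ?K = "{c \<in> carrier N. f c = \<zero>\<^bsub>L\<^esub>}"
  have R: "ring R" using N by (rule lmod.axioms)
  have F: "lmod R (free_lmod R X)" for X :: "'u set" by (rule free_lmod_lmod[OF R])
  have "|?K| <o u" by (rule ordLeq_ordLess_trans[OF card_of_mono1 small]) blast
  then obtain enc where enc: "inj_on enc ?K" "enc ` ?K \<subseteq> Field u" using u by (rule ordLess_embedding)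
  let ?X = "enc ` ?K"
  have X: "|?X| <o u" by (rule ordLeq_ordLess_trans[OF card_of_image]) fact
  have dec: "inv_into ?K enc x \<in> ?K" if "x \<in> ?X" for x using that by (rule inv_into_into)
  have decN: "inv_into ?K enc x \<in> carrier N" if "x \<in> ?X" for x using dec[OF that] by blast
  obtain g where g: "g \<in> lmod_hom R (free_lmod R ?X) N"
    and gu: "\<And>x. x \<in> ?X \<Longrightarrow> g (unit_vec R x) = inv_into ?K enc x"
    by (rule free_lmod_hom_exists[OF N, of ?X "inv_into ?K enc", OF decN]) blast+
  have zero: "lmod_zero (free_lmod R ?X) L \<in> lmod_hom R (free_lmod R ?X) L"
    using monoid.one_closed[OF comm_monoid.axioms(1)[OF comm_group.axioms(1)[OF lmod_hom_group_comm[OF F L]]]]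
    by (simp add: lmod_hom_group_def)
  have cmp: "compose (carrier (free_lmod R ?X)) f g = lmod_zero (free_lmod R ?X) L"
    proof (rule free_lmod_hom_ext[OF L lmod_hom_compose[OF F g f] zero])
    fix x assume x: "x \<in> ?X"
    then show "compose (carrier (free_lmod R ?X)) f g (unit_vec R x) = lmod_zero (free_lmod R ?X) L (unit_vec R x)"
      using unit_vec_closed[OF R x] gu[OF x] dec[OF x] by (simp add: compose_eq lmod_zero_def)
  qed
  have fg: "f (g c) = \<zero>\<^bsub>L\<^esub>" if "c \<in> carrier (free_lmod R ?X)" for c
    using fun_cong[OF cmp, of c] that by (simp add: compose_eq lmod_zero_def)
  have "g ` carrier (free_lmod R ?X) = ?K"
  proof
    show "g ` carrier (free_lmod R ?X) \<subseteq> ?K" using fg lmod_hom_closed[OF g] by blast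
    show "?K \<subseteq> g ` carrier (free_lmod R ?X)"
    proof
      fix k assume k: "k \<in> ?K"
      then have x: "enc k \<in> ?X" by blast
      have "g (unit_vec R (enc k)) = k" unfolding gu[OF x] by (rule inv_into_f_f[OF enc(1) k])
      then show "k \<in> g ` carrier (free_lmod R ?X)" by (rule image_eqI[OF sym unit_vec_closed[OF R x]])
    qed
  qed
  then show ?thesis using that X g by blast
qed

lemma (in power_generator) small_free_resolution_exists:
  assumes B: "B \<in> Obj C"
  obtains X :: "nat \<Rightarrow> 'u set" and e d
  where "free_res (End_op C Q) (Theta C Q B) X e d" "\<And>n. |X n| <o u"
proof -
  let ?S = "End_op C Q"
  have S: "ring ?S" by (rule End_op_ring[OF Q_Obj])
  have Ssmall: "|carrier ?S| <o u" using Hom_small[OF Q_Obj Q_Obj] by (simp add: End_op_simps)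
  have F: "lmod ?S (free_lmod ?S X)" for X :: "'u set" by (rule free_lmod_lmod[OF S])
  have T: "lmod ?S (Theta C Q B)" by (rule Theta_lmod[OF Q_Obj B])
  have zero: "lmod_zero (Theta C Q B) (Theta C Q B) \<in> lmod_hom ?S (Theta C Q B) (Theta C Q B)"
    using monoid.one_closed[OF comm_monoid.axioms(1)[OF comm_group.axioms(1)[OF lmod_hom_group_comm[OF T T]]]]
    by (simp add: lmod_hom_group_def)
  have Tsmall: "|carrier (Theta C Q B)| <o u" using Hom_small[OF Q_Obj B] by (simp add: Theta_simps)
  obtain X0 :: "'u set" and e where X0: "|X0| <o u"
    and e: "e \<in> lmod_hom ?S (free_lmod ?S X0) (Theta C Q B)"
    and e_img: "e ` carrier (free_lmod ?S X0) = {c \<in> carrier (Theta C Q B).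
      lmod_zero (Theta C Q B) (Theta C Q B) c = \<zero>\<^bsub>Theta C Q B\<^esub>}"
    by (rule kernel_free_cover[OF T T zero u'(2) Tsmall]) blast
  have step: "\<exists>(X1 :: 'u set) g. |X1| <o u \<and> g \<in> lmod_hom ?S (free_lmod ?S X1) (free_lmod ?S X) \<and>
      g ` carrier (free_lmod ?S X1) = {c \<in> carrier (free_lmod ?S X). f c = \<zero>\<^bsub>L\<^esub>}"
    if "|X| <o u" "lmod ?S L" "f \<in> lmod_hom ?S (free_lmod ?S X) L"
    for X :: "'u set" and L :: "('a, 'b, 'c) module_scheme" and f
    by (rule kernel_free_cover[OF F that(2,3) u'(2) finite_families_small[OF u l that(1) Ssmall]]) blast
  \<comment> \<open>A state consists of two consecutive bases and the differential between them.\<close>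
  define P where "P n s \<longleftrightarrow> (case s of (X, X', g) \<Rightarrow> |X| <o u \<and> |X'| <o u \<and>
    g \<in> lmod_hom ?S (free_lmod ?S X') (free_lmod ?S X) \<and>
    (n = 0 \<longrightarrow> X = X0 \<and> g ` carrier (free_lmod ?S X') =
      {c \<in> carrier (free_lmod ?S X0). e c = \<zero>\<^bsub>Theta C Q B\<^esub>}))"
    for n :: nat and s :: "'u set \<times> 'u set \<times> (('u \<Rightarrow> 'a) \<Rightarrow> ('u \<Rightarrow> 'a))"
  define R where "R s s' \<longleftrightarrow> (case s of (X, X', g) \<Rightarrow> case s' of (X1, X1', g1) \<Rightarrow> X1 = X' \<and>
    g1 ` carrier (free_lmod ?S X1') = {c \<in> carrier (free_lmod ?S X'). g c = \<zero>\<^bsub>free_lmod ?S X\<^esub>})"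
    for s s' :: "'u set \<times> 'u set \<times> (('u \<Rightarrow> 'a) \<Rightarrow> ('u \<Rightarrow> 'a))"
  have "\<exists>s. \<forall>n. P n (s n) \<and> R (s n) (s (Suc n))"
  proof (rule dependent_nat_choice)
    obtain X1 :: "'u set" and g where "|X1| <o u" "g \<in> lmod_hom ?S (free_lmod ?S X1) (free_lmod ?S X0)"
      "g ` carrier (free_lmod ?S X1) = {c \<in> carrier (free_lmod ?S X0). e c = \<zero>\<^bsub>Theta C Q B\<^esub>}"
      using step[OF X0 T e] by blast
    then have "P 0 (X0, X1, g)" using X0 by (simp add: P_def)
    then show "\<exists>s. P 0 s" by (rule exI)
  next
    fix s n assume "P n s"
    obtain X X' g where s: "s = (X, X', g)" by (cases s)
    have "|X'| <o u" "g \<in> lmod_hom ?S (free_lmod ?S X') (free_lmod ?S X)"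
      using \<open>P n s\<close> by (simp_all add: P_def s)
    then obtain X1 :: "'u set" and g1 where "|X1| <o u" "g1 \<in> lmod_hom ?S (free_lmod ?S X1) (free_lmod ?S X')"
      "g1 ` carrier (free_lmod ?S X1) = {c \<in> carrier (free_lmod ?S X'). g c = \<zero>\<^bsub>free_lmod ?S X\<^esub>}"
      using step[OF _ F] by blast
    then have "P (Suc n) (X', X1, g1)" "R s (X', X1, g1)" using \<open>|X'| <o u\<close> by (simp_all add: P_def R_def s)
    then show "\<exists>s'. P (Suc n) s' \<and> R s s'" by blast
  qed
  then obtain s where s: "\<And>n. P n (s n)" "\<And>n. R (s n) (s (Suc n))" by blast
  define X where "X n = fst (s n)" for n
  define d where "d n = snd (snd (s n))" for n
  have sn: "s n = (X n, X (Suc n), d n)" for n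
  proof -
    obtain X1 X' g where 1: "s n = (X1, X', g)" by (cases "s n")
    obtain X2 X2' g2 where 2: "s (Suc n) = (X2, X2', g2)" by (cases "s (Suc n)")
    show ?thesis using s(2)[of n] by (simp add: X_def d_def R_def 1 2)
  qed
  have X0': "X 0 = X0" using s(1)[of 0] by (simp add: P_def sn)
  have "free_resolution ?S (Theta C Q B) X e d"
    unfolding free_resolution_def
  proof (intro conjI allI)
    show "e \<in> lmod_hom ?S (free_lmod ?S (X 0)) (Theta C Q B)" using e X0' by simp
    show "d n \<in> lmod_hom ?S (free_lmod ?S (X (Suc n))) (free_lmod ?S (X n))" for n
      using s(1)[of n] by (simp add: P_def sn)
    show "e ` carrier (free_lmod ?S (X 0)) = carrier (Theta C Q B)"
      using e_img X0' by (simp add: lmod_zero_def)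
    show "d 0 ` carrier (free_lmod ?S (X 1)) = {c \<in> carrier (free_lmod ?S (X 0)). e c = \<zero>\<^bsub>Theta C Q B\<^esub>}"
      using s(1)[of 0] X0' by (simp add: P_def sn)
    show "d (Suc n) ` carrier (free_lmod ?S (X (Suc (Suc n)))) =
        {c \<in> carrier (free_lmod ?S (X (Suc n))). d n c = \<zero>\<^bsub>free_lmod ?S (X n)\<^esub>}" for n
      using s(2)[of n] by (simp add: R_def sn)
  qed
  then have "free_res ?S (Theta C Q B) X e d" using T by (intro free_res.intro)
  moreover have "|X n| <o u" for n using s(1)[of n] by (simp add: P_def sn)
  ultimately show ?thesis by (rule that)
qed

section \<open>Projective resolutions\<close>

text \<open>
  Exactness of a complex of projective objects, expressed by lifting along arrows from projective
  objects. This is what the comparison of resolutions uses, and it can be checked without kernels.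
\<close>

locale lifting_resolution = abelian_category C
  for C :: "('o, 'a, 'z) ab_category_scheme" (structure) +
  fixes B :: 'o and E :: "nat \<Rightarrow> 'o" and e :: 'a and d :: "nat \<Rightarrow> 'a"
  assumes E_projective: "projective C (E n)"
    and e: "e \<in> Hom C (E 0) B" and d: "d n \<in> Hom C (E (Suc n)) (E n)"
    and e_d: "e \<cdot> d 0 = Null C (E (Suc 0)) B"
    and d_d: "d n \<cdot> d (Suc n) = Null C (E (Suc (Suc n))) (E n)"
    and e_lift: "projective C R \<Longrightarrow> f \<in> Hom C R B \<Longrightarrow> \<exists>g \<in> Hom C R (E 0). e \<cdot> g = f"
    and d0_lift: "projective C R \<Longrightarrow> f \<in> Hom C R (E 0) \<Longrightarrow> e \<cdot> f = Null C R B
      \<Longrightarrow> \<exists>g \<in> Hom C R (E (Suc 0)). d 0 \<cdot> g = f"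
    and d_lift: "projective C R \<Longrightarrow> f \<in> Hom C R (E (Suc n)) \<Longrightarrow> d n \<cdot> f = Null C R (E n)
      \<Longrightarrow> \<exists>g \<in> Hom C R (E (Suc (Suc n))). d (Suc n) \<cdot> g = f"
begin

lemma E_Obj: "E n \<in> Obj C" using E_projective by (simp add: projective_def)

end

context abelian_category
begin

lemma lift_difference:
  assumes b: "b \<in> Hom C M N" and f: "f \<in> Hom C R M" and g: "g \<in> Hom C R M" and eq: "b \<cdot> f = b \<cdot> g"
    and lift: "\<And>f. f \<in> Hom C R M \<Longrightarrow> b \<cdot> f = Null C R N \<Longrightarrow> \<exists>h \<in> Hom C R L. a \<cdot> h = f"
  shows "\<exists>h \<in> Hom C R L. f = Add C g (a \<cdot> h)"
proof -
  obtain k where k: "k \<in> Hom C R M" "Add C g k = Null C R M" "Add C k g = Null C R M"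
    using g by (rule Neg_exists)
  have R: "R \<in> Obj C" using f by (rule Hom_Obj)
  have "b \<cdot> Add C k f = b \<cdot> Add C k g" using Comp_Add[OF k(1) f b] Comp_Add[OF k(1) g b] eq by simp
  then have "b \<cdot> Add C k f = Null C R N" using k(3) Comp_Null[OF b R] by simp
  then obtain h where h: "h \<in> Hom C R L" "a \<cdot> h = Add C k f" using lift[OF Add_Hom[OF k(1) f]] by blast
  have "Add C g (a \<cdot> h) = f" unfolding h(2) Add_assoc[OF g k(1) f, symmetric] k(2) by (rule Add_Null(2)[OF f])
  then show ?thesis using h(1) by blast
qed

lemma exact_pair_Comp:
  assumes "exact_pair C f g" "f \<in> Hom C L M" "g \<in> Hom C M N"
  shows "g \<cdot> f = Null C L N"
proof -
  obtain k \<epsilon> where k: "is_kernel C k g" and \<epsilon>: "epi_arr C \<epsilon>" "Cod C \<epsilon> = Dom C k" "f = k \<cdot> \<epsilon>"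
    using assms(1) unfolding exact_pair_def by blast
  have k': "k \<in> Arr C" "Cod C k = Dom C g" "g \<cdot> k = Null C (Dom C k) (Cod C g)" using k unfolding is_kernel_def by blast+
  have \<epsilon>A: "\<epsilon> \<in> Arr C" using \<epsilon>(1) by (simp add: epi_arr_def)
  have kH: "k \<in> Hom C (Dom C k) M" using k'(1,2) assms(3) by (simp add: Hom_def)
  have "Dom C \<epsilon> = L" using assms(2) \<epsilon>(2) \<epsilon>A k'(1) unfolding \<epsilon>(3) by (simp add: Hom_def arrow_simps(2))
  then have \<epsilon>H: "\<epsilon> \<in> Hom C L (Dom C k)" using \<epsilon>A \<epsilon>(2) by (simp add: Hom_def)
  have gk: "g \<cdot> k = Null C (Dom C k) N" using k'(3) assms(3) by (simp add: Hom_def)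
  have "g \<cdot> f = (g \<cdot> k) \<cdot> \<epsilon>" unfolding \<epsilon>(3) by (rule Comp_assoc[OF \<epsilon>H kH assms(3), symmetric])
  then show ?thesis unfolding gk using Null_Comp[OF \<epsilon>H Hom_Obj(2)[OF assms(3)]] by simp
qed

lemma exact_pair_lift:
  assumes "exact_pair C f g" "f \<in> Hom C L M" "g \<in> Hom C M N"
    and R: "projective C R" and h: "h \<in> Hom C R M" "g \<cdot> h = Null C R N"
  shows "\<exists>h' \<in> Hom C R L. f \<cdot> h' = h"
proof -
  obtain k \<epsilon> where k: "is_kernel C k g" and \<epsilon>: "epi_arr C \<epsilon>" "Cod C \<epsilon> = Dom C k" "f = k \<cdot> \<epsilon>"
    using assms(1) unfolding exact_pair_def by blast
  have \<epsilon>A: "\<epsilon> \<in> Arr C" using \<epsilon>(1) by (simp add: epi_arr_def)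
  have kA: "k \<in> Arr C" "Cod C k = Dom C g" using k unfolding is_kernel_def by blast+
  have gd: "Dom C g = M" "Cod C g = N" using assms(3) by (simp_all add: Hom_def)
  have RO: "R \<in> Obj C" using R by (simp add: projective_def)
  have "\<exists>!x. x \<in> Hom C R (Dom C k) \<and> k \<cdot> x = h"
    using k RO h gd unfolding is_kernel_def by blast
  then obtain x where x: "x \<in> Hom C R (Cod C \<epsilon>)" "k \<cdot> x = h" using \<epsilon>(2) by auto
  obtain y where y: "y \<in> Hom C R (Dom C \<epsilon>)" "\<epsilon> \<cdot> y = x"
    using R \<epsilon>(1) x(1) unfolding projective_def by blast
  have "Dom C \<epsilon> = L" using \<epsilon> \<epsilon>A kA assms(2) by (auto simp: Hom_def arrow_simps)
  moreover have "f \<cdot> y = h" using y x \<epsilon> \<epsilon>A kA by (auto simp: Hom_def arrow_simps)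
  ultimately show ?thesis using y(1) by blast
qed

lemma projective_resolution_lifting:
  assumes "projective_resolution C B E e d"
  shows "lifting_resolution C B E e d"
proof -
  have E: "\<And>n. projective C (E n)" and e: "e \<in> Hom C (E 0) B" "epi_arr C e"
    and d: "\<And>n. d n \<in> Hom C (E (Suc n)) (E n)" and x0: "exact_pair C (d 0) e"
    and x: "\<And>n. exact_pair C (d (Suc n)) (d n)" using assms unfolding projective_resolution_def by blast+
  show ?thesis
  proof
    show "projective C (E n)" "e \<in> Hom C (E 0) B" "d n \<in> Hom C (E (Suc n)) (E n)" for n by (rule E, rule e(1), rule d)
    show "e \<cdot> d 0 = Null C (E (Suc 0)) B" by (rule exact_pair_Comp[OF x0 d e(1)])
    show "d n \<cdot> d (Suc n) = Null C (E (Suc (Suc n))) (E n)" for n by (rule exact_pair_Comp[OF x d d])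
    show "\<exists>g \<in> Hom C R (E 0). e \<cdot> g = f" if "projective C R" "f \<in> Hom C R B" for R f
    proof -
      have "\<forall>f \<in> Hom C R (Cod C e). \<exists>g \<in> Hom C R (Dom C e). e \<cdot> g = f"
        using that(1) e(2) unfolding projective_def by blast
      moreover have "Cod C e = B" "Dom C e = E 0" using e(1) by (simp_all add: Hom_def)
      ultimately show ?thesis using that(2) by simp
    qed
    show "\<exists>g \<in> Hom C R (E (Suc 0)). d 0 \<cdot> g = f"
      if "projective C R" "f \<in> Hom C R (E 0)" "e \<cdot> f = Null C R B" for R f
      by (rule exact_pair_lift[OF x0 d e(1) that])
    show "\<exists>g \<in> Hom C R (E (Suc (Suc n))). d (Suc n) \<cdot> g = f"
      if "projective C R" "f \<in> Hom C R (E (Suc n))" "d n \<cdot> f = Null C R (E n)" for R f n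
      by (rule exact_pair_lift[OF x d d that])
  qed
qed

end

lemma lifting_comparison_exists:
  assumes "lifting_resolution C B E e d" "lifting_resolution C B E' e' d'"
  obtains \<alpha> where "\<And>n. \<alpha> n \<in> Hom C (E n) (E' n)" "e' \<cdot>\<^bsub>C\<^esub> \<alpha> 0 = e"
    "\<And>n. d' n \<cdot>\<^bsub>C\<^esub> \<alpha> (Suc n) = \<alpha> n \<cdot>\<^bsub>C\<^esub> d n"
proof -
  interpret L: lifting_resolution C B E e d by fact
  interpret L': lifting_resolution C B E' e' d' by fact
  \<comment> \<open>The last clause says that \<open>\<alpha> \<cdot> d n\<close> is a cycle, so that the recursion can
    continue.\<close>
  define P where "P n \<alpha> \<longleftrightarrow> \<alpha> \<in> Hom C (E n) (E' n) \<and> (n = 0 \<longrightarrow> e' \<cdot>\<^bsub>C\<^esub> \<alpha> = e) \<and>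
    (case n of 0 \<Rightarrow> e' \<cdot>\<^bsub>C\<^esub> (\<alpha> \<cdot>\<^bsub>C\<^esub> d 0) = Null C (E (Suc 0)) B
      | Suc m \<Rightarrow> d' m \<cdot>\<^bsub>C\<^esub> (\<alpha> \<cdot>\<^bsub>C\<^esub> d n) = Null C (E (Suc n)) (E' m))" for n \<alpha>
  have "\<exists>\<alpha>. \<forall>n. P n (\<alpha> n) \<and> d' n \<cdot>\<^bsub>C\<^esub> \<alpha> (Suc n) = \<alpha> n \<cdot>\<^bsub>C\<^esub> d n"
  proof (rule dependent_nat_choice)
    obtain a where a: "a \<in> Hom C (E 0) (E' 0)" "e' \<cdot>\<^bsub>C\<^esub> a = e" using L'.e_lift[OF L.E_projective L.e] by blast
    then have "P 0 a" using L.Comp_assoc[OF L.d a(1) L'.e] L.e_d by (simp add: P_def)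
    then show "\<exists>a. P 0 a" by (rule exI)
  next
    fix a n assume Pa: "P n a"
    then have a: "a \<in> Hom C (E n) (E' n)" by (simp add: P_def)
    have ad: "a \<cdot>\<^bsub>C\<^esub> d n \<in> Hom C (E (Suc n)) (E' n)" by (rule L.Comp_Hom[OF L.d a])
    have "\<exists>b \<in> Hom C (E (Suc n)) (E' (Suc n)). d' n \<cdot>\<^bsub>C\<^esub> b = a \<cdot>\<^bsub>C\<^esub> d n"
    proof (cases n)
      case 0
      then show ?thesis using L'.d0_lift[OF L.E_projective, of "a \<cdot>\<^bsub>C\<^esub> d n" "Suc 0"] ad Pa by (simp add: P_def)
    next
      case (Suc m)
      then show ?thesis using L'.d_lift[OF L.E_projective, of "a \<cdot>\<^bsub>C\<^esub> d n" "Suc n" m] ad Pa by (simp add: P_def)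
    qed
    then obtain b where b: "b \<in> Hom C (E (Suc n)) (E' (Suc n))" "d' n \<cdot>\<^bsub>C\<^esub> b = a \<cdot>\<^bsub>C\<^esub> d n" by blast
    have "d' n \<cdot>\<^bsub>C\<^esub> (b \<cdot>\<^bsub>C\<^esub> d (Suc n)) = Null C (E (Suc (Suc n))) (E' n)"
      using L.Comp_assoc[OF L.d b(1) L'.d] L.Comp_assoc[OF L.d L.d a] b(2) L.d_d L.Comp_Null[OF a L.E_Obj] by simp
    then have "P (Suc n) b" using b(1) by (simp add: P_def)
    then show "\<exists>b. P (Suc n) b \<and> d' n \<cdot>\<^bsub>C\<^esub> b = a \<cdot>\<^bsub>C\<^esub> d n" using b(2) by blast
  qed
  then obtain \<alpha> where \<alpha>: "\<And>n. P n (\<alpha> n)" "\<And>n. d' n \<cdot>\<^bsub>C\<^esub> \<alpha> (Suc n) = \<alpha> n \<cdot>\<^bsub>C\<^esub> d n" by blast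
  show ?thesis
    by (rule that[of \<alpha>]) (use \<alpha>(1) in \<open>simp add: P_def\<close>, use \<alpha>(1)[of 0] in \<open>simp add: P_def\<close>, rule \<alpha>(2))
qed

lemma (in lifting_resolution) lifting_homotopy_exists:
  assumes \<alpha>: "\<And>n. \<alpha> n \<in> Hom C (E n) (E n)" and e\<alpha>: "e \<cdot> \<alpha> 0 = e"
    and d\<alpha>: "\<And>n. d n \<cdot> \<alpha> (Suc n) = \<alpha> n \<cdot> d n"
  obtains h where "\<And>n. h n \<in> Hom C (E n) (E (Suc n))"
    "Ident C (E 0) = Add C (\<alpha> 0) (d 0 \<cdot> h 0)"
    "\<And>n. Ident C (E (Suc n)) = Add C (Add C (\<alpha> (Suc n)) (h n \<cdot> d n)) (d (Suc n) \<cdot> h (Suc n))"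
proof -
  \<comment> \<open>The last clause is the homotopy equation on boundaries, where the summand \<open>h \<cdot> d\<close>
    is zero.\<close>
  define P where "P n h \<longleftrightarrow> h \<in> Hom C (E n) (E (Suc n)) \<and>
    (n = 0 \<longrightarrow> Ident C (E 0) = Add C (\<alpha> 0) (d 0 \<cdot> h)) \<and>
    d n = Add C (\<alpha> n \<cdot> d n) (d n \<cdot> (h \<cdot> d n))" for n h
  have "\<exists>h. \<forall>n. P n (h n) \<and> Ident C (E (Suc n)) = Add C (Add C (\<alpha> (Suc n)) (h n \<cdot> d n)) (d (Suc n) \<cdot> h (Suc n))"
  proof (rule dependent_nat_choice)
    have "e \<cdot> Ident C (E 0) = e \<cdot> \<alpha> 0" using e\<alpha> Comp_Ident[OF e] by simp
    then have "\<exists>h \<in> Hom C (E 0) (E (Suc 0)). Ident C (E 0) = Add C (\<alpha> 0) (d 0 \<cdot> h)"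
      by (rule lift_difference[OF e Ident_Hom[OF E_Obj] \<alpha> _ d0_lift[OF E_projective]])
    then obtain h where h: "h \<in> Hom C (E 0) (E (Suc 0))" "Ident C (E 0) = Add C (\<alpha> 0) (d 0 \<cdot> h)" by blast
    have dh: "d 0 \<cdot> h \<in> Hom C (E 0) (E 0)" by (rule Comp_Hom[OF h(1) d])
    have "d 0 = Add C (\<alpha> 0) (d 0 \<cdot> h) \<cdot> d 0" unfolding h(2)[symmetric] using Ident_Comp[OF d] by simp
    then have "d 0 = Add C (\<alpha> 0 \<cdot> d 0) (d 0 \<cdot> (h \<cdot> d 0))"
      unfolding Add_Comp[OF d \<alpha> dh] Comp_assoc[OF d h(1) d] .
    then have "P 0 h" using h unfolding P_def by blast
    then show "\<exists>h. P 0 h" by (rule exI)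
  next
    fix h n assume Ph: "P n h"
    then have h: "h \<in> Hom C (E n) (E (Suc n))" and eq: "d n = Add C (\<alpha> n \<cdot> d n) (d n \<cdot> (h \<cdot> d n))"
      unfolding P_def by blast+
    have hd: "h \<cdot> d n \<in> Hom C (E (Suc n)) (E (Suc n))" by (rule Comp_Hom[OF d h])
    let ?g = "Add C (\<alpha> (Suc n)) (h \<cdot> d n)"
    have g: "?g \<in> Hom C (E (Suc n)) (E (Suc n))" by (rule Add_Hom[OF \<alpha> hd])
    have "d n \<cdot> ?g = d n" unfolding Comp_Add[OF \<alpha> hd d] d\<alpha> by (rule eq[symmetric])
    then have "d n \<cdot> Ident C (E (Suc n)) = d n \<cdot> ?g" using Comp_Ident[OF d] by simp
    then have "\<exists>k \<in> Hom C (E (Suc n)) (E (Suc (Suc n))). Ident C (E (Suc n)) = Add C ?g (d (Suc n) \<cdot> k)"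
      by (rule lift_difference[OF d Ident_Hom[OF E_Obj] g _ d_lift[OF E_projective]])
    then obtain k where k: "k \<in> Hom C (E (Suc n)) (E (Suc (Suc n)))" "Ident C (E (Suc n)) = Add C ?g (d (Suc n) \<cdot> k)" by blast
    have dk: "d (Suc n) \<cdot> k \<in> Hom C (E (Suc n)) (E (Suc n))" by (rule Comp_Hom[OF k(1) d])
    have "?g \<cdot> d (Suc n) = \<alpha> (Suc n) \<cdot> d (Suc n)"
      unfolding Add_Comp[OF d \<alpha> hd] Comp_assoc[OF d d h] d_d Comp_Null[OF h E_Obj]
      by (rule Add_Null(1)[OF Comp_Hom[OF d \<alpha>]])
    moreover have "d (Suc n) = Add C ?g (d (Suc n) \<cdot> k) \<cdot> d (Suc n)"
      unfolding k(2)[symmetric] using Ident_Comp[OF d] by simp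
    ultimately have "d (Suc n) = Add C (\<alpha> (Suc n) \<cdot> d (Suc n)) (d (Suc n) \<cdot> (k \<cdot> d (Suc n)))"
      unfolding Add_Comp[OF d g dk] Comp_assoc[OF d k(1) d] by (rule subst[where P = "\<lambda>x. d (Suc n) = Add C x _"])
    then have "P (Suc n) k" using k(1) unfolding P_def by blast
    then show "\<exists>k. P (Suc n) k \<and> Ident C (E (Suc n)) = Add C ?g (d (Suc n) \<cdot> k)" using k(2) by (intro exI[of _ k] conjI)
  qed
  then obtain h where "\<forall>n. P n (h n) \<and> Ident C (E (Suc n)) = Add C (Add C (\<alpha> (Suc n)) (h n \<cdot> d n)) (d (Suc n) \<cdot> h (Suc n))"
    by (rule exE)
  then have h: "P n (h n)" "Ident C (E (Suc n)) = Add C (Add C (\<alpha> (Suc n)) (h n \<cdot> d n)) (d (Suc n) \<cdot> h (Suc n))" for n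
    by blast+
  have h1: "h n \<in> Hom C (E n) (E (Suc n))" for n using h(1)[of n] unfolding P_def by blast
  have h2: "Ident C (E 0) = Add C (\<alpha> 0) (d 0 \<cdot> h 0)" using h(1)[of 0] unfolding P_def by blast
  show ?thesis by (rule that[OF h1 h2 h(2)])
qed

text \<open>
  A projective object \<open>R\<close> is a retract of the coproduct of copies of \<open>P\<close> indexed by \<open>Hom C P R\<close>,
  so it suffices to lift arrows from \<open>P\<close>.
\<close>

lemma (in power_generator) projective_lift:
  assumes R: "projective C R" and f: "f \<in> Hom C R M" and a: "a \<in> Hom C L M"
    and lift: "\<And>w. w \<in> Hom C P R \<Longrightarrow> \<exists>g \<in> Hom C P L. a \<cdot> g = f \<cdot> w"
  shows "\<exists>g \<in> Hom C R L. a \<cdot> g = f"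
proof -
  have RO: "R \<in> Obj C" using R by (simp add: projective_def)
  obtain K j where K: "is_coproduct C (Hom C P R) (\<lambda>_. P) K j"
    using small_coproduct_exists[OF cocomplete u'(2) Hom_small[OF P_Obj RO], of "\<lambda>_. P"] P_Obj by blast
  obtain \<epsilon> where \<epsilon>: "\<epsilon> \<in> Hom C K R" "\<And>w. w \<in> Hom C P R \<Longrightarrow> \<epsilon> \<cdot> j w = w"
    by (rule coproduct_map[OF K RO, of "\<lambda>w. w"]) blast+
  have jH: "j w \<in> Hom C P K" if "w \<in> Hom C P R" for w using coproduct_inj[OF K that] .
  have "epi_arr C \<epsilon>"
    unfolding epi_arr_def
  proof (intro conjI ballI impI)
    show "\<epsilon> \<in> Arr C" using \<epsilon>(1) by (simp add: Hom_def)
    fix Y g h assume "g \<in> Hom C (Cod C \<epsilon>) Y" "h \<in> Hom C (Cod C \<epsilon>) Y" and eq: "g \<cdot> \<epsilon> = h \<cdot> \<epsilon>"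
    then have g: "g \<in> Hom C R Y" and h: "h \<in> Hom C R Y" using \<epsilon>(1) by (simp_all add: Hom_def)
    have "g \<cdot> w = h \<cdot> w" if w: "w \<in> Hom C P R" for w
      using Comp_assoc[OF jH[OF w] \<epsilon>(1) g] Comp_assoc[OF jH[OF w] \<epsilon>(1) h] \<epsilon>(2)[OF w] eq by simp
    then show "g = h" using P_generator g h Hom_Obj[OF g] unfolding generator_def by blast
  qed
  moreover have "Cod C \<epsilon> = R" "Dom C \<epsilon> = K" using \<epsilon>(1) by (simp_all add: Hom_def)
  ultimately obtain s where s: "s \<in> Hom C R K" "\<epsilon> \<cdot> s = Ident C R"
    using R Ident_Hom[OF RO] unfolding projective_def by blast
  obtain g where g: "\<And>w. w \<in> Hom C P R \<Longrightarrow> g w \<in> Hom C P L \<and> a \<cdot> g w = f \<cdot> w" using lift by metis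
  obtain G where G: "G \<in> Hom C K L" "\<And>w. w \<in> Hom C P R \<Longrightarrow> G \<cdot> j w = g w"
    by (rule coproduct_map[OF K Hom_Obj(1)[OF a], of g]) (use g in blast)+
  have "a \<cdot> G = f \<cdot> \<epsilon>"
  proof (rule coproduct_eqI[OF K Comp_Hom[OF G(1) a] Comp_Hom[OF \<epsilon>(1) f]])
    fix w assume w: "w \<in> Hom C P R"
    show "(a \<cdot> G) \<cdot> j w = (f \<cdot> \<epsilon>) \<cdot> j w"
      using Comp_assoc[OF jH[OF w] G(1) a] Comp_assoc[OF jH[OF w] \<epsilon>(1) f] G(2)[OF w] g[OF w] \<epsilon>(2)[OF w] by simp
  qed
  then have "a \<cdot> (G \<cdot> s) = f"
    using Comp_assoc[OF s(1) G(1) a] Comp_assoc[OF s(1) \<epsilon>(1) f] s(2) Comp_Ident[OF f] by simp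
  then show ?thesis using Comp_Hom[OF s(1) G(1)] by blast
qed

text \<open>
  In other words, the left adjoint of \<open>\<Theta>\<close> on small modules, which takes the free module on \<open>X\<close> to
  the coproduct \<open>Q^(X)\<close>, takes \<open>\<Theta> B\<close> back to \<open>B\<close>, and its higher left derived functors vanish on
  \<open>\<Theta> B\<close>.
\<close>

lemma (in free_realization) realization_lifting: "lifting_resolution C B D \<epsilon> bd"
proof
  have \<delta>0: "\<delta> 0 = \<epsilon>" by (simp add: \<delta>_def)
  show "projective C (D n)" for n using D Q_projective by (rule projective_coproduct)
  show "\<epsilon> \<in> Hom C (D 0) B" by (rule \<epsilon>)
  show "bd n \<in> Hom C (D (Suc n)) (D n)" for n by (rule bd)
  show "\<epsilon> \<cdot> bd 0 = Null C (D (Suc 0)) B" by (rule \<epsilon>_bd)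
  show "bd n \<cdot> bd (Suc n) = Null C (D (Suc (Suc n))) (D n)" for n by (rule bd_bd)
  show "\<exists>g \<in> Hom C R (D 0). \<epsilon> \<cdot> g = f" if "projective C R" "f \<in> Hom C R B" for R f
    by (rule projective_lift[OF that \<epsilon>]) (use \<delta>_surjective_P[OF Comp_Hom[OF _ that(2)]] \<delta>0 in simp)
  have ex: "\<exists>g \<in> Hom C R (D (Suc n)). \<delta> (Suc n) \<cdot> g = f"
    if R: "projective C R" and f: "f \<in> Hom C R (D n)" and f0: "\<delta> n \<cdot> f = Null C R (A n)" for R f n
  proof (rule projective_lift[OF R f])
    show "\<delta> (Suc n) \<in> Hom C (D (Suc n)) (D n)" using \<delta>_Hom[of "Suc n"] by simp
    fix w assume w: "w \<in> Hom C P R"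
    have "\<delta> n \<cdot> (f \<cdot> w) = Null C P (A n)"
      using Comp_assoc[OF w f \<delta>_Hom] f0 Null_Comp[OF w A_Obj] by simp
    then show "\<exists>g \<in> Hom C P (D (Suc n)). \<delta> (Suc n) \<cdot> g = f \<cdot> w" by (rule \<delta>_exact_P[OF Comp_Hom[OF w f]])
  qed
  show "\<exists>g \<in> Hom C R (D (Suc 0)). bd 0 \<cdot> g = f"
    if "projective C R" "f \<in> Hom C R (D 0)" "\<epsilon> \<cdot> f = Null C R B" for R f
    using ex[of R f 0] that by (simp add: \<delta>_def)
  show "\<exists>g \<in> Hom C R (D (Suc (Suc n))). bd (Suc n) \<cdot> g = f"
    if "projective C R" "f \<in> Hom C R (D (Suc n))" "bd n \<cdot> f = Null C R (D n)" for R f n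
    using ex[of R f "Suc n"] that by (simp add: \<delta>_def)
qed

section \<open>Comparison of the Ext groups\<close>

text \<open>
  The form \<open>B <#> \<phi> ` K\<close> of the induced map is the one in which \<open>Ext_map\<close> is given. The last two
  hypotheses are its surjectivity and injectivity in terms of representatives.
\<close>

lemma quotient_iso:
  assumes "comm_group G" "comm_group H" "subgroup A G" "subgroup B H" and \<phi>: "\<phi> \<in> hom G H"
    and AB: "\<phi> ` A \<subseteq> B"
    and surj: "\<And>h. h \<in> carrier H \<Longrightarrow> \<exists>g \<in> carrier G. \<exists>b \<in> B. h = b \<otimes>\<^bsub>H\<^esub> \<phi> g"
    and inj: "\<And>g. g \<in> carrier G \<Longrightarrow> \<phi> g \<in> B \<Longrightarrow> g \<in> A"
  shows "(\<lambda>K. B <#>\<^bsub>H\<^esub> \<phi> ` K) \<in> iso (G Mod A) (H Mod B)"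
proof -
  interpret G: comm_group G by fact
  interpret H: comm_group H by fact
  interpret A: subgroup A G by fact
  interpret B: subgroup B H by fact
  have nA: "A \<lhd> G" using assms(3) by (rule G.subgroup_imp_normal)
  have nB: "B \<lhd> H" using assms(4) by (rule H.subgroup_imp_normal)
  have \<phi>c: "\<phi> g \<in> carrier H" if "g \<in> carrier G" for g using \<phi> that by (rule hom_in_carrier)
  have \<phi>m: "\<phi> (x \<otimes>\<^bsub>G\<^esub> y) = \<phi> x \<otimes>\<^bsub>H\<^esub> \<phi> y" if "x \<in> carrier G" "y \<in> carrier G" for x y
    using \<phi> that by (rule hom_mult)
  let ?f = "\<lambda>K. B <#>\<^bsub>H\<^esub> \<phi> ` K"
  have f: "?f (A #>\<^bsub>G\<^esub> g) = B #>\<^bsub>H\<^esub> \<phi> g" if g: "g \<in> carrier G" for g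
  proof
    show "?f (A #>\<^bsub>G\<^esub> g) \<subseteq> B #>\<^bsub>H\<^esub> \<phi> g"
    proof
      fix y assume "y \<in> ?f (A #>\<^bsub>G\<^esub> g)"
      then obtain b a where b: "b \<in> B" and a: "a \<in> A" and y: "y = b \<otimes>\<^bsub>H\<^esub> \<phi> (a \<otimes>\<^bsub>G\<^esub> g)"
        by (auto simp: set_mult_def r_coset_def)
      have "\<phi> a \<in> B" using AB a by blast
      then have "y = (b \<otimes>\<^bsub>H\<^esub> \<phi> a) \<otimes>\<^bsub>H\<^esub> \<phi> g" "b \<otimes>\<^bsub>H\<^esub> \<phi> a \<in> B"
        using b a g y \<phi>m \<phi>c by (simp_all add: H.m_assoc)
      then show "y \<in> B #>\<^bsub>H\<^esub> \<phi> g" by (auto simp: r_coset_def)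
    qed
    have "g \<in> A #>\<^bsub>G\<^esub> g" using g assms(3) by (rule G.rcos_self)
    then show "B #>\<^bsub>H\<^esub> \<phi> g \<subseteq> ?f (A #>\<^bsub>G\<^esub> g)" by (auto simp: set_mult_def r_coset_def[of H])
  qed
  have cG: "K \<in> carrier (G Mod A) \<longleftrightarrow> (\<exists>g \<in> carrier G. K = A #>\<^bsub>G\<^esub> g)" for K
    by (auto simp: FactGroup_def RCOSETS_def)
  have cH: "K \<in> carrier (H Mod B) \<longleftrightarrow> (\<exists>h \<in> carrier H. K = B #>\<^bsub>H\<^esub> h)" for K
    by (auto simp: FactGroup_def RCOSETS_def)
  have fc: "?f K \<in> carrier (H Mod B)" if K: "K \<in> carrier (G Mod A)" for K
  proof -
    obtain g where g: "g \<in> carrier G" "K = A #>\<^bsub>G\<^esub> g" using K unfolding cG by blast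
    show ?thesis unfolding cH g(2) f[OF g(1)] using \<phi>c[OF g(1)] by blast
  qed
  have "?f \<in> hom (G Mod A) (H Mod B)"
  proof (rule homI)
    fix K assume "K \<in> carrier (G Mod A)"
    then show "?f K \<in> carrier (H Mod B)" by (rule fc)
  next
    fix K K' assume "K \<in> carrier (G Mod A)" "K' \<in> carrier (G Mod A)"
    then obtain g g' where g: "g \<in> carrier G" "K = A #>\<^bsub>G\<^esub> g" "g' \<in> carrier G" "K' = A #>\<^bsub>G\<^esub> g'" unfolding cG by blast
    have KK': "K \<otimes>\<^bsub>G Mod A\<^esub> K' = A #>\<^bsub>G\<^esub> (g \<otimes>\<^bsub>G\<^esub> g')"
      unfolding g(2,4) by (simp add: FactGroup_def normal.rcos_sum[OF nA g(1,3)])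
    have "?f (K \<otimes>\<^bsub>G Mod A\<^esub> K') = B #>\<^bsub>H\<^esub> (\<phi> g \<otimes>\<^bsub>H\<^esub> \<phi> g')"
      unfolding KK' f[OF G.m_closed[OF g(1,3)]] \<phi>m[OF g(1,3)] by (rule refl)
    also have "\<dots> = ?f K <#>\<^bsub>H\<^esub> ?f K'"
      unfolding g(2,4) f[OF g(1)] f[OF g(3)]
      by (rule normal.rcos_sum[OF nB \<phi>c[OF g(1)] \<phi>c[OF g(3)], symmetric])
    finally show "?f (K \<otimes>\<^bsub>G Mod A\<^esub> K') = ?f K \<otimes>\<^bsub>H Mod B\<^esub> ?f K'" by (simp add: FactGroup_def)
  qed
  moreover have "bij_betw ?f (carrier (G Mod A)) (carrier (H Mod B))"
  proof (rule bij_betw_imageI)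
    show "inj_on ?f (carrier (G Mod A))"
    proof (rule inj_onI)
      fix K K' assume "K \<in> carrier (G Mod A)" "K' \<in> carrier (G Mod A)" and eq: "?f K = ?f K'"
      then obtain g g' where g: "g \<in> carrier G" "K = A #>\<^bsub>G\<^esub> g" "g' \<in> carrier G" "K' = A #>\<^bsub>G\<^esub> g'" unfolding cG by blast
      have "\<phi> g' \<in> B #>\<^bsub>H\<^esub> \<phi> g"
        using H.rcos_self[OF \<phi>c[OF g(3)] assms(4)] eq unfolding g(2,4) f[OF g(1)] f[OF g(3)] by simp
      then obtain b where b: "b \<in> B" "\<phi> g' = b \<otimes>\<^bsub>H\<^esub> \<phi> g" by (auto simp: r_coset_def)
      have "\<phi> (g' \<otimes>\<^bsub>G\<^esub> inv\<^bsub>G\<^esub> g) \<otimes>\<^bsub>H\<^esub> \<phi> g = b \<otimes>\<^bsub>H\<^esub> \<phi> g"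
        using \<phi>m[of "g' \<otimes>\<^bsub>G\<^esub> inv\<^bsub>G\<^esub> g" g] g(1,3) b(2) by (simp add: G.m_assoc)
      then have "\<phi> (g' \<otimes>\<^bsub>G\<^esub> inv\<^bsub>G\<^esub> g) = b" using g(1,3) b(1) \<phi>c by simp
      then have "g' \<otimes>\<^bsub>G\<^esub> inv\<^bsub>G\<^esub> g \<in> A" using inj g(1,3) b(1) by simp
      then have "g' \<in> A #>\<^bsub>G\<^esub> g" by (rule A.rcos_module_rev[OF G.group_axioms g(1,3)])
      then show "K = K'" unfolding g(2,4) by (rule G.repr_independence[OF _ g(1) assms(3)])
    qed
    show "?f ` carrier (G Mod A) = carrier (H Mod B)"
    proof
      show "?f ` carrier (G Mod A) \<subseteq> carrier (H Mod B)" using fc by (rule image_subsetI)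
      show "carrier (H Mod B) \<subseteq> ?f ` carrier (G Mod A)"
      proof
        fix K assume "K \<in> carrier (H Mod B)"
        then obtain h where h: "h \<in> carrier H" "K = B #>\<^bsub>H\<^esub> h" unfolding cH by blast
        obtain g b where g: "g \<in> carrier G" and b: "b \<in> B" "h = b \<otimes>\<^bsub>H\<^esub> \<phi> g" using surj[OF h(1)] by blast
        have "h \<in> B #>\<^bsub>H\<^esub> \<phi> g" using b by (auto simp: r_coset_def)
        from H.repr_independence[OF this \<phi>c[OF g] assms(4)]
        have "K = ?f (A #>\<^bsub>G\<^esub> g)" unfolding h(2) f[OF g] by (rule sym)
        moreover have "A #>\<^bsub>G\<^esub> g \<in> carrier (G Mod A)" using g unfolding cG by blast
        ultimately show "K \<in> ?f ` carrier (G Mod A)" by (rule image_eqI)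
      qed
    qed
  qed
  ultimately show ?thesis by (simp add: iso_def)
qed

context abelian_category
begin

text \<open>
  This computation cancels the term \<open>t\<close> in the proof of \<open>cocycle_lift\<close>.
\<close>

lemma Add_rearrange:
  assumes "\<alpha> \<in> Hom C X Y" "\<beta> \<in> Hom C X Y" "\<gamma> \<in> Hom C X Y" "t' \<in> Hom C X Y" "t \<in> Hom C X Y"
    and "Add C t' t = Null C X Y"
  shows "Add C (Add C \<alpha> (Add C \<beta> t')) (Add C \<gamma> t) = Add C (Add C \<alpha> \<gamma>) \<beta>"
proof -
  interpret comm_group "hom_group C X Y" using Hom_Obj[OF assms(1)] by (rule hom_comm_group)
  let ?m = "mult (hom_group C X Y)"
  have "?m (?m \<alpha> (?m \<beta> t')) (?m \<gamma> t) = ?m (?m (?m \<alpha> \<gamma>) \<beta>) (?m t' t)"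
  proof -
    have "\<alpha> \<in> carrier (hom_group C X Y)" "\<beta> \<in> carrier (hom_group C X Y)" "\<gamma> \<in> carrier (hom_group C X Y)"
      "t' \<in> carrier (hom_group C X Y)" "t \<in> carrier (hom_group C X Y)" using assms by simp_all
    then show ?thesis by (simp del: hom_group_simps add: m_ac)
  qed
  then show ?thesis using assms Add_Null(1)[OF Add_Hom[OF Add_Hom[OF assms(1,3)] assms(2)]] by simp
qed

lemma Theta_comp_hom:
  assumes "lmod (End_op C Q) M" "Q \<in> Obj C" "m \<in> Hom C Z Y" "f \<in> lmod_hom (End_op C Q) M (Theta C Q Z)"
  shows "(\<lambda>x\<in>carrier M. m \<cdot> f x) \<in> lmod_hom (End_op C Q) M (Theta C Q Y)"
proof -
  have "compose (carrier M) (Theta_arr C Q m) f = (\<lambda>x\<in>carrier M. m \<cdot> f x)"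
    using lmod_hom_closed[OF assms(4)] Theta_arr_apply[OF assms(3)]
    by (auto simp: compose_def Theta_simps)
  then show ?thesis using lmod_hom_compose[OF assms(1,4) Theta_arr_hom[OF assms(2,3)]] by simp
qed

end

text \<open>
  A projective resolution \<open>E\<close> of \<open>B\<close>, a free resolution \<open>F\<close> of \<open>\<Theta> B\<close> with bases of any size, and a
  comparison map \<open>\<phi>\<close> between them are given; the small free resolution with its complex \<open>D\<close>
  mediates between \<open>E\<close> and \<open>F\<close>.
\<close>

locale Ext_comparison = free_realization C u l P Q \<kappa> B X2 e2 d2 D \<iota> J bd \<epsilon> +
  E: lifting_resolution C B E eE dE + F: free_res "End_op C Q" "Theta C Q B" X eF dF
  for C :: "('o, 'a, 'z) ab_category_scheme" (structure)
    and u :: "'u rel" and l :: "'l rel" and P Q \<kappa> B and X2 :: "nat \<Rightarrow> 'y set" and e2 d2 D \<iota> J bd \<epsilon>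
    and E eE dE and X :: "nat \<Rightarrow> 'x set" and eF dF +
  fixes \<phi> and Y :: 'o
  assumes \<phi>: "\<phi> n \<in> lmod_hom (End_op C Q) (free_lmod (End_op C Q) (X n)) (Theta C Q (E n))"
    and e_\<phi>: "c \<in> carrier (free_lmod (End_op C Q) (X 0)) \<Longrightarrow> eE \<cdot> \<phi> 0 c = eF c"
    and d_\<phi>: "c \<in> carrier (free_lmod (End_op C Q) (X (Suc n))) \<Longrightarrow> dE n \<cdot> \<phi> (Suc n) c = \<phi> n (dF n c)"
    and Y: "Y \<in> Obj C"
begin

lemma \<phi>_Hom: "c \<in> carrier (F.F n) \<Longrightarrow> \<phi> n c \<in> Hom C Q (E n)"
  using lmod_hom_closed[OF \<phi>] by (simp add: Theta_simps)

lemma Theta_Y: "lmod S (Theta C Q Y)" by (rule Theta_lmod[OF Q_Obj Y])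

lemma hom_Y_Hom: "c \<in> lmod_hom S M (Theta C Q Y) \<Longrightarrow> x \<in> carrier M \<Longrightarrow> c x \<in> Hom C Q Y"
  using lmod_hom_closed by (fastforce simp: Theta_simps)

text \<open>
  Linear maps on the small free resolution are arrows out of \<open>D n\<close>; here the linear map is the
  restriction of \<open>c\<close> along a map \<open>j\<close> to the given free resolution.
\<close>

lemma realize:
  assumes j: "j \<in> lmod_hom S (free.F n) (F.F m)" and c: "c \<in> lmod_hom S (F.F m) (Theta C Q Z)" and Z: "Z \<in> Obj C"
  obtains c' where "c' \<in> Hom C (D n) Z" "\<And>k. k \<in> carrier (free.F n) \<Longrightarrow> c' \<cdot> J n k = c (j k)"
proof -
  let ?cj = "compose (carrier (free.F n)) c j"
  have cj: "?cj \<in> lmod_hom S (free.F n) (Theta C Q Z)" by (rule lmod_hom_compose[OF free.F_lmod j c])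
  have cjH: "?cj (unit_vec S x) \<in> Hom C Q Z" if "x \<in> X2 n" for x
    using lmod_hom_closed[OF cj unit_vec_closed[OF free.R that]] by (simp add: Theta_simps)
  obtain c' where c': "c' \<in> Hom C (D n) Z" "\<And>x. x \<in> X2 n \<Longrightarrow> c' \<cdot> \<iota> n x = ?cj (unit_vec S x)"
    by (rule D_map[OF Z, of n "\<lambda>x. ?cj (unit_vec S x)", OF cjH]) blast+
  show ?thesis
  proof (rule that[OF c'(1)])
    fix k assume k: "k \<in> carrier (free.F n)"
    have "c' \<cdot> J n k = ?cj k" by (rule Comp_J[OF c'(1) cj k c'(2)])
    then show "c' \<cdot> J n k = c (j k)" using k by (simp add: compose_eq)
  qed
qed

lemma D_eqI_J:
  assumes "h \<in> Hom C (D n) Z" "h' \<in> Hom C (D n) Z" "\<And>k. k \<in> carrier (free.F n) \<Longrightarrow> h \<cdot> J n k = h' \<cdot> J n k"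
  shows "h = h'"
proof (rule D_eqI[OF assms(1,2)])
  fix x assume x: "x \<in> X2 n"
  show "h \<cdot> \<iota> n x = h' \<cdot> \<iota> n x"
    using assms(3)[OF unit_vec_closed[OF free.R x]] J_unit[OF x] by simp
qed

lemma realization_map_exists:
  assumes j: "\<And>n. j n \<in> lmod_hom S (free.F n) (F.F n)"
    and e_j: "\<And>c. c \<in> carrier (free.F 0) \<Longrightarrow> eF (j 0 c) = e2 c"
    and d_j: "\<And>n c. c \<in> carrier (free.F (Suc n)) \<Longrightarrow> dF n (j (Suc n) c) = j n (d2 n c)"
  obtains \<psi> where "\<And>n. \<psi> n \<in> Hom C (D n) (E n)"
    and "\<And>n k. k \<in> carrier (free.F n) \<Longrightarrow> \<psi> n \<cdot> J n k = \<phi> n (j n k)"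
    and "eE \<cdot> \<psi> 0 = \<epsilon>" and "\<And>n. dE n \<cdot> \<psi> (Suc n) = \<psi> n \<cdot> bd n"
proof -
  have "\<exists>p. p \<in> Hom C (D n) (E n) \<and> (\<forall>k \<in> carrier (free.F n). p \<cdot> J n k = \<phi> n (j n k))" for n
    by (rule realize[OF j[of n] \<phi> E.E_Obj]) blast
  then obtain \<psi> where \<psi>: "\<And>n. \<psi> n \<in> Hom C (D n) (E n)"
    and \<psi>J: "\<And>n k. k \<in> carrier (free.F n) \<Longrightarrow> \<psi> n \<cdot> J n k = \<phi> n (j n k)" by metis
  have jc: "j n k \<in> carrier (F.F n)" if "k \<in> carrier (free.F n)" for n k by (rule lmod_hom_closed[OF j that])
  have "eE \<cdot> \<psi> 0 = \<epsilon>"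
  proof (rule D_eqI_J[OF Comp_Hom[OF \<psi> E.e] \<epsilon>])
    fix k assume k: "k \<in> carrier (free.F 0)"
    show "(eE \<cdot> \<psi> 0) \<cdot> J 0 k = \<epsilon> \<cdot> J 0 k"
      using Comp_assoc[OF J_Hom[OF k] \<psi> E.e] \<psi>J[OF k] e_\<phi>[OF jc[OF k]] e_j[OF k] \<epsilon>_J[OF k] by simp
  qed
  moreover have "dE n \<cdot> \<psi> (Suc n) = \<psi> n \<cdot> bd n" for n
  proof (rule D_eqI_J[OF Comp_Hom[OF \<psi> E.d] Comp_Hom[OF bd \<psi>]])
    fix k assume k: "k \<in> carrier (free.F (Suc n))"
    have dk: "d2 n k \<in> carrier (free.F n)" by (rule lmod_hom_closed[OF free.d_hom k])
    have "(dE n \<cdot> \<psi> (Suc n)) \<cdot> J (Suc n) k = \<phi> n (j n (d2 n k))"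
      using Comp_assoc[OF J_Hom[OF k] \<psi> E.d] \<psi>J[OF k] d_\<phi>[OF jc[OF k]] d_j[OF k] by simp
    also have "\<dots> = (\<psi> n \<cdot> bd n) \<cdot> J (Suc n) k"
      using Comp_assoc[OF J_Hom[OF k] bd \<psi>] bd_J[OF k] \<psi>J[OF dk] by simp
    finally show "(dE n \<cdot> \<psi> (Suc n)) \<cdot> J (Suc n) k = (\<psi> n \<cdot> bd n) \<cdot> J (Suc n) k" .
  qed
  ultimately show ?thesis using that[of \<psi>] \<psi> \<psi>J by blast
qed

text \<open>
  Restricting \<open>c\<close> along \<open>j\<close> to the small free resolution gives an arrow \<open>ct : D i \<rightarrow> Y\<close>, and \<open>f\<close> is
  its composition with the comparison \<open>\<chi> : E \<rightarrow> D\<close>. Restricted to the small resolution, \<open>f \<cdot> \<phi>\<close> is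
  \<open>ct \<cdot> \<chi> \<cdot> \<psi>\<close>, which differs from \<open>c\<close> by a coboundary as \<open>\<chi> \<cdot> \<psi>\<close> is homotopic to the identity by
  \<open>b\<close>. On the given resolution \<open>F\<close> the same follows by the homotopy \<open>h\<close> between the identity and
  \<open>j \<circ> r\<close>: it writes \<open>c - f \<cdot> \<phi>\<close> as its restriction along \<open>j \<circ> r\<close> plus a coboundary.
\<close>

lemma cocycle_lift:
  assumes c: "c \<in> lmod_cocycles S X dF (Theta C Q Y) i"
  shows "\<exists>f \<in> cocycles C E dE Y i. \<exists>g \<in> lmod_coboundaries S X dF (Theta C Q Y) i.
    \<forall>x \<in> carrier (F.F i). c x = Add C (g x) (f \<cdot> \<phi> i x)"
proof -
  have ch: "c \<in> lmod_hom S (F.F i) (Theta C Q Y)"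
    and c0: "compose (carrier (F.F (Suc i))) c (dF i) = lmod_zero (F.F (Suc i)) (Theta C Q Y)"
    using c by (simp_all add: lmod_cocycles_def)
  have cd: "c (dF i x) = Null C Q Y" if "x \<in> carrier (F.F (Suc i))" for x
    using fun_cong[OF c0, of x] that by (simp add: compose_eq lmod_zero_def Theta_simps)
  obtain j where j: "\<And>n. j n \<in> lmod_hom S (free.F n) (F.F n)"
    and e_j: "\<And>c. c \<in> carrier (free.F 0) \<Longrightarrow> eF (j 0 c) = e2 c"
    and d_j: "\<And>n c. c \<in> carrier (free.F (Suc n)) \<Longrightarrow> dF n (j (Suc n) c) = j n (d2 n c)"
    by (rule free_comparison_exists[OF free.free_res_axioms F.free_res_axioms]) blast
  obtain r where r: "\<And>n. r n \<in> lmod_hom S (F.F n) (free.F n)"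
    and e_r: "\<And>c. c \<in> carrier (F.F 0) \<Longrightarrow> e2 (r 0 c) = eF c"
    and d_r: "\<And>n c. c \<in> carrier (F.F (Suc n)) \<Longrightarrow> d2 n (r (Suc n) c) = r n (dF n c)"
    by (rule free_comparison_exists[OF F.free_res_axioms free.free_res_axioms]) blast
  have jc: "j n k \<in> carrier (F.F n)" if "k \<in> carrier (free.F n)" for n k by (rule lmod_hom_closed[OF j that])
  have rc: "r n k \<in> carrier (free.F n)" if "k \<in> carrier (F.F n)" for n k by (rule lmod_hom_closed[OF r that])
  have dc: "dF n k \<in> carrier (F.F n)" if "k \<in> carrier (F.F (Suc n))" for n k by (rule lmod_hom_closed[OF F.d_hom that])
  let ?jr = "\<lambda>n. compose (carrier (F.F n)) (j n) (r n)"
  obtain h where h: "\<And>n. h n \<in> lmod_hom S (F.F n) (F.F (Suc n))"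
    and h0: "\<And>c. c \<in> carrier (F.F 0) \<Longrightarrow> c = ?jr 0 c \<oplus>\<^bsub>F.F 0\<^esub> dF 0 (h 0 c)"
    and hS: "\<And>n c. c \<in> carrier (F.F (Suc n)) \<Longrightarrow>
      c = ?jr (Suc n) c \<oplus>\<^bsub>F.F (Suc n)\<^esub> h n (dF n c) \<oplus>\<^bsub>F.F (Suc n)\<^esub> dF (Suc n) (h (Suc n) c)"
  proof (rule F.homotopy_exists[of ?jr])
    show "?jr n \<in> lmod_hom S (F.F n) (F.F n)" for n by (rule lmod_hom_compose[OF F.F_lmod r j])
    show "eF (?jr 0 c) = eF c" if "c \<in> carrier (F.F 0)" for c
      using that e_j[OF rc[OF that]] e_r by (simp add: compose_eq)
    show "dF n (?jr (Suc n) c) = ?jr n (dF n c)" if "c \<in> carrier (F.F (Suc n))" for n c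
      using that d_j[OF rc[OF that]] d_r dc by (simp add: compose_eq)
    fix h assume "\<And>n. h n \<in> lmod_hom S (F.F n) (F.F (Suc n))"
      and "\<And>c. c \<in> carrier (F.F 0) \<Longrightarrow> c = ?jr 0 c \<oplus>\<^bsub>F.F 0\<^esub> dF 0 (h 0 c)"
      and "\<And>n c. c \<in> carrier (F.F (Suc n)) \<Longrightarrow>
        c = ?jr (Suc n) c \<oplus>\<^bsub>F.F (Suc n)\<^esub> h n (dF n c) \<oplus>\<^bsub>F.F (Suc n)\<^esub> dF (Suc n) (h (Suc n) c)"
    then show thesis by (rule that)
  qed
  have hc: "h n k \<in> carrier (F.F (Suc n))" if "k \<in> carrier (F.F n)" for n k by (rule lmod_hom_closed[OF h that])
  obtain \<psi> where \<psi>: "\<And>n. \<psi> n \<in> Hom C (D n) (E n)"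
    and \<psi>J: "\<And>n k. k \<in> carrier (free.F n) \<Longrightarrow> \<psi> n \<cdot> J n k = \<phi> n (j n k)"
    and e\<psi>: "eE \<cdot> \<psi> 0 = \<epsilon>" and d\<psi>: "\<And>n. dE n \<cdot> \<psi> (Suc n) = \<psi> n \<cdot> bd n"
    by (rule realization_map_exists[OF j e_j d_j]) blast+
  interpret L: lifting_resolution C B D \<epsilon> bd by (rule realization_lifting)
  obtain \<chi> where \<chi>: "\<And>n. \<chi> n \<in> Hom C (E n) (D n)" and e\<chi>: "\<epsilon> \<cdot> \<chi> 0 = eE"
    and d\<chi>: "\<And>n. bd n \<cdot> \<chi> (Suc n) = \<chi> n \<cdot> dE n"
    by (rule lifting_comparison_exists[OF E.lifting_resolution_axioms L.lifting_resolution_axioms]) blast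
  obtain b where b: "\<And>n. b n \<in> Hom C (D n) (D (Suc n))"
    and b0: "Ident C (D 0) = Add C (\<chi> 0 \<cdot> \<psi> 0) (bd 0 \<cdot> b 0)"
    and bS: "\<And>n. Ident C (D (Suc n)) = Add C (Add C (\<chi> (Suc n) \<cdot> \<psi> (Suc n)) (b n \<cdot> bd n)) (bd (Suc n) \<cdot> b (Suc n))"
  proof (rule L.lifting_homotopy_exists[of "\<lambda>n. \<chi> n \<cdot> \<psi> n"])
    show "\<chi> n \<cdot> \<psi> n \<in> Hom C (D n) (D n)" for n by (rule Comp_Hom[OF \<psi> \<chi>])
    show "\<epsilon> \<cdot> (\<chi> 0 \<cdot> \<psi> 0) = \<epsilon>" using Comp_assoc[OF \<psi> \<chi> \<epsilon>] e\<chi> e\<psi> by simp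
    show "bd n \<cdot> (\<chi> (Suc n) \<cdot> \<psi> (Suc n)) = (\<chi> n \<cdot> \<psi> n) \<cdot> bd n" for n
      using Comp_assoc[OF \<psi> \<chi> bd] d\<chi> Comp_assoc[OF \<psi> E.d \<chi>] d\<psi> Comp_assoc[OF bd \<psi> \<chi>] by simp
    fix b assume "\<And>n. b n \<in> Hom C (D n) (D (Suc n))"
      and "Ident C (D 0) = Add C (\<chi> 0 \<cdot> \<psi> 0) (bd 0 \<cdot> b 0)"
      and "\<And>n. Ident C (D (Suc n)) = Add C (Add C (\<chi> (Suc n) \<cdot> \<psi> (Suc n)) (b n \<cdot> bd n)) (bd (Suc n) \<cdot> b (Suc n))"
    then show thesis by (rule that)
  qed
  obtain ct where ct: "ct \<in> Hom C (D i) Y" and ctJ: "\<And>k. k \<in> carrier (free.F i) \<Longrightarrow> ct \<cdot> J i k = c (j i k)"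
    by (rule realize[OF j ch Y]) blast
  have ct_bd: "ct \<cdot> bd i = Null C (D (Suc i)) Y"
  proof (rule D_eqI_J[OF Comp_Hom[OF bd ct] Null_Hom[OF D_Obj Y]])
    fix k assume k: "k \<in> carrier (free.F (Suc i))"
    have "(ct \<cdot> bd i) \<cdot> J (Suc i) k = c (j i (d2 i k))"
      using Comp_assoc[OF J_Hom[OF k] bd ct] bd_J[OF k] ctJ[OF lmod_hom_closed[OF free.d_hom k]] by simp
    also have "\<dots> = Null C Q Y" using d_j[OF k] cd[OF jc[OF k]] by simp
    finally show "(ct \<cdot> bd i) \<cdot> J (Suc i) k = Null C (D (Suc i)) Y \<cdot> J (Suc i) k"
      using Null_Comp[OF J_Hom[OF k] Y] by simp
  qed
  define f where "f = ct \<cdot> \<chi> i"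
  have f: "f \<in> Hom C (E i) Y" unfolding f_def by (rule Comp_Hom[OF \<chi> ct])
  have fd: "f \<cdot> dE i = Null C (E (Suc i)) Y"
    unfolding f_def using Comp_assoc[OF E.d \<chi> ct] d\<chi>[of i] Comp_assoc[OF \<chi> bd ct] ct_bd Null_Comp[OF \<chi> Y] by simp
  have f\<phi>d: "f \<cdot> \<phi> i (dF i x) = Null C Q Y" if x: "x \<in> carrier (F.F (Suc i))" for x
    using d_\<phi>[OF x] Comp_assoc[OF \<phi>_Hom[OF x] E.d f] fd Null_Comp[OF \<phi>_Hom[OF x] Y] by simp
  have f\<phi>H: "f \<cdot> \<phi> i x \<in> Hom C Q Y" if "x \<in> carrier (F.F i)" for x by (rule Comp_Hom[OF \<phi>_Hom[OF that] f])
  have f_coc: "f \<in> cocycles C E dE Y i" using f fd by (simp add: cocycles_def)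
  have f\<psi>: "(f \<cdot> \<psi> i) \<cdot> J i k = f \<cdot> \<phi> i (j i k)" if "k \<in> carrier (free.F i)" for k
    using Comp_assoc[OF J_Hom[OF that] \<psi> f] \<psi>J[OF that] by simp
  have ct_bdb: "ct \<cdot> (bd i \<cdot> b i) = Null C (D i) Y"
    using Comp_assoc[OF b bd ct] ct_bd Null_Comp[OF b Y] by simp
  have ct_\<chi>\<psi>: "ct \<cdot> (\<chi> i \<cdot> \<psi> i) = f \<cdot> \<psi> i" unfolding f_def by (rule Comp_assoc[OF \<psi> \<chi> ct, symmetric])
  have f\<psi>H: "f \<cdot> \<psi> i \<in> Hom C (D i) Y" by (rule Comp_Hom[OF \<psi> f])
  show ?thesis
  proof (cases i)
    case 0
    have "ct \<cdot> Ident C (D i) = f \<cdot> \<psi> i"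
      using b0 Comp_Add[OF Comp_Hom[OF \<psi> \<chi>] Comp_Hom[OF b bd] ct] ct_bdb ct_\<chi>\<psi> Add_Null(1)[OF f\<psi>H] 0 by simp
    then have ct_f: "ct = f \<cdot> \<psi> i" using Comp_Ident[OF ct] by simp
    have cx: "c x = f \<cdot> \<phi> i x" if x: "x \<in> carrier (F.F i)" for x
    proof -
      have x0: "x \<in> carrier (F.F 0)" using x 0 by simp
      let ?y = "j i (r i x)"
      have y: "?y \<in> carrier (F.F i)" and hx: "h i x \<in> carrier (F.F (Suc i))" using jc rc hc x by blast+
      have dhx: "dF i (h i x) \<in> carrier (F.F i)" using dc[OF hx] .
      have x_eq: "x = ?y \<oplus>\<^bsub>F.F i\<^esub> dF i (h i x)"
      proof -
        have jr: "?jr 0 x = j 0 (r 0 x)" by (rule compose_eq[OF x0])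
        show ?thesis unfolding 0 by (rule h0[OF x0, unfolded jr])
      qed
      have "c x = Add C (c ?y) (c (dF i (h i x)))"
        using arg_cong[OF x_eq, of c] lmod_hom_add[OF ch y dhx] by (simp add: Theta_simps)
      then have "c x = c ?y" using cd[OF hx] Add_Null(1)[OF hom_Y_Hom[OF ch y]] by simp
      moreover have "c ?y = f \<cdot> \<phi> i ?y" using ctJ[OF rc[OF x]] f\<psi>[OF rc[OF x]] ct_f by simp
      moreover have "f \<cdot> \<phi> i x = f \<cdot> \<phi> i ?y"
      proof -
        have "\<phi> i x = Add C (\<phi> i ?y) (\<phi> i (dF i (h i x)))"
          using arg_cong[OF x_eq, of "\<phi> i"] lmod_hom_add[OF \<phi> y dhx] by (simp add: Theta_simps)
        then show ?thesis
          using Comp_Add[OF \<phi>_Hom[OF y] \<phi>_Hom[OF dhx] f] f\<phi>d[OF hx] Add_Null(1)[OF f\<phi>H[OF y]] by simp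
      qed
      ultimately show ?thesis by simp
    qed
    have "lmod_zero (F.F 0) (Theta C Q Y) \<in> lmod_coboundaries S X dF (Theta C Q Y) i" using 0 by simp
    moreover have "\<forall>x \<in> carrier (F.F i). c x = Add C (lmod_zero (F.F 0) (Theta C Q Y) x) (f \<cdot> \<phi> i x)"
    proof
      fix x assume x: "x \<in> carrier (F.F i)"
      then have "lmod_zero (F.F 0) (Theta C Q Y) x = Null C Q Y" using 0 by (simp add: lmod_zero_def Theta_simps)
      then show "c x = Add C (lmod_zero (F.F 0) (Theta C Q Y) x) (f \<cdot> \<phi> i x)"
        using cx[OF x] Add_Null(2)[OF f\<phi>H[OF x]] by simp
    qed
    ultimately show ?thesis using f_coc by blast
  next
    case (Suc m)
    let ?q = "ct \<cdot> b m"
    have ctS: "ct \<in> Hom C (D (Suc m)) Y" using ct Suc by simp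
    have q: "?q \<in> Hom C (D m) Y" by (rule Comp_Hom[OF b ctS])
    have qd: "?q \<cdot> bd m \<in> Hom C (D i) Y" using Comp_Hom[OF bd q] Suc by simp
    have "ct \<cdot> Ident C (D i) = Add C (f \<cdot> \<psi> i) (?q \<cdot> bd m)"
    proof -
      have hs: "\<chi> (Suc m) \<cdot> \<psi> (Suc m) \<in> Hom C (D (Suc m)) (D (Suc m))" "b m \<cdot> bd m \<in> Hom C (D (Suc m)) (D (Suc m))"
        "bd (Suc m) \<cdot> b (Suc m) \<in> Hom C (D (Suc m)) (D (Suc m))"
        by (rule Comp_Hom[OF \<psi> \<chi>] Comp_Hom[OF bd b] Comp_Hom[OF b bd])+
      have "ct \<cdot> Ident C (D (Suc m)) = Add C (Add C (ct \<cdot> (\<chi> (Suc m) \<cdot> \<psi> (Suc m))) (ct \<cdot> (b m \<cdot> bd m)))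
          (ct \<cdot> (bd (Suc m) \<cdot> b (Suc m)))"
        unfolding bS Comp_Add[OF Add_Hom[OF hs(1,2)] hs(3) ctS] Comp_Add[OF hs(1,2) ctS] by (rule refl)
      then show ?thesis
        using ct_bdb ct_\<chi>\<psi> Suc Comp_assoc[OF bd b ctS] Add_Null(1)[OF Add_Hom[OF f\<psi>H qd]] by simp
    qed
    from trans[OF Comp_Ident[OF ct, symmetric] this]
    have ct_f: "ct = Add C (f \<cdot> \<psi> i) (?q \<cdot> bd m)" .
    have cj: "c (j i k) = Add C (f \<cdot> \<phi> i (j i k)) (?q \<cdot> J m (d2 m k))" if k: "k \<in> carrier (free.F i)" for k
    proof -
      have k': "k \<in> carrier (free.F (Suc m))" using k Suc by simp
      have "c (j i k) = ct \<cdot> J i k" using ctJ[OF k] by simp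
      also have "\<dots> = Add C ((f \<cdot> \<psi> i) \<cdot> J i k) ((?q \<cdot> bd m) \<cdot> J i k)"
        using arg_cong[OF ct_f, of "\<lambda>x. x \<cdot> J i k"] unfolding Add_Comp[OF J_Hom[OF k] f\<psi>H qd] .
      also have "(?q \<cdot> bd m) \<cdot> J i k = ?q \<cdot> J m (d2 m k)"
        using Comp_assoc[OF J_Hom[OF k'] bd q] bd_J[OF k'] Suc by simp
      finally show ?thesis unfolding f\<psi>[OF k] .
    qed
    obtain n where n: "n \<in> Hom C (E i) Y" "Add C n f = Null C (E i) Y" using f by (rule Neg_exists)
    have hm: "h m \<in> lmod_hom S (F.F m) (F.F i)" using h[of m] Suc by simp
    \<comment> \<open>The cochain is \<open>ct \<cdot> b \<cdot> J \<circ> r + (c - f \<cdot> \<phi>) \<circ> h\<close>, with the negative \<open>n\<close> of \<open>f\<close>.\<close>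
    define g1 where "g1 = (\<lambda>y\<in>carrier (F.F m). ?q \<cdot> compose (carrier (F.F m)) (J m) (r m) y)"
    define g2 where "g2 = compose (carrier (F.F m)) c (h m)"
    define g3 where "g3 = (\<lambda>y\<in>carrier (F.F m). n \<cdot> compose (carrier (F.F m)) (\<phi> i) (h m) y)"
    have g1: "g1 \<in> lmod_hom S (F.F m) (Theta C Q Y)"
      unfolding g1_def by (rule Theta_comp_hom[OF F.F_lmod Q_Obj q lmod_hom_compose[OF F.F_lmod r J_hom]])
    have g2: "g2 \<in> lmod_hom S (F.F m) (Theta C Q Y)"
      unfolding g2_def by (rule lmod_hom_compose[OF F.F_lmod hm ch])
    have g3: "g3 \<in> lmod_hom S (F.F m) (Theta C Q Y)"
      unfolding g3_def by (rule Theta_comp_hom[OF F.F_lmod Q_Obj n(1) lmod_hom_compose[OF F.F_lmod hm \<phi>]])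
    let ?g = "\<lambda>y\<in>carrier (F.F m). g1 y \<oplus>\<^bsub>Theta C Q Y\<^esub> (\<lambda>y\<in>carrier (F.F m). g2 y \<oplus>\<^bsub>Theta C Q Y\<^esub> g3 y) y"
    have g: "?g \<in> lmod_hom S (F.F m) (Theta C Q Y)"
      by (rule lmod_hom_sum[OF F.F_lmod Theta_Y g1 lmod_hom_sum[OF F.F_lmod Theta_Y g2 g3]])
    have gy: "?g y = Add C (?q \<cdot> J m (r m y)) (Add C (c (h m y)) (n \<cdot> \<phi> i (h m y)))"
      if "y \<in> carrier (F.F m)" for y
      using that by (simp add: g1_def g2_def g3_def compose_eq Theta_simps)
    let ?gd = "compose (carrier (F.F (Suc m))) ?g (dF m)"
    have gd: "?gd \<in> lmod_coboundaries S X dF (Theta C Q Y) i" using g Suc by auto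
    have "c x = Add C (?gd x) (f \<cdot> \<phi> i x)" if x: "x \<in> carrier (F.F i)" for x
    proof -
      have x': "x \<in> carrier (F.F (Suc m))" using x Suc by simp
      have dx: "dF m x \<in> carrier (F.F m)" using dc[OF x'] .
      let ?y = "j i (r i x)" and ?z = "h m (dF m x)" and ?w = "dF i (h i x)"
      have y: "?y \<in> carrier (F.F i)" and hx: "h i x \<in> carrier (F.F (Suc i))" using jc rc hc x by blast+
      have z: "?z \<in> carrier (F.F i)" using hc[OF dx] Suc by simp
      have w: "?w \<in> carrier (F.F i)" using dc[OF hx] .
      have yz: "?y \<oplus>\<^bsub>F.F i\<^esub> ?z \<in> carrier (F.F i)"
      proof -
        interpret Fi: lmod S "F.F i" by (rule F.F_lmod)
        show ?thesis using y z by (rule Fi.M.a_closed)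
      qed
      have x_eq: "x = ?y \<oplus>\<^bsub>F.F i\<^esub> ?z \<oplus>\<^bsub>F.F i\<^esub> ?w"
      proof -
        have jr: "?jr (Suc m) x = j (Suc m) (r (Suc m) x)" by (rule compose_eq[OF x'])
        show ?thesis unfolding Suc by (rule hS[OF x', unfolded jr])
      qed
      have cx: "c x = Add C (c ?y) (c ?z)"
      proof -
        have "c x = Add C (Add C (c ?y) (c ?z)) (c ?w)"
          using arg_cong[OF x_eq, of c] lmod_hom_add[OF ch yz w] lmod_hom_add[OF ch y z] by (simp add: Theta_simps)
        then show ?thesis
          using cd[OF hx] Add_Null(1)[OF Add_Hom[OF hom_Y_Hom[OF ch y] hom_Y_Hom[OF ch z]]] by simp
      qed
      have fx: "f \<cdot> \<phi> i x = Add C (f \<cdot> \<phi> i ?y) (f \<cdot> \<phi> i ?z)"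
      proof -
        have "\<phi> i x = Add C (Add C (\<phi> i ?y) (\<phi> i ?z)) (\<phi> i ?w)"
          using arg_cong[OF x_eq, of "\<phi> i"] lmod_hom_add[OF \<phi> yz w] lmod_hom_add[OF \<phi> y z] by (simp add: Theta_simps)
        then show ?thesis
          using Comp_Add[OF Add_Hom[OF \<phi>_Hom[OF y] \<phi>_Hom[OF z]] \<phi>_Hom[OF w] f] Comp_Add[OF \<phi>_Hom[OF y] \<phi>_Hom[OF z] f]
            f\<phi>d[OF hx] Add_Null(1)[OF Add_Hom[OF f\<phi>H[OF y] f\<phi>H[OF z]]] by simp
      qed
      have nf: "Add C (n \<cdot> \<phi> i ?z) (f \<cdot> \<phi> i ?z) = Null C Q Y"
        using Add_Comp[OF \<phi>_Hom[OF z] n(1) f] n(2) Null_Comp[OF \<phi>_Hom[OF z] Y] by simp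
      have d2r: "d2 m (r i x) = r m (dF m x)" using d_r[OF x'] Suc by simp
      have qH: "?q \<cdot> J m (r m (dF m x)) \<in> Hom C Q Y" by (rule Comp_Hom[OF J_Hom[OF rc[OF dx]] q])
      have "Add C (?gd x) (f \<cdot> \<phi> i x) = Add C (Add C (?q \<cdot> J m (r m (dF m x))) (f \<cdot> \<phi> i ?y)) (c ?z)"
        unfolding compose_eq[OF x'] gy[OF dx] fx
        by (rule Add_rearrange[OF qH hom_Y_Hom[OF ch z] f\<phi>H[OF y] Comp_Hom[OF \<phi>_Hom[OF z] n(1)] f\<phi>H[OF z] nf])
      also have "Add C (?q \<cdot> J m (r m (dF m x))) (f \<cdot> \<phi> i ?y) = c ?y"
        using cj[OF rc[OF x]] d2r Add_comm[OF f\<phi>H[OF y] qH] by simp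
      finally show ?thesis unfolding cx by (rule sym)
    qed
    then show ?thesis using f_coc gd by blast
  qed
qed

text \<open>
  Restricted along \<open>j\<close>, the equation says that \<open>f \<cdot> \<psi>\<close> is a coboundary on \<open>D\<close>. Then so is
  \<open>f \<cdot> \<psi> \<cdot> \<chi>\<close> on \<open>E\<close>, and it differs from \<open>f\<close> by a coboundary, by the homotopy \<open>a\<close> between the
  identity and \<open>\<psi> \<cdot> \<chi>\<close>.
\<close>

lemma cocycle_bounds:
  assumes f: "f \<in> cocycles C E dE Y i" and g: "g \<in> lmod_coboundaries S X dF (Theta C Q Y) i"
    and fg: "\<And>x. x \<in> carrier (F.F i) \<Longrightarrow> f \<cdot> \<phi> i x = g x"
  shows "f \<in> coboundaries C E dE Y i"
proof -
  have fH: "f \<in> Hom C (E i) Y" and fd: "f \<cdot> dE i = Null C (E (Suc i)) Y" using f by (simp_all add: cocycles_def)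
  obtain j where j: "\<And>n. j n \<in> lmod_hom S (free.F n) (F.F n)"
    and e_j: "\<And>c. c \<in> carrier (free.F 0) \<Longrightarrow> eF (j 0 c) = e2 c"
    and d_j: "\<And>n c. c \<in> carrier (free.F (Suc n)) \<Longrightarrow> dF n (j (Suc n) c) = j n (d2 n c)"
    by (rule free_comparison_exists[OF free.free_res_axioms F.free_res_axioms]) blast
  have jc: "j n k \<in> carrier (F.F n)" if "k \<in> carrier (free.F n)" for n k by (rule lmod_hom_closed[OF j that])
  obtain \<psi> where \<psi>: "\<And>n. \<psi> n \<in> Hom C (D n) (E n)"
    and \<psi>J: "\<And>n k. k \<in> carrier (free.F n) \<Longrightarrow> \<psi> n \<cdot> J n k = \<phi> n (j n k)"
    and e\<psi>: "eE \<cdot> \<psi> 0 = \<epsilon>" and d\<psi>: "\<And>n. dE n \<cdot> \<psi> (Suc n) = \<psi> n \<cdot> bd n"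
    by (rule realization_map_exists[OF j e_j d_j]) blast+
  interpret L: lifting_resolution C B D \<epsilon> bd by (rule realization_lifting)
  obtain \<chi> where \<chi>: "\<And>n. \<chi> n \<in> Hom C (E n) (D n)" and e\<chi>: "\<epsilon> \<cdot> \<chi> 0 = eE"
    and d\<chi>: "\<And>n. bd n \<cdot> \<chi> (Suc n) = \<chi> n \<cdot> dE n"
    by (rule lifting_comparison_exists[OF E.lifting_resolution_axioms L.lifting_resolution_axioms]) blast
  obtain a where a: "\<And>n. a n \<in> Hom C (E n) (E (Suc n))"
    and a0: "Ident C (E 0) = Add C (\<psi> 0 \<cdot> \<chi> 0) (dE 0 \<cdot> a 0)"
    and aS: "\<And>n. Ident C (E (Suc n)) = Add C (Add C (\<psi> (Suc n) \<cdot> \<chi> (Suc n)) (a n \<cdot> dE n)) (dE (Suc n) \<cdot> a (Suc n))"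
  proof (rule E.lifting_homotopy_exists[of "\<lambda>n. \<psi> n \<cdot> \<chi> n"])
    show "\<psi> n \<cdot> \<chi> n \<in> Hom C (E n) (E n)" for n by (rule Comp_Hom[OF \<chi> \<psi>])
    show "eE \<cdot> (\<psi> 0 \<cdot> \<chi> 0) = eE" using Comp_assoc[OF \<chi> \<psi> E.e] e\<chi> e\<psi> by simp
    show "dE n \<cdot> (\<psi> (Suc n) \<cdot> \<chi> (Suc n)) = (\<psi> n \<cdot> \<chi> n) \<cdot> dE n" for n
      using Comp_assoc[OF \<chi> \<psi> E.d] d\<chi> Comp_assoc[OF \<chi> bd \<psi>] d\<psi> Comp_assoc[OF E.d \<chi> \<psi>] by simp
    fix a assume "\<And>n. a n \<in> Hom C (E n) (E (Suc n))"
      and "Ident C (E 0) = Add C (\<psi> 0 \<cdot> \<chi> 0) (dE 0 \<cdot> a 0)"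
      and "\<And>n. Ident C (E (Suc n)) = Add C (Add C (\<psi> (Suc n) \<cdot> \<chi> (Suc n)) (a n \<cdot> dE n)) (dE (Suc n) \<cdot> a (Suc n))"
    then show thesis by (rule that)
  qed
  have fda: "f \<cdot> (dE i \<cdot> a i) = Null C (E i) Y"
    using Comp_assoc[OF a E.d fH] fd Null_Comp[OF a Y] by simp
  have f\<psi>J: "(f \<cdot> \<psi> i) \<cdot> J i k = g (j i k)" if "k \<in> carrier (free.F i)" for k
    using Comp_assoc[OF J_Hom[OF that] \<psi> fH] \<psi>J[OF that] fg[OF jc[OF that]] by simp
  have f\<psi>H: "f \<cdot> \<psi> i \<in> Hom C (D i) Y" by (rule Comp_Hom[OF \<psi> fH])
  have f\<psi>\<chi>: "f \<cdot> (\<psi> i \<cdot> \<chi> i) = (f \<cdot> \<psi> i) \<cdot> \<chi> i" by (rule Comp_assoc[OF \<chi> \<psi> fH, symmetric])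
  show ?thesis
  proof (cases i)
    case 0
    have g0: "g = lmod_zero (F.F 0) (Theta C Q Y)" using g 0 by simp
    have "f \<cdot> \<psi> i = Null C (D i) Y"
    proof (rule D_eqI_J[OF f\<psi>H Null_Hom[OF D_Obj Y]])
      fix k assume k: "k \<in> carrier (free.F i)"
      have "g (j i k) = Null C Q Y" unfolding g0 using jc[OF k] 0 by (simp add: lmod_zero_def Theta_simps)
      then show "(f \<cdot> \<psi> i) \<cdot> J i k = Null C (D i) Y \<cdot> J i k" using f\<psi>J[OF k] Null_Comp[OF J_Hom[OF k] Y] by simp
    qed
    then have "f \<cdot> (\<psi> i \<cdot> \<chi> i) = Null C (E i) Y" using f\<psi>\<chi> Null_Comp[OF \<chi> Y] by simp
    moreover have "f \<cdot> Ident C (E i) = Add C (f \<cdot> (\<psi> i \<cdot> \<chi> i)) (f \<cdot> (dE i \<cdot> a i))"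
      using Comp_Add[OF Comp_Hom[OF \<chi> \<psi>] Comp_Hom[OF a E.d] fH] a0 0 by simp
    ultimately have "f = Null C (E i) Y"
      using fda Comp_Ident[OF fH] Add_Null(1)[OF Null_Hom[OF E.E_Obj Y]] by simp
    then show ?thesis using 0 by simp
  next
    case (Suc m)
    obtain g' where g': "g' \<in> lmod_hom S (F.F m) (Theta C Q Y)" and gg': "g = compose (carrier (F.F (Suc m))) g' (dF m)"
      using g Suc by auto
    obtain gt where gt: "gt \<in> Hom C (D m) Y" and gtJ: "\<And>k. k \<in> carrier (free.F m) \<Longrightarrow> gt \<cdot> J m k = g' (j m k)"
      by (rule realize[OF j g' Y]) blast
    have fS: "f \<in> Hom C (E (Suc m)) Y" using fH Suc by simp
    have f\<psi>: "f \<cdot> \<psi> (Suc m) = gt \<cdot> bd m"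
    proof (rule D_eqI_J[OF Comp_Hom[OF \<psi> fS] Comp_Hom[OF bd gt]])
      fix k assume k: "k \<in> carrier (free.F (Suc m))"
      have "(f \<cdot> \<psi> (Suc m)) \<cdot> J (Suc m) k = g' (j m (d2 m k))"
        using f\<psi>J[of k] k Suc gg' compose_eq[OF jc[OF k], of g' "dF m"] d_j[OF k] by simp
      also have "\<dots> = (gt \<cdot> bd m) \<cdot> J (Suc m) k"
        using Comp_assoc[OF J_Hom[OF k] bd gt] bd_J[OF k] gtJ[OF lmod_hom_closed[OF free.d_hom k]] by simp
      finally show "(f \<cdot> \<psi> (Suc m)) \<cdot> J (Suc m) k = (gt \<cdot> bd m) \<cdot> J (Suc m) k" .
    qed
    have hs: "\<psi> (Suc m) \<cdot> \<chi> (Suc m) \<in> Hom C (E (Suc m)) (E (Suc m))" "a m \<cdot> dE m \<in> Hom C (E (Suc m)) (E (Suc m))"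
      "dE (Suc m) \<cdot> a (Suc m) \<in> Hom C (E (Suc m)) (E (Suc m))"
      by (rule Comp_Hom[OF \<chi> \<psi>] Comp_Hom[OF E.d a] Comp_Hom[OF a E.d])+
    have "f \<cdot> Ident C (E (Suc m)) = Add C (Add C (f \<cdot> (\<psi> (Suc m) \<cdot> \<chi> (Suc m))) (f \<cdot> (a m \<cdot> dE m))) (f \<cdot> (dE (Suc m) \<cdot> a (Suc m)))"
      unfolding aS Comp_Add[OF Add_Hom[OF hs(1,2)] hs(3) fS] Comp_Add[OF hs(1,2) fS] by (rule refl)
    then have "f = Add C (f \<cdot> (\<psi> (Suc m) \<cdot> \<chi> (Suc m))) (f \<cdot> (a m \<cdot> dE m))"
      using fda Suc Comp_Ident[OF fS] Add_Null(1)[OF Add_Hom[OF Comp_Hom[OF hs(1) fS] Comp_Hom[OF hs(2) fS]]] by simp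
    also have "f \<cdot> (\<psi> (Suc m) \<cdot> \<chi> (Suc m)) = (gt \<cdot> \<chi> m) \<cdot> dE m"
      using Comp_assoc[OF \<chi> \<psi> fS] f\<psi> Comp_assoc[OF \<chi> bd gt] d\<chi> Comp_assoc[OF E.d \<chi> gt] by simp
    also have "f \<cdot> (a m \<cdot> dE m) = (f \<cdot> a m) \<cdot> dE m" by (rule Comp_assoc[OF E.d a fS, symmetric])
    also have "Add C ((gt \<cdot> \<chi> m) \<cdot> dE m) ((f \<cdot> a m) \<cdot> dE m) = Add C (gt \<cdot> \<chi> m) (f \<cdot> a m) \<cdot> dE m"
      by (rule Add_Comp[OF E.d Comp_Hom[OF \<chi> gt] Comp_Hom[OF a fS], symmetric])
    finally have "f = Add C (gt \<cdot> \<chi> m) (f \<cdot> a m) \<cdot> dE m" .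
    moreover have "Add C (gt \<cdot> \<chi> m) (f \<cdot> a m) \<in> Hom C (E m) Y"
      by (rule Add_Hom[OF Comp_Hom[OF \<chi> gt] Comp_Hom[OF a fS]])
    ultimately show ?thesis using Suc by auto
  qed
qed

end

lemma kernel_image_subgroups:
  assumes "comm_group G" "comm_group H" "h \<in> hom G H"
  shows "subgroup {x \<in> carrier G. h x = \<one>\<^bsub>H\<^esub>} G" "subgroup (h ` carrier G) H"
proof -
  interpret group_hom G H h
    using assms by (intro group_hom.intro group_hom_axioms.intro comm_group.axioms(2))
  show "subgroup {x \<in> carrier G. h x = \<one>\<^bsub>H\<^esub>} G" using subgroup_kernel by (simp add: kernel_def)
  show "subgroup (h ` carrier G) H" by (rule img_is_subgroup)
qed

lemma subgroup_comm_group: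
  assumes "comm_group G" "subgroup A G"
  shows "comm_group (G\<lparr>carrier := A\<rparr>)"
proof -
  interpret G: comm_group G by fact
  have "group (G\<lparr>carrier := A\<rparr>)" by (rule subgroup.subgroup_is_group[OF assms(2) G.group_axioms])
  moreover have "x \<otimes>\<^bsub>G\<^esub> y = y \<otimes>\<^bsub>G\<^esub> x" if "x \<in> A" "y \<in> A" for x y
    using that subgroup.mem_carrier[OF assms(2)] G.m_comm by blast
  ultimately show ?thesis by (intro group.group_comm_groupI) simp_all
qed

lemma (in lifting_resolution) cocycle_subgroups:
  assumes Y: "Y \<in> Obj C"
  shows "subgroup (cocycles C E d Y i) (hom_group C (E i) Y)"
    and "subgroup (coboundaries C E d Y i) (hom_group C (E i) Y)"
    and "coboundaries C E d Y i \<subseteq> cocycles C E d Y i"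
proof -
  have G: "comm_group (hom_group C (E n) Y)" for n by (rule hom_comm_group[OF E_Obj Y])
  have h: "(\<lambda>f. f \<cdot> d n) \<in> hom (hom_group C (E n) Y) (hom_group C (E (Suc n)) Y)" for n
    by (rule homI) (use Comp_Hom[OF d] Add_Comp[OF d] in auto)
  show "subgroup (cocycles C E d Y i) (hom_group C (E i) Y)"
    using kernel_image_subgroups(1)[OF G G h[of i]] by (simp add: cocycles_def)
  show "subgroup (coboundaries C E d Y i) (hom_group C (E i) Y)"
  proof (cases i)
    case 0
    then show ?thesis using group.triv_subgroup[OF comm_group.axioms(2)[OF G[of 0]]] by simp
  next
    case (Suc n)
    have "coboundaries C E d Y (Suc n) = (\<lambda>f. f \<cdot> d n) ` carrier (hom_group C (E n) Y)" by auto
    then show ?thesis using kernel_image_subgroups(2)[OF G G h[of n]] Suc by simp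
  qed
  show "coboundaries C E d Y i \<subseteq> cocycles C E d Y i"
  proof
    fix f assume f: "f \<in> coboundaries C E d Y i"
    show "f \<in> cocycles C E d Y i"
    proof (cases i)
      case 0
      then show ?thesis using f Null_Hom[OF E_Obj Y] Null_Comp[OF d Y] by (simp add: cocycles_def)
    next
      case (Suc n)
      then obtain g where g: "g \<in> Hom C (E n) Y" "f = g \<cdot> d n" using f by auto
      show ?thesis unfolding Suc g(2) cocycles_def
        using Comp_Hom[OF d g(1)] Comp_assoc[OF d d g(1)] d_d Comp_Null[OF g(1) E_Obj] by simp
    qed
  qed
qed

lemma (in free_res) cocycle_subgroups:
  assumes N: "lmod R N"
  shows "subgroup (lmod_cocycles R X d N i) (lmod_hom_group R (F i) N)"
    and "subgroup (lmod_coboundaries R X d N i) (lmod_hom_group R (F i) N)"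
    and "lmod_coboundaries R X d N i \<subseteq> lmod_cocycles R X d N i"
proof -
  interpret N: lmod R N by fact
  have G: "comm_group (lmod_hom_group R (F n) N)" for n by (rule lmod_hom_group_comm[OF F_lmod N])
  have car: "carrier (lmod_hom_group R (F n) N) = lmod_hom R (F n) N" for n by (simp add: lmod_hom_group_def)
  let ?h = "\<lambda>n f. compose (carrier (F (Suc n))) f (d n)"
  have h: "?h n \<in> hom (lmod_hom_group R (F n) N) (lmod_hom_group R (F (Suc n)) N)" for n
  proof (rule homI)
    fix f assume "f \<in> carrier (lmod_hom_group R (F n) N)"
    then show "?h n f \<in> carrier (lmod_hom_group R (F (Suc n)) N)"
      unfolding car by (rule lmod_hom_compose[OF F_lmod d_hom])
  next
    fix f g
    show "?h n (f \<otimes>\<^bsub>lmod_hom_group R (F n) N\<^esub> g) = ?h n f \<otimes>\<^bsub>lmod_hom_group R (F (Suc n)) N\<^esub> ?h n g"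
      using lmod_hom_closed[OF d_hom] by (auto simp: lmod_hom_group_def compose_def)
  qed
  show "subgroup (lmod_cocycles R X d N i) (lmod_hom_group R (F i) N)"
    using kernel_image_subgroups(1)[OF G G h[of i]] by (simp add: lmod_cocycles_def lmod_hom_group_def)
  show "subgroup (lmod_coboundaries R X d N i) (lmod_hom_group R (F i) N)"
  proof (cases i)
    case 0
    then show ?thesis
      using group.triv_subgroup[OF comm_group.axioms(2)[OF G[of 0]]] by (simp add: lmod_hom_group_def)
  next
    case (Suc n)
    have "lmod_coboundaries R X d N (Suc n) = ?h n ` carrier (lmod_hom_group R (F n) N)" unfolding car by auto
    then show ?thesis using kernel_image_subgroups(2)[OF G G h[of n]] Suc by simp
  qed
  show "lmod_coboundaries R X d N i \<subseteq> lmod_cocycles R X d N i"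
  proof
    fix f assume f: "f \<in> lmod_coboundaries R X d N i"
    have f_hom: "f \<in> lmod_hom R (F i) N"
      using subgroup.subset[OF \<open>subgroup (lmod_coboundaries R X d N i) (lmod_hom_group R (F i) N)\<close>] f car by auto
    have fd: "f (d i x) = \<zero>\<^bsub>N\<^esub>" if x: "x \<in> carrier (F (Suc i))" for x
    proof (cases i)
      case 0
      then show ?thesis using f lmod_hom_closed[OF d_hom x] by (simp add: lmod_zero_def)
    next
      case (Suc n)
      then obtain g where g: "g \<in> lmod_hom R (F n) N" "f = ?h n g" using f by auto
      have x': "x \<in> carrier (F (Suc (Suc n)))" using x Suc by simp
      have "f (d i x) = g (d n (d (Suc n) x))"
        unfolding g(2) Suc by (rule compose_eq[OF lmod_hom_closed[OF d_hom x']])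
      then show ?thesis using d_d[OF x'] lmod_hom_zero[OF F_lmod N g(1)] by simp
    qed
    then have "compose (carrier (F (Suc i))) f (d i) = lmod_zero (F (Suc i)) N"
      by (auto simp: compose_def lmod_zero_def)
    then show "f \<in> lmod_cocycles R X d N i" using f_hom by (simp add: lmod_cocycles_def)
  qed
qed

lemma (in Ext_comparison) Ext_map_iso:
  "Ext_map C Q X dF \<phi> Y i \<in> iso (Ext_group C E dE Y i) (lmod_Ext_group S X dF (Theta C Q Y) i)"
proof -
  let ?N = "Theta C Q Y"
  let ?HG = "hom_group C (E i) Y" and ?HH = "lmod_hom_group S (F.F i) ?N"
  let ?G = "?HG\<lparr>carrier := cocycles C E dE Y i\<rparr>" and ?H = "?HH\<lparr>carrier := lmod_cocycles S X dF ?N i\<rparr>"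
  let ?A = "coboundaries C E dE Y i" and ?B = "lmod_coboundaries S X dF ?N i"
  let ?\<Phi> = "\<lambda>f. compose (carrier (F.F i)) (Theta_arr C Q f) (\<phi> i)"
  note subE = E.cocycle_subgroups[OF Y, of i] and subF = F.cocycle_subgroups[OF Theta_Y, of i]
  have HG: "comm_group ?HG" by (rule hom_comm_group[OF E.E_Obj Y])
  have HH: "comm_group ?HH" by (rule lmod_hom_group_comm[OF F.F_lmod Theta_Y])
  have \<Phi>: "?\<Phi> f x = f \<cdot> \<phi> i x" if "f \<in> Hom C (E i) Y" "x \<in> carrier (F.F i)" for f x
    unfolding compose_eq[OF that(2)] by (rule Theta_arr_apply[OF that(1) \<phi>_Hom[OF that(2)]])
  have \<Phi>_hom: "?\<Phi> f \<in> lmod_hom S (F.F i) ?N" if "f \<in> Hom C (E i) Y" for f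
    by (rule lmod_hom_compose[OF F.F_lmod \<phi> Theta_arr_hom[OF Q_Obj that]])
  have cocH: "f \<in> Hom C (E i) Y" "f \<cdot> dE i = Null C (E (Suc i)) Y" if "f \<in> cocycles C E dE Y i" for f
    using that by (simp_all add: cocycles_def)
  have cocF: "c \<in> lmod_hom S (F.F i) ?N" if "c \<in> lmod_cocycles S X dF ?N i" for c
    using that by (simp add: lmod_cocycles_def)
  have ext: "c = c'" if "c \<in> lmod_hom S (F.F i) ?N" "c' \<in> lmod_hom S (F.F i) ?N"
    "\<And>x. x \<in> carrier (F.F i) \<Longrightarrow> c x = c' x" for c c'
    using that by (auto simp: lmod_hom_def intro: PiE_ext)
  have \<Phi>_coc: "?\<Phi> f \<in> lmod_cocycles S X dF ?N i" if f: "f \<in> cocycles C E dE Y i" for f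
  proof -
    have "?\<Phi> f (dF i x) = Null C Q Y" if x: "x \<in> carrier (F.F (Suc i))" for x
      unfolding \<Phi>[OF cocH(1)[OF f] lmod_hom_closed[OF F.d_hom x]] d_\<phi>[OF x, symmetric]
      using Comp_assoc[OF \<phi>_Hom[OF x] E.d cocH(1)[OF f]] cocH(2)[OF f] Null_Comp[OF \<phi>_Hom[OF x] Y] by simp
    then have "compose (carrier (F.F (Suc i))) (?\<Phi> f) (dF i) = lmod_zero (F.F (Suc i)) ?N"
      unfolding compose_def[of "carrier (F.F (Suc i))"] lmod_zero_def
      by (intro restrict_ext) (simp add: Theta_simps)
    then show ?thesis using \<Phi>_hom[OF cocH(1)[OF f]] by (simp add: lmod_cocycles_def)
  qed
  have "(\<lambda>K. ?B <#>\<^bsub>?H\<^esub> ?\<Phi> ` K) \<in> iso (?G Mod ?A) (?H Mod ?B)"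
  proof (rule quotient_iso)
    show "comm_group ?G" by (rule subgroup_comm_group[OF HG subE(1)])
    show "comm_group ?H" by (rule subgroup_comm_group[OF HH subF(1)])
    show "subgroup ?A ?G" by (rule group.subgroup_incl[OF comm_group.axioms(2)[OF HG] subE(2,1,3)])
    show "subgroup ?B ?H" by (rule group.subgroup_incl[OF comm_group.axioms(2)[OF HH] subF(2,1,3)])
    show "?\<Phi> \<in> hom ?G ?H"
    proof (rule homI)
      show "?\<Phi> f \<in> carrier ?H" if "f \<in> carrier ?G" for f using \<Phi>_coc that by simp
      fix f g assume "f \<in> carrier ?G" "g \<in> carrier ?G"
      then have fg: "f \<in> Hom C (E i) Y" "g \<in> Hom C (E i) Y" using cocH by simp_all
      have "?\<Phi> (Add C f g) = (\<lambda>x\<in>carrier (F.F i). ?\<Phi> f x \<oplus>\<^bsub>?N\<^esub> ?\<Phi> g x)"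
      proof (rule ext[OF \<Phi>_hom[OF Add_Hom[OF fg]] lmod_hom_sum[OF F.F_lmod Theta_Y \<Phi>_hom[OF fg(1)] \<Phi>_hom[OF fg(2)]]])
        fix x assume x: "x \<in> carrier (F.F i)"
        have "(\<lambda>x\<in>carrier (F.F i). ?\<Phi> f x \<oplus>\<^bsub>?N\<^esub> ?\<Phi> g x) x = Add C (?\<Phi> f x) (?\<Phi> g x)"
          using x by (simp add: Theta_simps)
        then show "?\<Phi> (Add C f g) x = (\<lambda>x\<in>carrier (F.F i). ?\<Phi> f x \<oplus>\<^bsub>?N\<^esub> ?\<Phi> g x) x"
          unfolding \<Phi>[OF fg(1) x] \<Phi>[OF fg(2) x] \<Phi>[OF Add_Hom[OF fg] x] Add_Comp[OF \<phi>_Hom[OF x] fg] by (rule sym)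
      qed
      then show "?\<Phi> (f \<otimes>\<^bsub>?G\<^esub> g) = ?\<Phi> f \<otimes>\<^bsub>?H\<^esub> ?\<Phi> g" by (simp add: lmod_hom_group_def)
    qed
    show "?\<Phi> ` ?A \<subseteq> ?B"
    proof (rule image_subsetI)
      fix f assume f: "f \<in> ?A"
      show "?\<Phi> f \<in> ?B"
      proof (cases i)
        case 0
        have "?\<Phi> f = lmod_zero (F.F i) ?N"
          unfolding lmod_zero_def compose_def
          using f 0 Theta_arr_apply[OF Null_Hom[OF E.E_Obj Y] \<phi>_Hom] Null_Comp[OF \<phi>_Hom Y]
          by (intro restrict_ext) (simp add: Theta_simps)
        then show ?thesis using 0 by simp
      next
        case (Suc m)
        then obtain g where g: "g \<in> Hom C (E m) Y" "f = g \<cdot> dE m" using f by auto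
        let ?g = "compose (carrier (F.F m)) (Theta_arr C Q g) (\<phi> m)"
        have gh: "?g \<in> lmod_hom S (F.F m) ?N" by (rule lmod_hom_compose[OF F.F_lmod \<phi> Theta_arr_hom[OF Q_Obj g(1)]])
        have fH: "f \<in> Hom C (E i) Y" unfolding g(2) Suc by (rule Comp_Hom[OF E.d g(1)])
        have eq: "?\<Phi> f = compose (carrier (F.F (Suc m))) ?g (dF m)"
        proof (rule ext[OF \<Phi>_hom[OF fH]])
          show "compose (carrier (F.F (Suc m))) ?g (dF m) \<in> lmod_hom S (F.F i) ?N"
            unfolding Suc by (rule lmod_hom_compose[OF F.F_lmod F.d_hom gh])
          fix x assume x: "x \<in> carrier (F.F i)"
          have x': "x \<in> carrier (F.F (Suc m))" using x Suc by simp
          have dx: "dF m x \<in> carrier (F.F m)" by (rule lmod_hom_closed[OF F.d_hom x'])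
          have "?\<Phi> f x = g \<cdot> (dE m \<cdot> \<phi> (Suc m) x)"
            unfolding \<Phi>[OF fH x] unfolding g(2) Suc by (rule Comp_assoc[OF \<phi>_Hom[OF x'] E.d g(1)])
          also have "\<dots> = compose (carrier (F.F (Suc m))) ?g (dF m) x"
            unfolding d_\<phi>[OF x'] compose_eq[OF x'] compose_eq[OF dx] Theta_arr_apply[OF g(1) \<phi>_Hom[OF dx]] by (rule refl)
          finally show "?\<Phi> f x = compose (carrier (F.F (Suc m))) ?g (dF m) x" .
        qed
        have "compose (carrier (F.F (Suc m))) ?g (dF m) \<in> lmod_coboundaries S X dF ?N (Suc m)" using gh by auto
        then show ?thesis unfolding eq using Suc by simp
      qed
    qed
    show "\<exists>f \<in> carrier ?G. \<exists>g \<in> ?B. c = g \<otimes>\<^bsub>?H\<^esub> ?\<Phi> f" if "c \<in> carrier ?H" for c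
    proof -
      have c: "c \<in> lmod_cocycles S X dF ?N i" using that by simp
      obtain f g where f: "f \<in> cocycles C E dE Y i" and g: "g \<in> ?B"
        and cfg: "\<And>x. x \<in> carrier (F.F i) \<Longrightarrow> c x = Add C (g x) (f \<cdot> \<phi> i x)"
        using cocycle_lift[OF c] by blast
      have gh: "g \<in> lmod_hom S (F.F i) ?N" using cocF subF(3) g by blast
      note fH = \<Phi>_hom[OF cocH(1)[OF f]]
      have "c = (\<lambda>x\<in>carrier (F.F i). g x \<oplus>\<^bsub>?N\<^esub> ?\<Phi> f x)"
      proof (rule ext[OF cocF[OF c] lmod_hom_sum[OF F.F_lmod Theta_Y gh fH]])
        fix x assume x: "x \<in> carrier (F.F i)"
        have "(\<lambda>x\<in>carrier (F.F i). g x \<oplus>\<^bsub>?N\<^esub> ?\<Phi> f x) x = Add C (g x) (?\<Phi> f x)" using x by (simp add: Theta_simps)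
        then show "c x = (\<lambda>x\<in>carrier (F.F i). g x \<oplus>\<^bsub>?N\<^esub> ?\<Phi> f x) x"
          unfolding \<Phi>[OF cocH(1)[OF f] x] cfg[OF x] by (rule sym)
      qed
      then have "c = g \<otimes>\<^bsub>?H\<^esub> ?\<Phi> f" by (simp add: lmod_hom_group_def)
      then show ?thesis using f g by (intro bexI) simp_all
    qed
    show "f \<in> ?A" if "f \<in> carrier ?G" "?\<Phi> f \<in> ?B" for f
    proof -
      have f: "f \<in> cocycles C E dE Y i" using that(1) by simp
      show ?thesis by (rule cocycle_bounds[OF f that(2)]) (rule \<Phi>[OF cocH(1)[OF f], symmetric])
    qed
  qed
  moreover have "Ext_map C Q X dF \<phi> Y i = (\<lambda>K. ?B <#>\<^bsub>?H\<^esub> ?\<Phi> ` K)"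
    by (rule HOL.ext) (simp add: Ext_map_def Let_def set_mult_def)
  ultimately show ?thesis by (simp add: Ext_group_def lmod_Ext_group_def)
qed

lemma (in power_generator) Q_good: "good C Q"
  unfolding good_def n_good_def
proof (intro allI ballI impI, elim conjE)
  let ?S = "End_op C Q"
  fix n B Y i E eE dE and X :: "nat \<Rightarrow> 'a list set" and eF dF \<phi>
  assume B: "B \<in> Obj C" and Y: "Y \<in> Obj C" and E: "projective_resolution C B E eE dE"
    and F: "free_resolution ?S (Theta C Q B) X eF dF" and cmp: "comparison_map C Q E eE dE X eF dF \<phi>"
  interpret E: lifting_resolution C B E eE dE using E by (rule projective_resolution_lifting)
  interpret F: free_res ?S "Theta C Q B" X eF dF
    by (rule free_res.intro[OF Theta_lmod[OF Q_Obj B] F])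
  have \<phi>: "\<And>n. \<phi> n \<in> lmod_hom ?S (F.F n) (Theta C Q (E n))"
    and e\<phi>: "compose (carrier (F.F 0)) (Theta_arr C Q eE) (\<phi> 0) = eF"
    and d\<phi>: "\<And>n. compose (carrier (F.F (Suc n))) (Theta_arr C Q (dE n)) (\<phi> (Suc n)) =
      compose (carrier (F.F (Suc n))) (\<phi> n) (dF n)"
    using cmp by (simp_all add: comparison_map_def Let_def)
  have \<phi>H: "\<phi> n c \<in> Hom C Q (E n)" if "c \<in> carrier (F.F n)" for n c
    using lmod_hom_closed[OF \<phi> that] by (simp add: Theta_simps)
  obtain X2 :: "nat \<Rightarrow> 'u set" and e2 d2 where X2: "free_res ?S (Theta C Q B) X2 e2 d2" "\<And>n. |X2 n| <o u"
    by (rule small_free_resolution_exists[OF B]) blast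
  obtain D \<iota> J bd \<epsilon> where real: "free_realization C u l P Q \<kappa> B X2 e2 d2 D \<iota> J bd \<epsilon>"
    by (rule free_realization_exists[OF X2(1) B X2(2)]) blast
  have "Ext_comparison C u l P Q \<kappa> B X2 e2 d2 D \<iota> J bd \<epsilon> E eE dE X eF dF \<phi> Y"
  proof (intro Ext_comparison.intro Ext_comparison_axioms.intro real E.lifting_resolution_axioms F.free_res_axioms \<phi> Y)
    show "eE \<cdot> \<phi> 0 c = eF c" if "c \<in> carrier (F.F 0)" for c
      using fun_cong[OF e\<phi>, of c] that Theta_arr_apply[OF E.e \<phi>H[OF that]] by (simp add: compose_eq)
    show "dE n \<cdot> \<phi> (Suc n) c = \<phi> n (dF n c)" if "c \<in> carrier (F.F (Suc n))" for c n
      using fun_cong[OF d\<phi>[of n], of c] that Theta_arr_apply[OF E.d \<phi>H[OF that]] by (simp add: compose_eq)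
  qed
  then show "Ext_map C Q X dF \<phi> Y i \<in> iso (Ext_group C E dE Y i) (lmod_Ext_group ?S X dF (Theta C Q Y) i)"
    by (rule Ext_comparison.Ext_map_iso)
qed

theorem theorem4p10:
  fixes B :: "('o, 'a) ab_category" and P Q :: 'o and \<iota> :: "'l \<Rightarrow> 'a"
    and l :: "'l rel" and u :: "'u rel"
  assumes "Card_order l"
    and "smallness_cardinal u l"
    and "abelian_category B"
    and "projective_generator B P"
    and "locally_presentable u (cardSuc l) B"
    and "presentable u (cardSuc l) B P"
    and "is_coproduct B (Field l) (\<lambda>_. P) Q \<iota>"
  shows "projective_generator B Q \<and> good B Q"
proof -
  have "Cinfinite (cardSuc l)" using assms(5) by (simp add: locally_presentable_def)
  then have "Cinfinite l" using cardSuc_finite[OF assms(1)] assms(1) by (simp add: cinfinite_def)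
  then interpret power_generator B u l P Q \<iota>
    using assms by (intro power_generator.intro power_generator_axioms.intro)
      (auto simp: locally_presentable_def projective_generator_def)
  show ?thesis using Q_projective Q_generator Q_good by (simp add: projective_generator_def)
qed

end
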